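(* Let $0<q<p\le1$ be fixed and let $\Delta=\Delta_n\in\mathbb N$. Consider the non-Markovian model started from $\mathsf{SBM}(n+\Delta_n,n,p,q)$, and set $$H=H(p,q)=\frac{\sqrt{p(2-p-q)}}{q}.$$ All asymptotics are as $n\to\infty$, and "asymptotically almost surely" means with probability tending to $1$. (i) For any $\varepsilon>0$, if $$\Delta_n\le\Big(\frac{p-q}{q}\Big)n-H\sqrt{n\log n}-\varepsilon\sqrt{\frac{n(\log\log n)^2}{\log n}},$$ then the dynamics halts asymptotically almost surely. (ii) For any sufficiently large constant $L=L(p,q)>0$, if $$\Delta_n\ge\Big(\frac{p-q}{q}\Big)n+L\sqrt{n\log n},$$ then $\mathbb P(\mathscr P_1)\to1$, i.e. opinion $+$ wins on the first day asymptotically almost surely. (iii) For any fixed constant $\delta>0$, if $$\Delta_n\ge\Big(\frac{p-q}{q}\Big)n-(H-\delta)\sqrt{n\log n},$$ then $\mathbb P(\mathscr P_2)\to1$, i.e. opinion $+$ wins on the second day asymptotically almost surely. (iv) For any $\varepsilon>0$, if $$\Delta_n\ge\Big(\frac{p-q}{q}\Big)n-H\sqrt{n\log n}+\varepsilon\sqrt{\frac{n(\log\log n)^2}{\log n}},$$ then $\mathbb P(\mathscr P_3)\to1$, i.e. opinion $+$ wins on the third day asymptotically almost surely. (v) Asymptotically almost surely opinion $-$ will not win, i.e. $\mathbb P(\mathscr M)=o(1)$.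
   Context: $\mathbb N=\{1,2,\dots\}$. Stochastic block model: $\mathsf{SBM}(m,n,p,q)$ is the random graph on $m+n$ vertices, each carrying a label $W_i\in\{-1,+1\}$, with $m$ vertices labelled $+1$ and $n$ vertices labelled $-1$; independently for each pair of distinct vertices $i,j$, the edge $(i,j)$ is present with probability $p$ if $W_iW_j=1$ and with probability $q$ otherwise. Majority rule: given a graph $(V,E_t)$ and opinions $W^{(t)}_i\in\{\pm1\}$, set $W^{(t+1)}_i=\mathrm{sign}\big(\sum_{j:(i,j)\in E_t}W^{(t)}_j\big)$ if this sum is nonzero, and $W^{(t+1)}_i=W^{(t)}_i$ otherwise, simultaneously for all $i$. Write $V^{(t)}_\pm=\{i:W^{(t)}_i=\pm1\}$. Non-Markovian model: the vertex set is $V=\{1,\dots,2n+\Delta\}$; initially $|V^{(0)}_+|=n+\Delta$, $|V^{(0)}_-|=n$, and $G_0=(V,E_0)\sim\mathsf{SBM}(n+\Delta,n,p,q)$ with communities $V_+^{(0)},V_-^{(0)}$. For each day $t\in\mathbb N$, the opinions $W^{(t)}$ are computed from $(G_{t-1},W^{(t-1)})$ by the majority rule. Then $G_t=(V,E_t)$ is formed as follows: for each pair $(i,j)$ with $W^{(t)}_i=W^{(t-1)}_i$ and $W^{(t)}_j=W^{(t-1)}_j$, the pair keeps its status ($(i,j)\in E_t$ iff $(i,j)\in E_{t-1}$); every other pair is resampled, independently of each other and of the past given $W^{(t)}$, being an edge of $G_t$ with probability $p$ if $W^{(t)}_iW^{(t)}_j=1$ and with probability $q$ otherwise. Events: $\mathscr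 P_t=\{|V^{(t)}_+|=2n+\Delta\}$ (opinion $+$ wins at day $t$), $\mathscr P=\bigcup_{t\in\mathbb N}\mathscr P_t$; $\mathscr M_t=\{|V^{(t)}_-|=2n+\Delta\}$, $\mathscr M=\bigcup_{t\in\mathbb N}\mathscr M_t$ (opinion $-$ wins eventually). "The dynamics halts" means that consensus is never reached (the event $(\mathscr P\cup\mathscr M)^c$ occurs) and, moreover, eventually no vertex changes opinion. *)

theory Defs
  imports "HOL-Probability.Probability" "HOL-Library.Ramsey"
begin

text \<open>
  A (simple) graph on a vertex set \<open>V\<close> is given by its edge set, a subset of \<open>[V]\<^bsup>2\<^esup>\<close>.
  Opinions are functions into \<open>int\<close>; only the values on \<open>V\<close>, which lie in \<open>{-1, 1}\<close>, matter.
\<close>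

type_synonym opinions = "nat \<Rightarrow> int"
type_synonym edges = "nat set set"

definition plus_side :: "nat set \<Rightarrow> opinions \<Rightarrow> nat set" where
  "plus_side V W = {i \<in> V. W i = 1}"

definition minus_side :: "nat set \<Rightarrow> opinions \<Rightarrow> nat set" where
  "minus_side V W = {i \<in> V. W i = -1}"

definition labelling :: "nat set \<Rightarrow> nat \<Rightarrow> nat \<Rightarrow> opinions \<Rightarrow> bool" where
  "labelling V m n W \<longleftrightarrow> (\<forall>i\<in>V. W i \<in> {-1, 1}) \<and>
     card (plus_side V W) = m \<and> card (minus_side V W) = n"

definition majority :: "nat set \<Rightarrow> edges \<Rightarrow> opinions \<Rightarrow> opinions" where
  "majority V E W = (\<lambda>i. let S = \<Sum>j\<in>{j \<in> V. {i, j} \<in> E}. W j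
                         in if S \<noteq> 0 then sgn S else W i)"

definition indep_graph :: "nat set \<Rightarrow> (nat set \<Rightarrow> real) \<Rightarrow> edges pmf" where
  "indep_graph V f =
     map_pmf (\<lambda>b. {e \<in> [V]\<^bsup>2\<^esup>. b e}) (Pi_pmf ([V]\<^bsup>2\<^esup>) False (\<lambda>e. bernoulli_pmf (f e)))"

text \<open>For \<open>e = {i, j}\<close> the product below is \<open>W i * W j\<close>.\<close>

definition edge_prob :: "real \<Rightarrow> real \<Rightarrow> opinions \<Rightarrow> nat set \<Rightarrow> real" where
  "edge_prob p q W e = (if (\<Prod>i\<in>e. W i) = 1 then p else q)"

text \<open>The stochastic block model with communities \<open>plus_side V W\<close> and \<open>minus_side V W\<close>.\<close>

definition sbm :: "real \<Rightarrow> real \<Rightarrow> nat set \<Rightarrow> opinions \<Rightarrow> edges pmf" where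
  "sbm p q V W = indep_graph V (edge_prob p q W)"

text \<open>
  The new graph after the opinions moved from \<open>W\<close> to \<open>W'\<close>: keeping the status of a pair is
  expressed by the degenerate edge probabilities 1 and 0.
\<close>

definition rewire :: "real \<Rightarrow> real \<Rightarrow> nat set \<Rightarrow> edges \<Rightarrow> opinions \<Rightarrow> opinions \<Rightarrow> edges pmf" where
  "rewire p q V E W W' = indep_graph V
     (\<lambda>e. if \<forall>i\<in>e. W' i = W i then of_bool (e \<in> E) else edge_prob p q W' e)"

text \<open>
  The opinions alone are not Markovian, but the pairs \<open>(W\<^sup>(\<^sup>t\<^sup>), E\<^sub>t)\<close> of opinions and graph are;
  the law of the whole trajectory is the measure with these transition probabilities
  provided by the Ionescu-Tulcea theorem.
\<close>

type_synonym state = "opinions \<times> edges"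

definition initial_law :: "real \<Rightarrow> real \<Rightarrow> nat set \<Rightarrow> opinions \<Rightarrow> state pmf" where
  "initial_law p q V w = map_pmf (\<lambda>E. (w, E)) (sbm p q V w)"

definition next_day :: "real \<Rightarrow> real \<Rightarrow> nat set \<Rightarrow> state \<Rightarrow> state pmf" where
  "next_day p q V = (\<lambda>(W, E). let W' = majority V E W
                         in map_pmf (\<lambda>E'. (W', E')) (rewire p q V E W W'))"

definition transition ::
  "real \<Rightarrow> real \<Rightarrow> nat set \<Rightarrow> opinions \<Rightarrow> nat \<Rightarrow> (nat \<Rightarrow> state) \<Rightarrow> state measure" where
  "transition p q V w t \<omega> =
     measure_pmf (case t of 0 \<Rightarrow> initial_law p q V w | Suc s \<Rightarrow> next_day p q V (\<omega> s))"

definition trajectory_law ::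
  "real \<Rightarrow> real \<Rightarrow> nat set \<Rightarrow> opinions \<Rightarrow> (nat \<Rightarrow> state) measure" where
  "trajectory_law p q V w =
     projective_family.lim UNIV
       (Ionescu_Tulcea.CI (transition p q V w) (\<lambda>_. count_space UNIV)) (\<lambda>_. count_space UNIV)"

interpretation process: Ionescu_Tulcea "transition p q V w" "\<lambda>_. count_space UNIV" for p q V w
proof (rule Ionescu_Tulcea.intro, goal_cases)
  case (1 i)
  show "transition p q V w i \<in> measurable (PiM {0..<i} (\<lambda>_. count_space UNIV))
          (subprob_algebra (count_space UNIV))"
  proof (cases i)
    case 0
    then show ?thesis
      by (simp add: transition_def[abs_def] measurable_const space_subprob_algebra
          measure_pmf.subprob_space_axioms)
  next
    case (Suc s)
    have comp: "(\<lambda>\<omega>. \<omega> s) \<in> measurable (PiM {0..<Suc s} (\<lambda>_. count_space UNIV)) (count_space UNIV)"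
      by (rule measurable_component_singleton) simp
    have "(\<lambda>x. measure_pmf (next_day p q V x)) \<in>
        measurable (count_space UNIV) (subprob_algebra (count_space UNIV))"
      by (simp add: space_subprob_algebra measure_pmf.subprob_space_axioms)
    from measurable_compose[OF comp this] show ?thesis
      by (simp add: Suc transition_def[abs_def])
  qed
next
  case (2 i x)
  show "prob_space (transition p q V w i x)"
    by (simp add: transition_def measure_pmf.prob_space_axioms)
qed

lemma sets_trajectory_law [measurable_cong]:
  "sets (trajectory_law p q V w) = sets (PiM UNIV (\<lambda>_. count_space UNIV))"
  unfolding trajectory_law_def by (rule process.PF.sets_lim)

lemma prob_space_trajectory_law: "prob_space (trajectory_law p q V w)"
proof -
  let ?M = "trajectory_law p q V w"
  have "distr ?M (PiM {0} (\<lambda>_. count_space UNIV)) (\<lambda>\<omega>. restrict \<omega> {0}) =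
      Ionescu_Tulcea.CI (transition p q V w) (\<lambda>_. count_space UNIV) {0}"
    unfolding trajectory_law_def by (rule process.distr_lim) simp
  then have "prob_space (distr ?M (PiM {0} (\<lambda>_. count_space UNIV)) (\<lambda>\<omega>. restrict \<omega> {0}))"
    using process.PF.prob_space_P[of "{0}", where p=p and q=q and V=V and w=w] by simp
  moreover have "(\<lambda>\<omega>. restrict \<omega> {0}) \<in> measurable ?M (PiM {0} (\<lambda>_. count_space UNIV))"
    unfolding measurable_cong_sets[OF sets_trajectory_law refl]
    by (rule measurable_restrict_subset) simp
  ultimately show ?thesis
    by (rule prob_space_distrD[rotated])
qed

lemma space_trajectory_law [simp]: "space (trajectory_law p q V w) = UNIV"
  using sets_eq_imp_space_eq[OF sets_trajectory_law] by (simp add: space_PiM)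


lemma process_C_singleton:
  "emeasure (process.C p q V w 0 n (\<lambda>_. undefined)) {restrict x {0..<n}} =
     (\<Prod>s<n. emeasure (transition p q V w s x) {x s})"
proof (induction n)
  case 0
  show ?case
    by (simp add: PiM_empty emeasure_return restrict_def)
next
  case (Suc n)
  let ?U = "\<lambda>_. count_space UNIV :: state measure"
  let ?C = "process.C p q V w 0 n (\<lambda>_. undefined)"
  let ?x = "\<lambda>n. restrict x {0..<n}"
  have sing: "{?x m} \<in> sets (PiM {0..<m} ?U)" for m
    using sets_PiM_I_finite[of "{0..<m}" "\<lambda>s. {restrict x {0..<m} s}" ?U]
    by (simp add: PiE_singleton del: restrict_apply)
  have x0: "(\<lambda>_. undefined) \<in> space (PiM {0..<0::nat} ?U)"
    by (simp add: space_PiM)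
  have space_C: "space ?C = space (PiM {0..<n} ?U)"
    using process.space_C[OF x0, where m=n and p=p and q=q and V=V and w=w] by simp
  have sets_C: "sets ?C = sets (PiM {0..<n} ?U)"
    using process.sets_C[OF x0, where m=n and p=p and q=q and V=V and w=w] by simp
  have ne: "space ?C \<noteq> {}"
    by (simp add: space_C space_PiM PiE_eq_empty_iff)
  have inner: "emeasure (process.eP p q V w n y) {?x (Suc n)} =
      emeasure (transition p q V w n x) {x n} * indicator {?x n} y" if y: "y \<in> space ?C" for y
  proof -
    have y': "y \<in> space (PiM {0..<n} ?U)"
      using y by (simp add: space_C)
    have "emeasure (process.eP p q V w n y) {?x (Suc n)} =
        emeasure (transition p q V w n y) ((\<lambda>z. y(n := z)) -` {?x (Suc n)})"
      using process.emeasure_eP[OF y' sing, where p=p and q=q and V=V and w=w] by simp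
    also have "(\<lambda>z. y(n := z)) -` {?x (Suc n)} = (if y = ?x n then {x n} else {})"
    proof -
      have "y(n := z) = ?x (Suc n) \<longleftrightarrow> y = ?x n \<and> z = x n" for z
      proof
        assume eq: "y(n := z) = ?x (Suc n)"
        have "z = x n"
          using fun_cong[OF eq, of n] by simp
        moreover have "y i = ?x n i" for i
          using fun_cong[OF eq, of i] y'
          by (cases "i = n") (auto simp: space_PiM PiE_def extensional_def split: if_splits)
        ultimately show "y = ?x n \<and> z = x n"
          by auto
      qed (auto simp: fun_eq_iff restrict_def)
      then show ?thesis
        by (auto simp: vimage_def)
    qed
    also have "emeasure (transition p q V w n y) \<dots> =
        emeasure (transition p q V w n x) {x n} * indicator {?x n} y"
      by (cases n) (auto simp: transition_def)
    finally show ?thesis .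
  qed
  have "process.eP p q V w n \<in> measurable ?C (subprob_algebra (PiM {0..<Suc n} ?U))"
    unfolding measurable_cong_sets[OF sets_C refl] by (rule process.measurable_eP)
  from emeasure_bind[OF ne this sing]
  have "emeasure (process.C p q V w 0 (Suc n) (\<lambda>_. undefined)) {?x (Suc n)} =
      (\<integral>\<^sup>+y. emeasure (process.eP p q V w n y) {?x (Suc n)} \<partial>?C)"
    by simp
  also have "\<dots> = (\<integral>\<^sup>+y. emeasure (transition p q V w n x) {x n} * indicator {?x n} y \<partial>?C)"
    by (rule nn_integral_cong) (rule inner)
  also have "\<dots> = emeasure (transition p q V w n x) {x n} * emeasure ?C {?x n}"
    using sing by (simp add: nn_integral_cmult_indicator sets_C)
  finally show ?case
    unfolding Suc.IH by (simp only: prod.lessThan_Suc mult.commute)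
qed

text \<open>The finite-dimensional distributions, which determine the law.\<close>

lemma trajectory_law_cylinder:
  "measure (trajectory_law p q V w) {\<omega>. \<forall>s\<le>t. \<omega> s = x s} =
     pmf (initial_law p q V w) (x 0) * (\<Prod>s<t. pmf (next_day p q V (x s)) (x (Suc s)))"
proof -
  let ?U = "\<lambda>_. count_space UNIV :: state measure"
  let ?J = "{0..<Suc t}"
  have sing: "{restrict x ?J} \<in> sets (PiM ?J ?U)"
    using sets_PiM_I_finite[of ?J "\<lambda>s. {restrict x ?J s}" ?U]
    by (simp add: PiE_singleton del: restrict_apply)
  have emb: "{\<omega>. \<forall>s\<le>t. \<omega> s = x s} = prod_emb UNIV ?U ?J {restrict x ?J}"
    by (auto simp: prod_emb_def space_PiM fun_eq_iff restrict_def less_Suc_eq_le split: if_splits)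
  have sub: "{restrict x ?J} \<subseteq> space (PiM ?J ?U)"
    by (auto simp: space_PiM)
  have "emeasure (trajectory_law p q V w) {\<omega>. \<forall>s\<le>t. \<omega> s = x s} =
      emeasure (process.CI p q V w ?J) {restrict x ?J}"
    unfolding emb trajectory_law_def by (rule process.lim) (use sing in auto)
  also have "\<dots> = emeasure (process.C p q V w 0 (Suc t) (\<lambda>_. undefined)) {restrict x ?J}"
    using process.emeasure_CI[OF subset_refl sing, where p=p and q=q and V=V and w=w] sub
    by (simp only: prod_emb_id[OF sub[unfolded space_PiM]])
  also have "\<dots> = (\<Prod>s<Suc t. ennreal (measure (transition p q V w s x) {x s}))"
    unfolding process_C_singleton
    by (intro prod.cong refl) (simp add: transition_def measure_pmf.emeasure_eq_measure)
  also have "\<dots> = ennreal (\<Prod>s<Suc t. measure (transition p q V w s x) {x s})"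
    by (rule prod_ennreal) simp
  finally have "measure (trajectory_law p q V w) {\<omega>. \<forall>s\<le>t. \<omega> s = x s} =
      (\<Prod>s<Suc t. measure (transition p q V w s x) {x s})"
    by (simp add: measure_def prod_nonneg del: prod.lessThan_Suc)
  then show ?thesis
    unfolding prod.lessThan_Suc_shift by (simp add: transition_def measure_pmf_single)
qed

definition opinion :: "(nat \<Rightarrow> state) \<Rightarrow> nat \<Rightarrow> opinions" where
  "opinion \<omega> t = fst (\<omega> t)"

definition plus_wins_on :: "nat set \<Rightarrow> nat \<Rightarrow> (nat \<Rightarrow> state) set" where
  "plus_wins_on V t = {\<omega>. card (plus_side V (opinion \<omega> t)) = card V}"

definition minus_wins_on :: "nat set \<Rightarrow> nat \<Rightarrow> (nat \<Rightarrow> state) set" where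
  "minus_wins_on V t = {\<omega>. card (minus_side V (opinion \<omega> t)) = card V}"

definition plus_wins :: "nat set \<Rightarrow> (nat \<Rightarrow> state) set" where
  "plus_wins V = (\<Union>t\<in>{1..}. plus_wins_on V t)"

definition minus_wins :: "nat set \<Rightarrow> (nat \<Rightarrow> state) set" where
  "minus_wins V = (\<Union>t\<in>{1..}. minus_wins_on V t)"

definition halts :: "nat set \<Rightarrow> (nat \<Rightarrow> state) set" where
  "halts V = - (plus_wins V \<union> minus_wins V) \<inter>
     {\<omega>. \<exists>T. \<forall>t\<ge>T. \<forall>i\<in>V. opinion \<omega> (Suc t) i = opinion \<omega> t i}"

lemma sets_trajectory_lawI:
  "{\<omega>. Q (\<omega> t)} \<in> sets (trajectory_law p q V w)"
proof -
  have "(\<lambda>\<omega>. \<omega> t) \<in> measurable (trajectory_law p q V w) (count_space UNIV)"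
    unfolding measurable_cong_sets[OF sets_trajectory_law refl]
    by (rule measurable_component_singleton) simp
  from measurable_sets[OF this, of "Collect Q"] show ?thesis
    by (simp add: vimage_def)
qed

lemma sets_wins_on [measurable]:
  "plus_wins_on U t \<in> sets (trajectory_law p q V w)"
  "minus_wins_on U t \<in> sets (trajectory_law p q V w)"
  unfolding plus_wins_on_def minus_wins_on_def opinion_def by (rule sets_trajectory_lawI)+

lemma sets_wins [measurable]:
  "plus_wins U \<in> sets (trajectory_law p q V w)"
  "minus_wins U \<in> sets (trajectory_law p q V w)"
  unfolding plus_wins_def minus_wins_def by auto

lemma sets_halts [measurable]:
  assumes "finite U"
  shows "halts U \<in> sets (trajectory_law p q V w)"
proof -
  let ?M = "trajectory_law p q V w"
  have val: "{\<omega>. opinion \<omega> t i = c} \<in> sets ?M" for t i c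
    unfolding opinion_def by (rule sets_trajectory_lawI)
  have same: "{\<omega>. opinion \<omega> (Suc t) i = opinion \<omega> t i} \<in> sets ?M" for t i
  proof -
    have "{\<omega>. opinion \<omega> (Suc t) i = opinion \<omega> t i} =
        (\<Union>c. {\<omega>. opinion \<omega> (Suc t) i = c} \<inter> {\<omega>. opinion \<omega> t i = c})"
      by auto
    also have "\<dots> \<in> sets ?M"
      by (rule sets.countable_UN') (auto intro: sets.Int[OF val val])
    finally show ?thesis .
  qed
  have day: "{\<omega>. \<forall>i\<in>U. opinion \<omega> (Suc t) i = opinion \<omega> t i} \<in> sets ?M" for t
    using sets.sets_Collect_finite_All[OF _ assms, of ?M "\<lambda>i \<omega>. opinion \<omega> (Suc t) i = opinion \<omega> t i"]
      same by simp
  have "{\<omega>. \<exists>T. \<forall>t\<ge>T. \<forall>i\<in>U. opinion \<omega> (Suc t) i = opinion \<omega> t i} =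
      (\<Union>T. \<Inter>t\<in>{T..}. {\<omega>. \<forall>i\<in>U. opinion \<omega> (Suc t) i = opinion \<omega> t i})"
    by auto
  also have "\<dots> \<in> sets ?M"
    by (intro sets.countable_UN' sets.countable_INT' day) (auto intro: day)
  finally have stable: "{\<omega>. \<exists>T. \<forall>t\<ge>T. \<forall>i\<in>U. opinion \<omega> (Suc t) i = opinion \<omega> t i} \<in> sets ?M" .
  have "- (plus_wins U \<union> minus_wins U) \<in> sets ?M"
    using sets.compl_sets[OF sets.Un[OF sets_wins], of p q V w U U]
    by (simp add: Compl_eq_Diff_UNIV)
  then show ?thesis
    unfolding halts_def using stable by (rule sets.Int)
qed

definition threshold_const :: "real \<Rightarrow> real \<Rightarrow> real" where
  "threshold_const p q = sqrt (p * (2 - p - q)) / q"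

text \<open>
  Which vertices start with which opinion is not prescribed: \<open>w n\<close> is an arbitrary
  labelling of \<open>{1..2 * n + \<Delta> n}\<close> with the prescribed community sizes.
\<close>

definition valid_start :: "(nat \<Rightarrow> nat) \<Rightarrow> (nat \<Rightarrow> opinions) \<Rightarrow> bool" where
  "valid_start \<Delta> w \<longleftrightarrow> (\<forall>n\<ge>1. \<Delta> n \<ge> 1 \<and> labelling {1..2 * n + \<Delta> n} (n + \<Delta> n) n (w n))"

definition model_prob ::
  "real \<Rightarrow> real \<Rightarrow> (nat \<Rightarrow> nat) \<Rightarrow> (nat \<Rightarrow> opinions) \<Rightarrow> nat \<Rightarrow>
     (nat set \<Rightarrow> (nat \<Rightarrow> state) set) \<Rightarrow> real" where
  "model_prob p q \<Delta> w n A =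
     measure (trajectory_law p q {1..2 * n + \<Delta> n} (w n)) (A {1..2 * n + \<Delta> n})"

end

theory Submission
  imports Defs "HOL-Real_Asymp.Real_Asymp"
begin

text \<open>
  Write \<open>S\<^sub>0(v)\<close> for the number of plus neighbours minus the number of minus neighbours of a vertex
  in the initial graph. With overwhelming probability no plus vertex ever turns minus: this holds
  on the first day by Hoeffding's inequality, and a vertex that has just turned plus sees a fresh
  neighbourhood, which has a linear surplus of plus vertices. On such trajectories the set \<open>R\<close> of
  converted vertices only grows, and an unconverted vertex \<open>v\<close> has current sum between
  \<open>S\<^sub>0(v) + |N(v) \<inter> R|\<close> and \<open>S\<^sub>0(v) + 2|R|\<close>. Hence everything reduces to the counts
  \<open>N(s) = |{v. S\<^sub>0(v) > -s}|\<close> over the minus vertices \<open>v\<close>: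
  if \<open>N(2\<mu>) < \<mu>\<close> for some \<open>\<mu> \<le> n\<close>, then \<open>R\<close> never leaves \<open>{v. S\<^sub>0(v) > -2\<mu>}\<close> and the dynamics halts,
  which avoids following the dynamics over several days; conversely \<open>N(0)\<close> vertices turn on day one,
  their resampled edges convert at least \<open>N(c N(0))\<close> vertices by day two, and once \<open>R\<close> has more
  than a constant times \<open>sqrt(n log n)\<close> elements it converts everybody.

  The sums \<open>S\<^sub>0(v)\<close> are differences of two independent binomials. Near the threshold the factor
  \<open>1 / sqrt(log n)\<close> in their moderate deviations matters, so they are estimated by exponential
  tilting together with two-sided local bounds of order \<open>1 / sqrt n\<close> for the tilted binomial.
  First and second moments then control the counts.
\<close>

section \<open>Local bounds for the binomial distribution\<close>

text \<open>With p n / q plus vertices the initial sum of a minus vertex has mean about 0 and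
  variance about \<open>\<sigma>\<^sup>2 * n\<close>, where
  \<open>\<sigma>\<^sup>2 = p * (2 - p - q)\<close>. Removing H sqrt(n log n) of them, H = \<sigma>
  / q, moves the mean to - \<sigma> sqrt(n log n). Being nonnegative then has probability of order
  n^(-1/2) / sqrt(log n), so about sqrt(n / log n) vertices turn on day one. The matching tilt is x
  = sqrt(log n / n) / \<sigma>, and shifting a sum by s multiplies the tail by exp(x s). So
  conversions feed back only once their number reaches order 1 / x, which is again sqrt(n / log n).
  This coincidence makes H critical and is why Chernoff's bound is too weak here. A displacement by
  \<epsilon> times \<open>window n\<close> changes the counts by a power of log n, which tips the
  balance.

  The value p = 1 is allowed, and there the second binomial degenerates. Hence local bounds are
  applied only to the binomial with parameter q; the other one is summed exactly against an
  exponential or, for lower bounds, confined by Hoeffding's inequality.\<close>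

lemma pmf_binomial_Suc:
  assumes "0 \<le> r" "r \<le> 1" "k \<le> a"
  shows "pmf (binomial_pmf a r) (Suc k) * ((real k + 1) * (1 - r)) =
    pmf (binomial_pmf a r) k * ((real a - real k) * r)"
proof (cases "k < a")
  case True
  have "Suc k * (a choose Suc k) = (a - k) * (a choose k)"
    by (simp only: binomial_absorption binomial_absorb_comp)
  then have eq: "(real k + 1) * real (a choose Suc k) = (real a - real k) * real (a choose k)"
    by (metis assms(3) of_nat_Suc of_nat_diff of_nat_mult add.commute)
  have "(1 - r) ^ (a - k) = (1 - r) * (1 - r) ^ (a - Suc k)"
    using True by (metis Suc_diff_Suc power_Suc)
  then show ?thesis
    using assms eq by (simp add: mult_ac pmf_binomial)
next
  case False
  then show ?thesis using assms by (simp add: pmf_binomial)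
qed

declare pmf_binomial [simp del]

text \<open>Inside a window of width of order \<open>sqrt a\<close> around the mean consecutive ratios are
  \<open>1 + O(1 / sqrt a)\<close>, so that all point masses there are comparable.\<close>

lemma pmf_binomial_window_chain:
  assumes \<rho>: "0 < \<rho>" "\<rho> \<le> r" "r \<le> 1 - \<rho>" and M: "1 \<le> M"
    and a: "8 * M / (\<rho> * (1 - \<rho>)) \<le> sqrt (real a)"
    and k: "\<bar>real k - real a * r\<bar> \<le> M * sqrt (real a)"
    and k': "\<bar>real k' - real a * r\<bar> \<le> M * sqrt (real a)"
  shows "exp (- 16 * M\<^sup>2 / (\<rho> * (1 - \<rho>))) * pmf (binomial_pmf a r) k \<le> pmf (binomial_pmf a r) k'"
proof -
  define w where "w = \<rho> * (1 - \<rho>)"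
  \<comment> \<open>Relative error per step: both sides of the ratio are at least w a / 2 and differ
    by at most 2 M sqrt a, and \<open>\<tau>\<close> is the quotient of these bounds.\<close>
  define \<tau> where "\<tau> = 4 * M / (w * sqrt a)"
  let ?f = "pmf (binomial_pmf a r)"
  have w0: "0 < w" using \<rho> by (simp add: w_def)
  have sa: "0 < sqrt a" 
    using a M w0 by (smt (verit) divide_pos_pos w_def)
  have aa: "sqrt a * sqrt a = a" by simp
  have \<tau>: "0 < \<tau>" "\<tau> \<le> 1/2"
    using a M w0 sa unfolding \<tau>_def w_def[symmetric] by (auto simp: field_simps)
  have rw: "w \<le> r * (1 - r)"
  proof -
    have "r * (1 - r) - w = (r - \<rho>) * (1 - \<rho> - r)"
      by (simp add: w_def algebra_simps)
    moreover have "(r - \<rho>) * (1 - \<rho> - r) \<ge> 0"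
      using \<rho> by simp
    ultimately show ?thesis by simp
  qed
  have Msa: "8 * M * sqrt a \<le> w * a"
  proof -
    have "8 * M \<le> w * sqrt a" using a w0 by (simp add: w_def[symmetric] field_simps)
    then have "8 * M * sqrt a \<le> w * sqrt a * sqrt a" using sa by (intro mult_right_mono) auto
    then show ?thesis by (simp add: mult.assoc)
  qed
  have sa1: "1 \<le> sqrt a"
  proof -
    have "w \<le> 1" using \<rho> by (simp add: w_def mult_le_one)
    then have "1 \<le> 8 * M / w" using M w0 by (simp add: field_simps)
    then show ?thesis using a unfolding w_def[symmetric] by linarith
  qed
  have Ms: "1 \<le> M * sqrt a" using mult_mono[OF M sa1] M by simp
  have step: "(1 - \<tau>) * ?f j \<le> ?f (Suc j) \<and> (1 - \<tau>) * ?f (Suc j) \<le> ?f j"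
    if j: "\<bar>real j - real a * r\<bar> \<le> M * sqrt (real a)" for j
  proof -
    define d where "d = real j - a * r"
    define A where "A = (real a - real j) * r"
    define D where "D = (real j + 1) * (1 - r)"
    have d: "\<bar>d\<bar> \<le> M * sqrt a" using j by (simp add: d_def)
    have Aeq: "A = a * (r * (1 - r)) - d * r" by (simp add: A_def d_def algebra_simps)
    have Deq: "D = a * (r * (1 - r)) + (d + 1) * (1 - r)" by (simp add: D_def d_def algebra_simps)
    have v: "w * a \<le> a * (r * (1 - r))" using rw by (metis mult.commute mult_left_mono of_nat_0_le_iff)
    have "\<bar>d * r\<bar> \<le> \<bar>d\<bar>" "\<bar>d * (1 - r)\<bar> \<le> \<bar>d\<bar>"
      using \<rho> by (simp_all add: abs_mult mult_left_le)
    then have dr: "\<bar>d * r\<bar> \<le> M * sqrt a" and dr': "\<bar>d * (1 - r)\<bar> \<le> M * sqrt a"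
      using d by linarith+
    have A0: "w * a / 2 \<le> A"
      using dr v Msa Aeq Ms by (simp add: abs_le_iff)
    have D0: "w * a / 2 \<le> D"
      using dr' v Msa Deq Ms \<rho> by (simp add: abs_le_iff distrib_right)
    have "A - D = - d - 1 + r" by (simp add: Aeq Deq algebra_simps)
    then have "\<bar>A - D\<bar> \<le> M * sqrt a + 1" using d \<rho> by linarith
    also have "\<dots> \<le> 2 * M * sqrt a" 
      using mult_mono[OF M sa1] M by simp
    finally have AD: "\<bar>A - D\<bar> \<le> 2 * M * sqrt a" .
    have t: "\<tau> * (w * a / 2) = 2 * M * sqrt a"
      using w0 sa aa unfolding \<tau>_def by (simp add: field_simps)
    have tA: "2 * M * sqrt a \<le> \<tau> * A" "2 * M * sqrt a \<le> \<tau> * D"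
      using mult_left_mono[OF A0, of \<tau>, unfolded t] mult_left_mono[OF D0, of \<tau>, unfolded t] \<tau>(1) by auto
    have AD': "(1 - \<tau>) * D \<le> A" "(1 - \<tau>) * A \<le> D"
      using tA AD by (auto simp: algebra_simps abs_le_iff)
    have pos: "0 < A" "0 < D" using A0 D0 mult_pos_pos[OF w0, of "real a"] sa by auto
    have ja: "j \<le> a" using pos(1) \<rho> by (simp add: A_def zero_less_mult_iff)
    have eq: "?f (Suc j) * D = ?f j * A"
      using pmf_binomial_Suc[of r j a] ja \<rho> by (simp add: A_def D_def)
    have "(1 - \<tau>) * ?f j * D \<le> ?f (Suc j) * D"
      using mult_left_mono[OF AD'(1) pmf_nonneg[of "binomial_pmf a r" j]] unfolding eq by (simp only: mult_ac)
    moreover have "(1 - \<tau>) * ?f (Suc j) * A \<le> ?f j * A"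
      using mult_left_mono[OF AD'(2) pmf_nonneg[of "binomial_pmf a r" "Suc j"]] unfolding eq[symmetric] by (simp only: mult_ac)
    ultimately show ?thesis using pos by simp
  qed
  have chain: "(1 - \<tau>) ^ i * ?f j \<le> ?f (j + i) \<and> (1 - \<tau>) ^ i * ?f (j + i) \<le> ?f j"
    if j: "\<bar>real j - real a * r\<bar> \<le> M * sqrt (real a)" 
      and ji: "\<bar>real (j + i) - real a * r\<bar> \<le> M * sqrt (real a)" for i j
    using ji
  proof (induction i)
    case 0
    then show ?case by simp
  next
    case (Suc i)
    have win: "\<bar>real (j + i) - real a * r\<bar> \<le> M * sqrt (real a)"
      using j Suc.prems by (auto simp: abs_le_iff)
    note IH = Suc.IH[OF win] and S = step[OF win]
    have n: "0 \<le> 1 - \<tau>" using \<tau> by simp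
    have "(1 - \<tau>) ^ Suc i * ?f j \<le> ?f (j + Suc i)"
      using mult_left_mono[OF conjunct1[OF IH] n] S by simp
    moreover have "(1 - \<tau>) ^ Suc i * ?f (j + Suc i) \<le> ?f j"
      using mult_left_mono[OF conjunct2[OF S] zero_le_power[OF n, of i]] IH
      by (simp add: mult_ac)
    ultimately show ?case by simp
  qed
  \<comment> \<open>Two window points are at most \<open>2 * M * sqrt a\<close> apart, and each step
    costs at most a factor exp(- 2 \<tau>); the product is the exponent 4 \<tau> M sqrt a = 16 M^2 /
    w.\<close>
  have pow: "exp (- 16 * M\<^sup>2 / w) \<le> (1 - \<tau>) ^ i" if i: "real i \<le> 2 * M * sqrt a" for i
  proof -
    have "- (2 * \<tau>) \<le> ln (1 - \<tau>)"
      using ln_one_minus_pos_lower_bound[of \<tau>] \<tau> mult_left_mono[of \<tau> "1/2" \<tau>]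
      unfolding power2_eq_square by linarith
    then have 1: "exp (- (2 * \<tau>)) \<le> 1 - \<tau>"
      using \<tau> exp_le_cancel_iff[of "- (2 * \<tau>)" "ln (1 - \<tau>)"] by (simp del: exp_le_cancel_iff)
    have "2 * \<tau> * real i \<le> 2 * \<tau> * (2 * M * sqrt a)"
      using i \<tau> by (intro mult_left_mono) auto
    also have "\<dots> = 16 * M\<^sup>2 / w"
      using w0 sa by (simp add: \<tau>_def field_simps power2_eq_square)
    finally have "exp (- 16 * M\<^sup>2 / w) \<le> exp (- (2 * \<tau>) * real i)"
      by simp
    also have "\<dots> = exp (- (2 * \<tau>)) ^ i"
      by (simp add: exp_of_nat_mult[symmetric] mult.commute)
    also have "\<dots> \<le> (1 - \<tau>) ^ i"
      using 1 by (intro power_mono) auto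
    finally show ?thesis .
  qed
  show ?thesis
  proof (cases "k \<le> k'")
    case True
    then obtain i where i: "k' = k + i" using le_Suc_ex by blast
    have "real i \<le> 2 * M * sqrt a" using k k' i by (auto simp: abs_le_iff)
    from mult_right_mono[OF pow[OF this], of "?f k"] chain[of k i] k k' i
    show ?thesis by (simp add: w_def)
  next
    case False
    then obtain i where i: "k = k' + i" by (metis le_Suc_ex nat_le_linear)
    have "real i \<le> 2 * M * sqrt a" using k k' i by (auto simp: abs_le_iff)
    from mult_right_mono[OF pow[OF this], of "?f k"] chain[of k' i] k k' i
    show ?thesis by (simp add: w_def)
  qed
qed

lemma card_nat_window:
  assumes "0 \<le> l" "l \<le> u"
  shows "finite {k::nat. l \<le> real k \<and> real k \<le> u}"
    and "real (card {k::nat. l \<le> real k \<and> real k \<le> u}) \<le> u - l + 1"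
    and "u - l - 1 \<le> real (card {k::nat. l \<le> real k \<and> real k \<le> u})"
proof -
  have eq: "{k::nat. l \<le> real k \<and> real k \<le> u} = {nat \<lceil>l\<rceil>..nat \<lfloor>u\<rfloor>}"
    using assms by (auto simp: le_nat_iff nat_le_iff ceiling_le_iff le_floor_iff)
  show "finite {k::nat. l \<le> real k \<and> real k \<le> u}" by (simp add: eq)
  have "real (nat \<lceil>l\<rceil>) \<ge> l" "real (nat \<lceil>l\<rceil>) \<le> l + 1" "real (nat \<lfloor>u\<rfloor>) \<le> u" "real (nat \<lfloor>u\<rfloor>) \<ge> u - 1"
    using assms by linarith+
  then show "real (card {k::nat. l \<le> real k \<and> real k \<le> u}) \<le> u - l + 1"
    and "u - l - 1 \<le> real (card {k::nat. l \<le> real k \<and> real k \<le> u})"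
    using assms(2) unfolding eq card_atLeastAtMost by linarith+
qed

text \<open>Hoeffding bounds each tail beyond \<open>M * sqrt a\<close> by exp(- 2 M^2), which is at
  most exp(- 2) and hence at most 1/4.\<close>

lemma binomial_central_window:
  assumes r: "0 \<le> r" "r \<le> 1" and M: "1 \<le> M" and a: "0 < a"
  shows "1 / 2 \<le> measure_pmf.prob (binomial_pmf a r) {k. \<bar>real k - real a * r\<bar> \<le> M * sqrt (real a)}"
proof -
  have bd: "binomial_distribution r"
    using r by unfold_locales auto
  let ?P = "measure_pmf.prob (binomial_pmf a r)"
  have sq: "exp (- 2 * (M * sqrt a)\<^sup>2 / a) = exp (- 2 * M\<^sup>2)"
    using a by (simp add: power_mult_distrib)
  have "2 \<le> exp (1::real)" using exp_ge_add_one_self[of 1] by simp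
  then have "4 \<le> exp (1::real) * exp 1"
    using mult_mono[of 2 "exp 1" 2 "exp (1::real)"] by simp
  then have e2: "exp (- 2) \<le> (1/4 :: real)"
    by (simp add: exp_minus exp_add[symmetric] field_simps)
  have "1 \<le> M\<^sup>2" using M by (simp add: one_le_power)
  then have e: "exp (- 2 * M\<^sup>2) \<le> 1/4"
    using e2 by (smt (verit) exp_le_cancel_iff)
  have 1: "?P {k. real k \<le> a * r - M * sqrt a} \<le> 1/4"
    using binomial_distribution.prob_le[OF bd, of a "M * sqrt a"] a M e unfolding sq by simp
  have 2: "?P {k. a * r + M * sqrt a \<le> real k} \<le> 1/4"
    using binomial_distribution.prob_ge[OF bd, of a "M * sqrt a"] a M e unfolding sq by simp
  have "1 = ?P UNIV" by simp
  also have "\<dots> \<le> ?P ({k. \<bar>real k - real a * r\<bar> \<le> M * sqrt (real a)} \<union>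
      ({k. real k \<le> a * r - M * sqrt a} \<union> {k. a * r + M * sqrt a \<le> real k}))"
    by (intro measure_pmf.finite_measure_mono) auto
  also have "\<dots> \<le> ?P {k. \<bar>real k - real a * r\<bar> \<le> M * sqrt (real a)} +
      (?P {k. real k \<le> a * r - M * sqrt a} + ?P {k. a * r + M * sqrt a \<le> real k})"
    by (intro order_trans[OF measure_Un_le] add_left_mono measure_Un_le) auto
  finally show ?thesis using 1 2 by linarith
qed

text \<open>The size condition on \<open>a\<close> keeps the window inside the nonnegative reals, so
  that its integers can be counted with \<open>card_nat_window\<close>.\<close>

lemma window_arith:
  assumes \<rho>: "0 < \<rho>" "\<rho> \<le> r" "r \<le> 1 - \<rho>" and M: "1 \<le> M"
    and a: "8 * M / (\<rho> * (1 - \<rho>)) \<le> sqrt (real a)"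
  shows "1 \<le> sqrt (real a)" and "0 \<le> real a * r - M * sqrt (real a)"
proof -
  define w where "w = \<rho> * (1 - \<rho>)"
  have w: "0 < w" "w \<le> 1" "w \<le> \<rho>" using \<rho> by (auto simp: w_def mult_le_one mult_left_le)
  have "8 * M \<le> w * sqrt a" using a w by (simp add: w_def[symmetric] field_simps)
  also have "\<dots> \<le> \<rho> * sqrt a" using w by (intro mult_right_mono) auto
  finally have 1: "8 * M \<le> \<rho> * sqrt a" .
  also have "\<dots> \<le> 1 * sqrt a" using \<rho> by (intro mult_right_mono) auto
  finally show s1: "1 \<le> sqrt (real a)" using M by linarith
  have "M * sqrt a \<le> \<rho> * sqrt a * sqrt a"
    using 1 M s1 by (intro mult_right_mono) auto
  also have "\<dots> = a * \<rho>" by (simp add: mult_ac)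
  also have "\<dots> \<le> a * r" using \<rho> by (intro mult_left_mono) auto
  finally show "0 \<le> real a * r - M * sqrt (real a)" by simp
qed

text \<open>Half of the mass lies in a window of at most 3 M sqrt a integers whose point masses are
  comparable, so each of them carries its share. The constant is uniform in \<open>a\<close> and
  \<open>r\<close> because the tilted parameter will vary with n.\<close>

lemma binomial_local_lower:
  assumes \<rho>: "0 < \<rho>" and M: "1 \<le> M"
  shows "\<exists>c>0. \<forall>a r k. \<rho> \<le> r \<longrightarrow> r \<le> 1 - \<rho> \<longrightarrow> 8 * M / (\<rho> * (1 - \<rho>)) \<le> sqrt (real a) \<longrightarrow>
     \<bar>real k - real a * r\<bar> \<le> M * sqrt (real a) \<longrightarrow> c / sqrt (real a) \<le> pmf (binomial_pmf a r) k"
proof (intro exI[of _ "exp (- 16 * M\<^sup>2 / (\<rho> * (1 - \<rho>))) / (6 * M)"] conjI allI impI)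
  show "0 < exp (- 16 * M\<^sup>2 / (\<rho> * (1 - \<rho>))) / (6 * M)" using M by simp
  fix a :: nat and r :: real and k :: nat
  assume r: "\<rho> \<le> r" "r \<le> 1 - \<rho>" and a: "8 * M / (\<rho> * (1 - \<rho>)) \<le> sqrt (real a)"
    and k: "\<bar>real k - real a * r\<bar> \<le> M * sqrt (real a)"
  let ?f = "pmf (binomial_pmf a r)"
  define e where "e = exp (- 16 * M\<^sup>2 / (\<rho> * (1 - \<rho>)))"
  define W where "W = {k. \<bar>real k - real a * r\<bar> \<le> M * sqrt (real a)}"
  note wa = window_arith[OF \<rho> r M a]
  have a0: "0 < a" using wa(1) by (cases a) auto
  have Weq: "W = {k. a * r - M * sqrt a \<le> real k \<and> real k \<le> a * r + M * sqrt a}"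
    by (auto simp: W_def abs_le_iff)
  have M0: "0 \<le> M * sqrt a" using M by simp
  have fin: "finite W" and cW: "card W \<le> 2 * (M * sqrt a) + 1"
    using card_nat_window[OF wa(2), of "a * r + M * sqrt a"] M0 unfolding Weq by auto
  have Ms: "1 \<le> M * sqrt a" using mult_mono[OF M wa(1)] M by simp
  have "1 / 2 \<le> measure_pmf.prob (binomial_pmf a r) W"
    unfolding W_def using r \<rho> M a0 by (intro binomial_central_window) auto
  also have "\<dots> = (\<Sum>j\<in>W. ?f j)"
    using fin by (rule measure_measure_pmf_finite)
  finally have "e * (1 / 2) \<le> e * (\<Sum>j\<in>W. ?f j)"
    by (intro mult_left_mono) (auto simp: e_def)
  also have "\<dots> = (\<Sum>j\<in>W. e * ?f j)" by (simp add: sum_distrib_left)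
  also have "\<dots> \<le> (\<Sum>j\<in>W. ?f k)"
    using pmf_binomial_window_chain[OF \<rho> r M a _ k]
    by (intro sum_mono) (auto simp: W_def e_def)
  also have "\<dots> = card W * ?f k" by simp
  also have "\<dots> \<le> (3 * (M * sqrt a)) * ?f k"
    using cW Ms by (intro mult_right_mono) auto
  finally have "e \<le> (6 * M) * (sqrt a * ?f k)" by (simp add: mult_ac)
  then have "e / (6 * M) \<le> sqrt a * ?f k" using M by (simp add: field_simps)
  then show "exp (- 16 * M\<^sup>2 / (\<rho> * (1 - \<rho>))) / (6 * M) / sqrt a \<le> ?f k"
    using a0 unfolding e_def[symmetric] by (subst pos_divide_le_eq) (auto simp: mult.commute)
qed

text \<open>Together with \<open>pmf_binomial_increasing\<close> this is unimodality; it extends an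
  upper bound at the integers next to the mean to all integers.\<close>

lemma pmf_binomial_decreasing:
  assumes "0 \<le> r" "r < 1" "real a * r \<le> real j" "j \<le> k"
  shows "pmf (binomial_pmf a r) k \<le> pmf (binomial_pmf a r) j"
  using assms(4)
proof (induction rule: dec_induct)
  case (step m)
  have "pmf (binomial_pmf a r) (Suc m) \<le> pmf (binomial_pmf a r) m"
  proof (cases "m \<le> a")
    case True
    have "(real a - real m) * r \<le> (real m + 1) * (1 - r)"
      using step assms by (simp add: algebra_simps)
    then have "pmf (binomial_pmf a r) m * ((real a - real m) * r) \<le> pmf (binomial_pmf a r) m * ((real m + 1) * (1 - r))"
      by (intro mult_left_mono) auto
    then have "pmf (binomial_pmf a r) (Suc m) * ((real m + 1) * (1 - r)) \<le> pmf (binomial_pmf a r) m * ((real m + 1) * (1 - r))"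
      using pmf_binomial_Suc[of r m a] True assms by simp
    then show ?thesis
      by (rule mult_right_le_imp_le) (use assms in simp)
  next
    case False
    then show ?thesis using assms by (simp add: pmf_binomial binomial_eq_0)
  qed
  then show ?case using step by linarith
qed simp

lemma pmf_binomial_increasing:
  assumes "0 < r" "r \<le> 1" "real k \<le> real a * r" "j \<le> k"
  shows "pmf (binomial_pmf a r) j \<le> pmf (binomial_pmf a r) k"
  using assms(4)
proof (induction rule: inc_induct)
  case (step m)
  have ma: "real m + 1 \<le> a * r" using step assms(3) by linarith
  have "a * r \<le> a" using assms by (simp add: mult_left_le)
  then have mle: "m \<le> a" "real m < a" using ma by linarith+
  have "(real m + 1) * (1 - r) \<le> (real a - real m) * r"
    using ma assms(1) by (simp add: algebra_simps)
  then have "pmf (binomial_pmf a r) (Suc m) * ((real m + 1) * (1 - r)) \<le> pmf (binomial_pmf a r) (Suc m) * ((real a - real m) * r)"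
    by (intro mult_left_mono) auto
  then have "pmf (binomial_pmf a r) m * ((real a - real m) * r) \<le> pmf (binomial_pmf a r) (Suc m) * ((real a - real m) * r)"
    using pmf_binomial_Suc[of r m a] mle assms by simp
  then have "pmf (binomial_pmf a r) m \<le> pmf (binomial_pmf a r) (Suc m)"
    by (rule mult_right_le_imp_le) (use assms mle in simp)
  then show ?case using step by linarith
qed simp

text \<open>A point of the window is comparable to at least sqrt a others, and the masses sum to at
  most 1. Unimodality handles the points outside the window. The second entry of the maximum
  \<open>C\<close> covers small \<open>a\<close>, where the claim follows from masses being at most
  1.\<close>

lemma binomial_local_upper:
  assumes \<rho>: "0 < \<rho>"
  shows "\<exists>C>0. \<forall>a r k. \<rho> \<le> r \<longrightarrow> r \<le> 1 - \<rho> \<longrightarrow> 0 < a \<longrightarrow> pmf (binomial_pmf a r) k \<le> C / sqrt (real a)"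
proof -
  define e where "e = exp (- 16 * 2\<^sup>2 / (\<rho> * (1 - \<rho>)))"
  define C where "C = max (1 / e) (8 * 2 / (\<rho> * (1 - \<rho>)))"
  have e: "0 < e" by (simp add: e_def)
  have "pmf (binomial_pmf a r) k \<le> C / sqrt (real a)"
    if r: "\<rho> \<le> r" "r \<le> 1 - \<rho>" and a0: "0 < a" for a r k
  proof (cases "8 * 2 / (\<rho> * (1 - \<rho>)) \<le> sqrt (real a)")
    case a: True
    let ?f = "pmf (binomial_pmf a r)"
    define W where "W = {k. \<bar>real k - real a * r\<bar> \<le> 2 * sqrt (real a)}"
    note wa = window_arith[OF \<rho> r one_le_numeral a]
    have Weq: "W = {k. a * r - 2 * sqrt a \<le> real k \<and> real k \<le> a * r + 2 * sqrt a}"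
      by (auto simp: W_def abs_le_iff)
    have fin: "finite W" and cW: "4 * sqrt a - 1 \<le> card W"
      using card_nat_window[of "a * r - 2 * sqrt a" "a * r + 2 * sqrt a"] wa unfolding Weq by auto
    have central: "?f j \<le> C / sqrt a" if j: "j \<in> W" for j
    proof -
      have "sqrt a * (e * ?f j) \<le> card W * (e * ?f j)"
        using cW wa(1) e by (intro mult_right_mono) (linarith, simp)
      also have "\<dots> = (\<Sum>i\<in>W. e * ?f j)" by simp
      also have "\<dots> \<le> (\<Sum>i\<in>W. ?f i)"
        using pmf_binomial_window_chain[OF \<rho> r _ a, of j] j
        by (intro sum_mono) (auto simp: W_def e_def)
      also have "\<dots> = measure_pmf.prob (binomial_pmf a r) W"
        using fin by (rule measure_measure_pmf_finite[symmetric])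
      also have "\<dots> \<le> 1" by simp
      finally have "?f j \<le> (1 / e) / sqrt a" using e a0 by (simp add: field_simps)
      also have "\<dots> \<le> C / sqrt a" by (intro divide_right_mono) (auto simp: C_def)
      finally show ?thesis .
    qed
    show ?thesis
    proof (cases "real a * r \<le> real k")
      case True
      define j where "j = nat \<lceil>a * r\<rceil>"
      have ar: "0 \<le> a * r" using r \<rho> by simp
      have j: "a * r \<le> real j" "real j \<le> a * r + 1" "j \<le> k"
        using True ar unfolding j_def by linarith+
      have "j \<in> W" using j wa(1) unfolding W_def mem_Collect_eq by linarith
      from central[OF this] pmf_binomial_decreasing[OF _ _ j(1,3)] r \<rho> show ?thesis by fastforce
    next
      case False
      define j where "j = nat \<lfloor>a * r\<rfloor>"
      have ar: "0 \<le> a * r" using r \<rho> by simp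
      have j: "real j \<le> a * r" "a * r \<le> real j + 1" "k \<le> j"
        using False ar unfolding j_def by linarith+
      have "j \<in> W" using j wa(1) unfolding W_def mem_Collect_eq by linarith
      from central[OF this] pmf_binomial_increasing[OF _ _ j(1,3)] r \<rho> show ?thesis by fastforce
    qed
  next
    case False
    have "sqrt a \<le> C" using False by (simp add: C_def)
    then have "1 \<le> C / sqrt a" using a0 by simp
    then show ?thesis using pmf_le_1[of "binomial_pmf a r" k] by linarith
  qed
  moreover have "0 < C" using e by (simp add: C_def less_max_iff_disj)
  ultimately show ?thesis by blast
qed

section \<open>Exponential tilting\<close>

definition bern_mgf :: "real \<Rightarrow> real \<Rightarrow> real" where
  "bern_mgf r x = 1 - r + r * exp x"

text \<open>The success probability after reweighting a Bernoulli law by exp(x k); it is also the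
  derivative of \<open>ln (bern_mgf r x)\<close> in \<open>x\<close>.\<close>

definition tilted :: "real \<Rightarrow> real \<Rightarrow> real" where
  "tilted r x = r * exp x / bern_mgf r x"

lemma bern_mgf_pos: "0 \<le> r \<Longrightarrow> r \<le> 1 \<Longrightarrow> 0 < bern_mgf r x"
  unfolding bern_mgf_def
  by (cases "r = 1") (auto intro: add_pos_nonneg)

lemma one_minus_tilted: "0 \<le> r \<Longrightarrow> r \<le> 1 \<Longrightarrow> 1 - tilted r x = (1 - r) / bern_mgf r x"
  using bern_mgf_pos[of r x] by (simp add: tilted_def field_simps) (simp add: bern_mgf_def)

lemma tilted_bounds: "0 \<le> r \<Longrightarrow> r \<le> 1 \<Longrightarrow> 0 \<le> tilted r x \<and> tilted r x \<le> 1"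
proof -
  assume r: "0 \<le> r" "r \<le> 1"
  have "0 \<le> 1 - tilted r x" unfolding one_minus_tilted[OF r] using bern_mgf_pos[OF r, of x] r by simp
  then show ?thesis using bern_mgf_pos[OF r, of x] r by (simp add: tilted_def)
qed

text \<open>The change of measure behind all tail estimates: a binomial reweighted by exp(x k) is
  again binomial up to normalisation, and moderate deviations of the old law become typical values
  of the new one.\<close>

lemma pmf_binomial_tilted:
  assumes r: "0 \<le> r" "r \<le> 1"
  shows "pmf (binomial_pmf a r) k * exp (x * real k) = bern_mgf r x ^ a * pmf (binomial_pmf a (tilted r x)) k"
proof (cases "k \<le> a")
  case True
  have z: "0 < bern_mgf r x" using bern_mgf_pos[OF r] .
  have e: "exp (x * real k) = exp x ^ k" by (simp add: exp_of_nat_mult[symmetric] mult.commute)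
  have "bern_mgf r x ^ a = bern_mgf r x ^ k * bern_mgf r x ^ (a - k)"
    using True by (simp add: power_add[symmetric])
  then show ?thesis
    using r z tilted_bounds[OF r, of x] unfolding e
    by (simp add: pmf_binomial one_minus_tilted) (simp add: tilted_def power_divide power_mult_distrib)
next
  case False
  then show ?thesis using tilted_bounds[OF r, of x] r by (simp add: pmf_binomial binomial_eq_0)
qed

lemma measure_bind_pmf:
  "measure_pmf.prob (bind_pmf M N) X = measure_pmf.expectation M (\<lambda>x. measure_pmf.prob (N x) X)"
proof -
  have "ennreal (measure_pmf.prob (bind_pmf M N) X) = (\<integral>\<^sup>+x. ennreal (measure_pmf.prob (N x) X) \<partial>M)"
    by (simp add: measure_pmf.emeasure_eq_measure[symmetric])
  also have "\<dots> = ennreal (measure_pmf.expectation M (\<lambda>x. measure_pmf.prob (N x) X))"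
    by (rule nn_integral_eq_integral) (auto intro!: measure_pmf.integrable_const_bound[where B=1])
  finally show ?thesis by (simp add: integral_nonneg_AE)
qed

lemma prob_pair_binomial:
  assumes "0 \<le> p" "p \<le> 1"
  shows "measure_pmf.prob (pair_pmf A (binomial_pmf b p)) E =
    (\<Sum>j\<le>b. pmf (binomial_pmf b p) j * measure_pmf.prob A {i. (i, j) \<in> E})"
proof -
  have "pair_pmf A (binomial_pmf b p) = bind_pmf (binomial_pmf b p) (\<lambda>j. map_pmf (\<lambda>i. (i, j)) A)"
    unfolding pair_pmf_def map_pmf_def by (rule bind_commute_pmf)
  then have "measure_pmf.prob (pair_pmf A (binomial_pmf b p)) E =
      measure_pmf.expectation (binomial_pmf b p) (\<lambda>j. measure_pmf.prob (map_pmf (\<lambda>i. (i, j)) A) E)"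
    by (simp only: measure_bind_pmf)
  also have "\<dots> = (\<Sum>j\<le>b. measure_pmf.prob (map_pmf (\<lambda>i. (i, j)) A) E * pmf (binomial_pmf b p) j)"
    using assms by (intro integral_measure_pmf_real) (auto dest: set_pmf_binomial_eq[THEN equalityD1, THEN subsetD] split: if_splits)
  finally show ?thesis by (simp add: vimage_def mult.commute)
qed

lemma sum_exp_tail:
  fixes x :: real
  assumes "0 < x"
  shows "(\<Sum>i\<in>{i. i \<le> a \<and> t \<le> real i}. exp (- x * real i)) \<le> exp (- x * t) / (1 - exp (- x))"
proof -
  define i0 where "i0 = nat \<lceil>t\<rceil>"
  define y where "y = exp (- x)"
  have y: "0 < y" "y < 1" using assms by (auto simp: y_def)
  have ey: "exp (- x * real i) = y ^ i" for i
    by (simp add: y_def exp_of_nat_mult[symmetric] mult.commute)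
  have sub: "{i. i \<le> a \<and> t \<le> real i} \<subseteq> (\<lambda>j. i0 + j) ` {..a}"
  proof
    fix i assume i: "i \<in> {i. i \<le> a \<and> t \<le> real i}"
    then have "i0 \<le> i" unfolding i0_def by (simp add: nat_le_iff ceiling_le_iff)
    then show "i \<in> (\<lambda>j. i0 + j) ` {..a}" using i by (intro image_eqI[of _ _ "i - i0"]) auto
  qed
  have "(\<Sum>i\<in>{i. i \<le> a \<and> t \<le> real i}. exp (- x * real i)) \<le> (\<Sum>i\<in>(\<lambda>j. i0 + j) ` {..a}. y ^ i)"
    unfolding ey using y by (intro sum_mono2 sub) auto
  also have "\<dots> = (\<Sum>j\<le>a. y ^ i0 * y ^ j)"
    by (subst sum.reindex) (auto simp: power_add)
  also have "\<dots> = y ^ i0 * (\<Sum>j<Suc a. y ^ j)"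
    by (simp add: sum_distrib_left lessThan_Suc_atMost)
  also have "\<dots> \<le> y ^ i0 * (1 / (1 - y))"
  proof (intro mult_left_mono)
    show "(\<Sum>j<Suc a. y ^ j) \<le> 1 / (1 - y)"
      using y by (subst sum_gp_strict) (auto intro!: divide_right_mono simp del: power_Suc)
  qed (use y in simp)
  also have "\<dots> \<le> exp (- x * t) * (1 / (1 - y))"
  proof (intro mult_right_mono)
    have "t \<le> real i0" unfolding i0_def by linarith
    then show "y ^ i0 \<le> exp (- x * t)" using assms unfolding ey[symmetric] by simp
  qed (use y in auto)
  finally show ?thesis by (simp add: y_def)
qed

text \<open>Chernoff's bound refined: every point keeps the bound \<open>K\<close> on its tilted
  mass, and the exponential weights form a geometric series. With \<open>K\<close> of order 1 / sqrt
  a this gains the factor 1 / (x sqrt a).\<close>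

lemma binomial_tail_upper:
  assumes q: "0 \<le> q" "q \<le> 1" and x: "0 < x"
    and C: "\<And>k. pmf (binomial_pmf a (tilted q x)) k \<le> K"
  shows "measure_pmf.prob (binomial_pmf a q) {i. t \<le> real i} \<le>
    bern_mgf q x ^ a * K * exp (- x * t) / (1 - exp (- x))"
proof -
  have pt: "pmf (binomial_pmf a q) i \<le> bern_mgf q x ^ a * K * exp (- x * real i)" for i
  proof -
    have "pmf (binomial_pmf a q) i = pmf (binomial_pmf a q) i * exp (x * real i) * exp (- x * real i)"
      by (simp add: mult.assoc exp_add[symmetric])
    also have "\<dots> \<le> bern_mgf q x ^ a * K * exp (- x * real i)"
      unfolding pmf_binomial_tilted[OF q]
      using C bern_mgf_pos[OF q, of x] by (intro mult_right_mono mult_left_mono) auto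
    finally show ?thesis .
  qed
  have K: "0 \<le> K" by (rule order_trans[OF pmf_nonneg C])
  have "measure_pmf.prob (binomial_pmf a q) {i. t \<le> real i} =
      measure_pmf.prob (binomial_pmf a q) {i. i \<le> a \<and> t \<le> real i}"
    using q by (intro measure_prob_cong_0) (auto simp: pmf_binomial binomial_eq_0)
  also have "\<dots> = (\<Sum>i\<in>{i. i \<le> a \<and> t \<le> real i}. pmf (binomial_pmf a q) i)"
    by (rule measure_measure_pmf_finite) simp
  also have "\<dots> \<le> (\<Sum>i\<in>{i. i \<le> a \<and> t \<le> real i}. bern_mgf q x ^ a * K * exp (- x * real i))"
    by (intro sum_mono pt)
  also have "\<dots> = bern_mgf q x ^ a * K * (\<Sum>i\<in>{i. i \<le> a \<and> t \<le> real i}. exp (- x * real i))"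
    by (simp add: sum_distrib_left)
  also have "\<dots> \<le> bern_mgf q x ^ a * K * (exp (- x * t) / (1 - exp (- x)))"
    using K bern_mgf_pos[OF q, of x] by (intro mult_left_mono sum_exp_tail[OF x]) auto
  finally show ?thesis by simp
qed

text \<open>After the change of measure the tilted masses sum to one.\<close>

lemma sum_binomial_exp:
  assumes p: "0 \<le> p" "p \<le> 1"
  shows "(\<Sum>j\<le>b. pmf (binomial_pmf b p) j * exp (x * real j)) = bern_mgf p x ^ b"
proof -
  have "(\<Sum>j\<le>b. pmf (binomial_pmf b p) j * exp (x * real j)) =
      bern_mgf p x ^ b * (\<Sum>j\<le>b. pmf (binomial_pmf b (tilted p x)) j)"
    unfolding pmf_binomial_tilted[OF p] by (simp add: sum_distrib_left)
  also have "(\<Sum>j\<le>b. pmf (binomial_pmf b (tilted p x)) j) = 1"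
    using tilted_bounds[OF p, of x]
    by (intro sum_pmf_eq_1) (auto simp: set_pmf_binomial_eq)
  finally show ?thesis by simp
qed

abbreviation binom_pair_prob :: "nat \<Rightarrow> real \<Rightarrow> nat \<Rightarrow> real \<Rightarrow> (nat \<times> nat) set \<Rightarrow> real" where
  "binom_pair_prob a q b p \<equiv> measure_pmf.prob (pair_pmf (binomial_pmf a q) (binomial_pmf b p))"

abbreviation diff_tail :: "nat \<Rightarrow> real \<Rightarrow> nat \<Rightarrow> real \<Rightarrow> real \<Rightarrow> real" where
  "diff_tail a q b p s \<equiv> binom_pair_prob a q b p {(i, j). - s < real i - real j}"

abbreviation diff_point :: "nat \<Rightarrow> real \<Rightarrow> nat \<Rightarrow> real \<Rightarrow> int \<Rightarrow> real" where
  "diff_point a q b p k \<equiv> binom_pair_prob a q b p {(i, j). int i - int j = k}"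

text \<open>Conditioning on the second count \<open>j\<close> moves the level of
  \<open>binomial_tail_upper\<close> to \<open>j - s\<close>, and the resulting weights exp(- x j)
  sum exactly by \<open>sum_binomial_exp\<close>. The degenerate case p = 1 is thereby
  covered.\<close>

lemma binomial_diff_tail_upper:
  assumes q: "0 \<le> q" "q \<le> 1" and p: "0 \<le> p" "p \<le> 1" and x: "0 < x"
    and C: "\<And>k. pmf (binomial_pmf a (tilted q x)) k \<le> K"
  shows "binom_pair_prob a q b p {(i, j). - s \<le> real i - real j} \<le>
    bern_mgf q x ^ a * bern_mgf p (- x) ^ b * K * exp (x * s) / (1 - exp (- x))"
proof -
  have "binom_pair_prob a q b p {(i, j). - s \<le> real i - real j} =
     (\<Sum>j\<le>b. pmf (binomial_pmf b p) j * measure_pmf.prob (binomial_pmf a q) {i. real j - s \<le> real i})"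
    unfolding prob_pair_binomial[OF p] by (simp add: algebra_simps)
  also have "\<dots> \<le> (\<Sum>j\<le>b. pmf (binomial_pmf b p) j *
      (bern_mgf q x ^ a * K * exp (- x * (real j - s)) / (1 - exp (- x))))"
    by (intro sum_mono mult_left_mono binomial_tail_upper[OF q x C]) auto
  also have "\<dots> = (\<Sum>j\<le>b. (pmf (binomial_pmf b p) j * exp (- x * real j)) *
      (bern_mgf q x ^ a * K * exp (x * s) / (1 - exp (- x))))"
  proof (intro sum.cong refl)
    fix j
    have "exp (- x * (real j - s)) = exp (- x * real j) * exp (x * s)"
      by (simp add: exp_add[symmetric] algebra_simps)
    then show "pmf (binomial_pmf b p) j * (bern_mgf q x ^ a * K * exp (- x * (real j - s)) / (1 - exp (- x))) =
      (pmf (binomial_pmf b p) j * exp (- x * real j)) * (bern_mgf q x ^ a * K * exp (x * s) / (1 - exp (- x)))"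
      by (simp only: times_divide_eq_right mult_ac)
  qed
  also have "\<dots> = bern_mgf p (- x) ^ b * (bern_mgf q x ^ a * K * exp (x * s) / (1 - exp (- x)))"
    unfolding sum_distrib_right[symmetric] sum_binomial_exp[OF p] ..
  finally show ?thesis by (simp add: mult_ac)
qed

text \<open>One point instead of a geometric series: the factor 1 / (1 - exp(- x)) is absent, so
  this bound is smaller than the tail bound by a factor of order x. That gain makes the correlation
  between two vertices negligible.\<close>

lemma binomial_diff_point_upper:
  assumes q: "0 \<le> q" "q \<le> 1" and p: "0 \<le> p" "p \<le> 1"
    and C: "\<And>k. pmf (binomial_pmf a (tilted q x)) k \<le> K"
  shows "diff_point a q b p k \<le>
    bern_mgf q x ^ a * bern_mgf p (- x) ^ b * K * exp (- x * real_of_int k)"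
proof -
  have K: "0 \<le> K" by (rule order_trans[OF pmf_nonneg C])
  have z: "0 \<le> bern_mgf q x ^ a * K" using K bern_mgf_pos[OF q, of x] by simp
  have pt: "measure_pmf.prob (binomial_pmf a q) {i. int i = int j + k} \<le>
      bern_mgf q x ^ a * K * exp (- x * (real j + real_of_int k))" for j
  proof (cases "0 \<le> int j + k")
    case True
    define i where "i = nat (int j + k)"
    have i: "real i = real j + real_of_int k" using True by (simp add: i_def)
    have "{i. int i = int j + k} = {i}" using True by (auto simp: i_def)
    then have "measure_pmf.prob (binomial_pmf a q) {i. int i = int j + k} = pmf (binomial_pmf a q) i"
      by (simp add: measure_pmf_single)
    also have "\<dots> = pmf (binomial_pmf a q) i * exp (x * real i) * exp (- x * real i)"
      by (simp add: mult.assoc exp_add[symmetric])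
    also have "\<dots> \<le> bern_mgf q x ^ a * K * exp (- x * real i)"
      unfolding pmf_binomial_tilted[OF q]
      using C bern_mgf_pos[OF q, of x] by (intro mult_right_mono mult_left_mono) auto
    finally show ?thesis by (simp add: i)
  next
    case False
    then have "{i. int i = int j + k} = {}" by auto
    then show ?thesis using z by simp
  qed
  have "diff_point a q b p k =
     (\<Sum>j\<le>b. pmf (binomial_pmf b p) j * measure_pmf.prob (binomial_pmf a q) {i. int i = int j + k})"
    unfolding prob_pair_binomial[OF p] by (simp add: algebra_simps)
  also have "\<dots> \<le> (\<Sum>j\<le>b. pmf (binomial_pmf b p) j * (bern_mgf q x ^ a * K * exp (- x * (real j + real_of_int k))))"
    by (intro sum_mono mult_left_mono pt) auto
  also have "\<dots> = (\<Sum>j\<le>b. (pmf (binomial_pmf b p) j * exp (- x * real j)) *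
      (bern_mgf q x ^ a * K * exp (- x * real_of_int k)))"
  proof (intro sum.cong refl)
    fix j
    have "exp (- x * (real j + real_of_int k)) = exp (- x * real j) * exp (- x * real_of_int k)"
      by (simp add: exp_add[symmetric] algebra_simps)
    then show "pmf (binomial_pmf b p) j * (bern_mgf q x ^ a * K * exp (- x * (real j + real_of_int k))) =
      (pmf (binomial_pmf b p) j * exp (- x * real j)) * (bern_mgf q x ^ a * K * exp (- x * real_of_int k))"
      by (simp only: mult_ac)
  qed
  also have "\<dots> = bern_mgf p (- x) ^ b * (bern_mgf q x ^ a * K * exp (- x * real_of_int k))"
    unfolding sum_distrib_right[symmetric] sum_binomial_exp[OF p] ..
  finally show ?thesis by (simp add: mult_ac)
qed

text \<open>The window condition says that the tilted difference is centred up to order sqrt a. At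
  least half of the tilted mass of \<open>j\<close> is within sqrt b of its mean. For each such
  \<open>j\<close> the tail contains about 1 / x integers \<open>i\<close> whose tilted mass is of
  order 1 / sqrt a and whose exponential weight has lost at most a factor e.\<close>

lemma binomial_diff_tail_lower:
  assumes \<rho>: "0 < \<rho>" and M: "1 \<le> M"
  shows "\<exists>c>0. \<forall>q p x a b s. 0 \<le> q \<longrightarrow> q \<le> 1 \<longrightarrow> 0 \<le> p \<longrightarrow> p \<le> 1 \<longrightarrow> 0 < x \<longrightarrow> x \<le> 1 / 4 \<longrightarrow> 0 < b \<longrightarrow>
      \<rho> \<le> tilted q x \<longrightarrow> tilted q x \<le> 1 - \<rho> \<longrightarrow> 8 * M / (\<rho> * (1 - \<rho>)) \<le> sqrt (real a) \<longrightarrow>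
      sqrt (real b) + \<bar>real a * tilted q x - real b * tilted p (- x)\<bar> + \<bar>s\<bar> + 1 / x \<le> M * sqrt (real a) \<longrightarrow>
      c / (x * sqrt (real a)) * bern_mgf q x ^ a * bern_mgf p (- x) ^ b * exp (x * s)
      \<le> diff_tail a q b p s"
proof -
  obtain c where c0: "0 < c" and c: "\<And>a r k. \<rho> \<le> r \<Longrightarrow> r \<le> 1 - \<rho> \<Longrightarrow> 8 * M / (\<rho> * (1 - \<rho>)) \<le> sqrt (real a) \<Longrightarrow>
     \<bar>real k - real a * r\<bar> \<le> M * sqrt (real a) \<Longrightarrow> c / sqrt (real a) \<le> pmf (binomial_pmf a r) k"
    using binomial_local_lower[OF \<rho> M] by blast
  show ?thesis
  proof (intro exI[of _ "c * exp (- 1) / 4"] conjI allI impI)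
    show "0 < c * exp (- 1) / 4" using c0 by simp
    fix q p x s :: real and a b :: nat
    assume q: "0 \<le> q" "q \<le> 1" and p: "0 \<le> p" "p \<le> 1" and x: "0 < x" "x \<le> 1 / 4" and b: "0 < b"
      and t: "\<rho> \<le> tilted q x" "tilted q x \<le> 1 - \<rho>" and a: "8 * M / (\<rho> * (1 - \<rho>)) \<le> sqrt (real a)"
      and win: "sqrt (real b) + \<bar>real a * tilted q x - real b * tilted p (- x)\<bar> + \<bar>s\<bar> + 1 / x \<le> M * sqrt (real a)"
    define q' where "q' = tilted q x"
    define p' where "p' = tilted p (- x)"
    define J where "J = {j. \<bar>real j - b * p'\<bar> \<le> sqrt b} \<inter> {..b}"
    \<comment> \<open>Starting at \<open>+ 1\<close> yields the strict inequality of the tail event;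
      stopping at distance \<open>1 / x\<close> limits the loss in the weight to exp(- 1).\<close>
    define I where "I j = {i::nat. real j - s + 1 \<le> real i \<and> real i \<le> real j - s + 1 / x}" for j
    define \<phi> where "\<phi> = bern_mgf q x ^ a"
    define \<psi> where "\<psi> = bern_mgf p (- x) ^ b"
    note wa = window_arith[OF \<rho> t M a]
    have p'01: "0 \<le> p'" "p' \<le> 1" using tilted_bounds[OF p] by (auto simp: p'_def)
    have zq: "0 < \<phi>" using bern_mgf_pos[OF q, of x] by (simp add: \<phi>_def)
    have zp: "0 < \<psi>" using bern_mgf_pos[OF p] by (simp add: \<psi>_def)
    have x1: "4 \<le> 1 / x" using x by (simp add: field_simps)
    have inner: "\<phi> * exp (- x * real j) * exp (x * s) * exp (- 1) * (c / sqrt a) * (1 / (2 * x))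
        \<le> measure_pmf.prob (binomial_pmf a q) {i. real j - s < real i}" if j: "j \<in> J" for j
    proof -
      have jj: "\<bar>real j - b * p'\<bar> \<le> sqrt b" using j by (simp add: J_def)
      have l0: "0 \<le> real j - s + 1"
      proof -
        have "a * q' - M * sqrt a \<ge> 0" using wa(2) by (simp add: q'_def)
        moreover have "real j - s \<ge> a * q' - M * sqrt a"
          using jj win x1 unfolding q'_def[symmetric] p'_def[symmetric] by linarith
        ultimately show ?thesis by linarith
      qed
      have fin: "finite (I j)" and cI: "1 / x - 2 \<le> card (I j)"
        using card_nat_window[OF l0, of "real j - s + 1 / x"] x1 unfolding I_def by auto
      \<comment> \<open>The assumption \<open>x \<le> 1 / 4\<close> makes 1 / x - 2 at least half of
        1 / x.\<close>
      have half: "1 / (2 * x) \<le> card (I j)"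
      proof -
        have "1 / (2 * x) = (1 / x) / 2" by simp
        then show ?thesis using cI x1 by linarith
      qed
      have pt: "\<phi> * exp (- x * real j) * exp (x * s) * exp (- 1) * (c / sqrt a) \<le> pmf (binomial_pmf a q) i" if i: "i \<in> I j" for i
      proof -
        have ii: "real j - s + 1 \<le> real i" "real i \<le> real j - s + 1 / x" using i by (auto simp: I_def)
        have "\<bar>real i - a * q'\<bar> \<le> M * sqrt a"
          using ii jj win x1 unfolding q'_def[symmetric] p'_def[symmetric] by linarith
        then have ci: "c / sqrt a \<le> pmf (binomial_pmf a q') i"
          unfolding q'_def by (intro c t a) 
        have "x * real i \<le> x * (real j - s + 1 / x)" using ii x by (intro mult_left_mono) auto
        also have "\<dots> = x * real j - x * s + 1" using x by (simp add: algebra_simps)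
        finally have "exp (- x * real j + x * s + - 1) \<le> exp (- x * real i)"
          by (subst exp_le_cancel_iff) (simp add: algebra_simps)
        then have ex: "exp (- x * real j) * exp (x * s) * exp (- 1) \<le> exp (- x * real i)"
          by (simp only: exp_add)
        have "\<phi> * (exp (- x * real j) * exp (x * s) * exp (- 1)) * (c / sqrt a)
            \<le> \<phi> * exp (- x * real i) * pmf (binomial_pmf a q') i"
          using ex ci zq c0 by (intro mult_mono) auto
        also have "\<dots> = pmf (binomial_pmf a q) i * exp (x * real i) * exp (- x * real i)"
          unfolding pmf_binomial_tilted[OF q] by (simp add: \<phi>_def q'_def)
        also have "\<dots> = pmf (binomial_pmf a q) i" by (simp add: mult.assoc exp_add[symmetric])
        finally show ?thesis by (simp add: mult_ac)
      qed
      have nn: "0 \<le> \<phi> * exp (- x * real j) * exp (x * s) * exp (- 1) * (c / sqrt a)"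
        using zq c0 by simp
      have "\<phi> * exp (- x * real j) * exp (x * s) * exp (- 1) * (c / sqrt a) * (1 / (2 * x))
        \<le> \<phi> * exp (- x * real j) * exp (x * s) * exp (- 1) * (c / sqrt a) * card (I j)"
        by (intro mult_left_mono half nn)
      also have "\<dots> = (\<Sum>i\<in>I j. \<phi> * exp (- x * real j) * exp (x * s) * exp (- 1) * (c / sqrt a))"
        by simp
      also have "\<dots> \<le> (\<Sum>i\<in>I j. pmf (binomial_pmf a q) i)"
        by (intro sum_mono pt)
      also have "\<dots> = measure_pmf.prob (binomial_pmf a q) (I j)"
        using fin by (simp add: measure_measure_pmf_finite)
      also have "\<dots> \<le> measure_pmf.prob (binomial_pmf a q) {i. real j - s < real i}"
        by (intro measure_pmf.finite_measure_mono) (auto simp: I_def)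
      finally show ?thesis .
    qed
    have "1 / 2 \<le> measure_pmf.prob (binomial_pmf b p') {k. \<bar>real k - real b * p'\<bar> \<le> 1 * sqrt (real b)}"
      using p'01 b by (intro binomial_central_window) auto
    also have "\<dots> = measure_pmf.prob (binomial_pmf b p') J"
      using p'01 by (intro measure_prob_cong_0) (auto simp: J_def pmf_binomial binomial_eq_0)
    also have "\<dots> = (\<Sum>j\<in>J. pmf (binomial_pmf b p') j)"
      by (rule measure_measure_pmf_finite) (simp add: J_def)
    finally have J: "1 / 2 \<le> (\<Sum>j\<in>J. pmf (binomial_pmf b p') j)" .
    define R where "R = \<phi> * exp (x * s) * exp (- 1) * (c / sqrt a) * (1 / (2 * x))"
    have R0: "0 \<le> R" using zq c0 x by (simp add: R_def)
    have "R * \<psi> * (1 / 2) \<le> R * \<psi> * (\<Sum>j\<in>J. pmf (binomial_pmf b p') j)"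
      using R0 zp J by (intro mult_left_mono) auto
    also have "\<dots> = (\<Sum>j\<in>J. R * (\<psi> * pmf (binomial_pmf b p') j))"
      by (simp add: sum_distrib_left mult_ac)
    also have "\<dots> = (\<Sum>j\<in>J. R * (pmf (binomial_pmf b p) j * exp (- x * real j)))"
      unfolding pmf_binomial_tilted[OF p] by (simp add: \<psi>_def p'_def)
    also have "\<dots> = (\<Sum>j\<in>J. pmf (binomial_pmf b p) j * (\<phi> * exp (- x * real j) * exp (x * s) * exp (- 1) * (c / sqrt a) * (1 / (2 * x))))"
      by (intro sum.cong) (auto simp: R_def mult_ac)
    also have "\<dots> \<le> (\<Sum>j\<in>J. pmf (binomial_pmf b p) j * measure_pmf.prob (binomial_pmf a q) {i. real j - s < real i})"
      by (intro sum_mono mult_left_mono inner) auto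
    also have "\<dots> \<le> (\<Sum>j\<le>b. pmf (binomial_pmf b p) j * measure_pmf.prob (binomial_pmf a q) {i. real j - s < real i})"
      by (intro sum_mono2) (auto simp: J_def)
    also have "\<dots> = diff_tail a q b p s"
      unfolding prob_pair_binomial[OF p] by (simp add: algebra_simps)
    finally show "c * exp (- 1) / 4 / (x * sqrt (real a)) * bern_mgf q x ^ a * bern_mgf p (- x) ^ b * exp (x * s)
      \<le> diff_tail a q b p s"
      by (simp add: R_def \<phi>_def \<psi>_def mult_ac)
  qed
qed

section \<open>Degrees in graphs with independent edges\<close>

definition deg_into :: "edges \<Rightarrow> nat \<Rightarrow> nat set \<Rightarrow> nat" where
  "deg_into E v J = card {j \<in> J. {v, j} \<in> E}"

lemma set_indep_graph: "E \<in> set_pmf (indep_graph V f) \<Longrightarrow> E \<subseteq> [V]\<^bsup>2\<^esup>"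
  by (auto simp: indep_graph_def)

lemma finite_nsets2: "finite V \<Longrightarrow> finite ([V]\<^bsup>2\<^esup>)"
  by (rule finite_imp_finite_nsets)

lemma indep_graph_pair:
  fixes V :: "nat set"
  assumes V: "finite V" and disj: "S \<inter> T = {}"
  shows "map_pmf (\<lambda>E. (E \<inter> S, E \<inter> T)) (indep_graph V f) =
    pair_pmf (map_pmf (\<lambda>E. E \<inter> S) (indep_graph V f)) (map_pmf (\<lambda>E. E \<inter> T) (indep_graph V f))"
proof -
  define I where "I = [V]\<^bsup>2\<^esup>"
  define g where "g e = bernoulli_pmf (f e)" for e
  define P where "P = Pi_pmf (I \<inter> S) False g"
  \<comment> \<open>Everything outside \<open>S\<close>, not only \<open>T\<close>, so that the two
    independent blocks together make up all pairs.\<close>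
  define Q where "Q = Pi_pmf (I - S) False g"
  define h1 where "h1 b = {e \<in> I \<inter> S. b e}" for b :: "nat set \<Rightarrow> bool"
  define h2 where "h2 b = {e \<in> I \<inter> T. b e}" for b :: "nat set \<Rightarrow> bool"
  have fin: "finite I" unfolding I_def by (rule finite_nsets2[OF V])
  have "Pi_pmf ((I \<inter> S) \<union> (I - S)) False g = map_pmf (\<lambda>(f, g) x. if x \<in> I \<inter> S then f x else g x) (pair_pmf P Q)"
    unfolding P_def Q_def using fin by (intro Pi_pmf_union) auto
  also have "(I \<inter> S) \<union> (I - S) = I" by auto
  finally have Pi: "Pi_pmf I False g = map_pmf (\<lambda>(f, g) x. if x \<in> I \<inter> S then f x else g x) (pair_pmf P Q)" .
  have G: "indep_graph V f = map_pmf (\<lambda>b. {e \<in> I. b e}) (Pi_pmf I False g)"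
    by (simp add: indep_graph_def I_def g_def[abs_def])
  have "map_pmf (\<lambda>E. (E \<inter> S, E \<inter> T)) (indep_graph V f) = map_pmf (\<lambda>(a, b). (h1 a, h2 b)) (pair_pmf P Q)"
    unfolding G Pi map_pmf_comp
    using disj by (intro map_pmf_cong refl) (auto simp: h1_def h2_def)
  also have "\<dots> = pair_pmf (map_pmf h1 P) (map_pmf h2 Q)"
    by (rule map_pair)
  finally have eq: "map_pmf (\<lambda>E. (E \<inter> S, E \<inter> T)) (indep_graph V f) = pair_pmf (map_pmf h1 P) (map_pmf h2 Q)" .
  have "map_pmf (\<lambda>E. E \<inter> S) (indep_graph V f) = map_pmf h1 P"
    using arg_cong[OF eq, of "map_pmf fst"] by (simp add: map_pmf_comp map_fst_pair_pmf)
  moreover have "map_pmf (\<lambda>E. E \<inter> T) (indep_graph V f) = map_pmf h2 Q"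
    using arg_cong[OF eq, of "map_pmf snd"] by (simp add: map_pmf_comp map_snd_pair_pmf)
  ultimately show ?thesis using eq by simp
qed

text \<open>The equations on \<open>F\<close> and \<open>H\<close> express that they look only at
  the pairs in \<open>S\<close> and in \<open>T\<close>.\<close>

lemma indep_graph_indep:
  assumes V: "finite V" and disj: "S \<inter> T = {}"
    and F: "\<And>E. F (E \<inter> S) = F E" and H: "\<And>E. H (E \<inter> T) = H E"
  shows "map_pmf (\<lambda>E. (F E, H E)) (indep_graph V f) =
    pair_pmf (map_pmf F (indep_graph V f)) (map_pmf H (indep_graph V f))"
proof -
  have "map_pmf (\<lambda>E. (F E, H E)) (indep_graph V f) =
      map_pmf (\<lambda>(a, b). (F a, H b)) (map_pmf (\<lambda>E. (E \<inter> S, E \<inter> T)) (indep_graph V f))"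
    by (simp add: map_pmf_comp F H)
  also have "\<dots> = pair_pmf (map_pmf F (map_pmf (\<lambda>E. E \<inter> S) (indep_graph V f)))
      (map_pmf H (map_pmf (\<lambda>E. E \<inter> T) (indep_graph V f)))"
    unfolding indep_graph_pair[OF V disj] by (rule map_pair)
  finally show ?thesis by (simp add: map_pmf_comp F H)
qed

lemma doubleton_in_nsets2: "v \<in> V \<Longrightarrow> j \<in> V \<Longrightarrow> v \<noteq> j \<Longrightarrow> {v, j} \<in> [V]\<^bsup>2\<^esup>"
  by (auto simp: nsets_def)

lemma deg_into_alt:
  assumes "v \<notin> J"
  shows "deg_into E v J = card {e \<in> (\<lambda>j. {v, j}) ` J. e \<in> E}"
proof -
  have "inj_on (\<lambda>j. {v, j}) {j \<in> J. {v, j} \<in> E}"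
    using assms by (auto simp: inj_on_def doubleton_eq_iff)
  moreover have "{e \<in> (\<lambda>j. {v, j}) ` J. e \<in> E} = (\<lambda>j. {v, j}) ` {j \<in> J. {v, j} \<in> E}" by auto
  ultimately show ?thesis unfolding deg_into_def by (simp add: card_image)
qed

lemma deg_into_distr:
  fixes V :: "nat set"
  assumes V: "finite V" and v: "v \<in> V" "v \<notin> J" "J \<subseteq> V" and f: "\<And>j. j \<in> J \<Longrightarrow> f {v, j} = r"
    and r: "0 \<le> r" "r \<le> 1"
  shows "map_pmf (\<lambda>E. deg_into E v J) (indep_graph V f) = binomial_pmf (card J) r"
proof -
  define I where "I = [V]\<^bsup>2\<^esup>"
  define S where "S = (\<lambda>j. {v, j}) ` J"
  have fin: "finite I" unfolding I_def by (rule finite_nsets2[OF V])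
  have S: "S \<subseteq> I" using v by (auto simp: S_def I_def intro!: doubleton_in_nsets2)
  have cS: "card S = card J"
    unfolding S_def using v by (intro card_image) (auto simp: inj_on_def doubleton_eq_iff)
  have finS: "finite S" using S fin finite_subset by blast
  have "map_pmf (\<lambda>E. deg_into E v J) (indep_graph V f) =
      map_pmf (\<lambda>b. card {e \<in> S. b e}) (Pi_pmf I False (\<lambda>e. bernoulli_pmf (f e)))"
    unfolding indep_graph_def map_pmf_comp I_def[symmetric] deg_into_alt[OF v(2)] S_def[symmetric]
    using S by (intro map_pmf_cong refl arg_cong[where f=card]) auto
  also have "\<dots> = map_pmf (\<lambda>b. card {e \<in> S. b e}) (Pi_pmf S False (\<lambda>e. bernoulli_pmf (f e)))"
    unfolding Pi_pmf_subset[OF fin S] map_pmf_comp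
    by (intro map_pmf_cong refl arg_cong[where f=card]) auto
  also have "Pi_pmf S False (\<lambda>e. bernoulli_pmf (f e)) = Pi_pmf S False (\<lambda>e. bernoulli_pmf r)"
    using f by (intro Pi_pmf_cong) (auto simp: S_def)
  also have "map_pmf (\<lambda>b. card {e \<in> S. b e}) \<dots> = binomial_pmf (card J) r"
    using finS cS r by (subst binomial_pmf_altdef'[of S]) auto
  finally show ?thesis .
qed

lemma deg_into_cong_edges: "(\<And>j. j \<in> J \<Longrightarrow> {v, j} \<in> E \<longleftrightarrow> {v, j} \<in> E') \<Longrightarrow> deg_into E v J = deg_into E' v J"
  unfolding deg_into_def by (intro arg_cong[where f=card]) auto

lemma deg_into_pair_distr:
  fixes V :: "nat set"
  assumes V: "finite V" and v: "v \<in> V" "v \<notin> J" "J \<subseteq> V" "v \<notin> K" "K \<subseteq> V" and JK: "J \<inter> K = {}"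
    and f: "\<And>j. j \<in> J \<Longrightarrow> f {v, j} = r" "\<And>j. j \<in> K \<Longrightarrow> f {v, j} = s"
    and r: "0 \<le> r" "r \<le> 1" and s: "0 \<le> s" "s \<le> 1"
  shows "map_pmf (\<lambda>E. (deg_into E v J, deg_into E v K)) (indep_graph V f) =
    pair_pmf (binomial_pmf (card J) r) (binomial_pmf (card K) s)"
proof -
  have disj: "(\<lambda>j. {v, j}) ` J \<inter> (\<lambda>j. {v, j}) ` K = {}"
    using JK by (auto simp: doubleton_eq_iff)
  have "map_pmf (\<lambda>E. (deg_into E v J, deg_into E v K)) (indep_graph V f) =
    pair_pmf (map_pmf (\<lambda>E. deg_into E v J) (indep_graph V f)) (map_pmf (\<lambda>E. deg_into E v K) (indep_graph V f))"
    by (rule indep_graph_indep[OF V disj]) (auto intro!: deg_into_cong_edges)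
  then show ?thesis
    using deg_into_distr[OF V v(1-3) _ r, of f] deg_into_distr[OF V v(1,4,5) _ s, of f] f by simp
qed

text \<open>The stars around two distinct vertices can share only the pair \<open>{u, v}\<close>,
  and the assumptions exclude it.\<close>

lemma deg_into_indep:
  fixes V :: "nat set"
  assumes V: "finite V" and uv: "u \<noteq> v" "v \<notin> J" "v \<notin> K" "u \<notin> J'" "u \<notin> K'"
  shows "map_pmf (\<lambda>E. ((deg_into E u J, deg_into E u K), (deg_into E v J', deg_into E v K'))) (indep_graph V f) =
    pair_pmf (map_pmf (\<lambda>E. (deg_into E u J, deg_into E u K)) (indep_graph V f))
      (map_pmf (\<lambda>E. (deg_into E v J', deg_into E v K')) (indep_graph V f))"
proof (rule indep_graph_indep[OF V])
  show "(\<lambda>j. {u, j}) ` (J \<union> K) \<inter> (\<lambda>j. {v, j}) ` (J' \<union> K') = {}"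
    using uv by (auto simp: doubleton_eq_iff)
qed (auto intro!: deg_into_cong_edges)

section \<open>Hoeffding bounds for pairs of binomials\<close>

lemma prob_pair_fst: "measure_pmf.prob (pair_pmf A B) {(x, y). P x} = measure_pmf.prob A {x. P x}"
proof -
  have "measure_pmf.prob A {x. P x} = measure_pmf.prob (map_pmf fst (pair_pmf A B)) {x. P x}"
    by (simp add: map_fst_pair_pmf)
  also have "\<dots> = measure_pmf.prob (pair_pmf A B) {z. P (fst z)}"
    by (simp add: vimage_def)
  also have "{z. P (fst z)} = {(x, y). P x}" by auto
  finally show ?thesis by simp
qed

lemma prob_pair_snd: "measure_pmf.prob (pair_pmf A B) {(x, y). P y} = measure_pmf.prob B {y. P y}"
proof -
  have "measure_pmf.prob B {x. P x} = measure_pmf.prob (map_pmf snd (pair_pmf A B)) {x. P x}"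
    by (simp add: map_snd_pair_pmf)
  also have "\<dots> = measure_pmf.prob (pair_pmf A B) {z. P (snd z)}"
    by (simp add: vimage_def)
  also have "{z. P (snd z)} = {(x, y). P y}" by auto
  finally show ?thesis by simp
qed

lemma prob_pair_or:
  assumes "\<And>x y. Q x y \<Longrightarrow> P x \<or> R y"
  shows "measure_pmf.prob (pair_pmf A B) {(x, y). Q x y} \<le> measure_pmf.prob A {x. P x} + measure_pmf.prob B {y. R y}"
proof -
  have "measure_pmf.prob (pair_pmf A B) {(x, y). Q x y} \<le>
      measure_pmf.prob (pair_pmf A B) ({(x, y). P x} \<union> {(x, y). R y})"
    using assms by (intro measure_pmf.finite_measure_mono) auto
  also have "\<dots> \<le> measure_pmf.prob (pair_pmf A B) {(x, y). P x} + measure_pmf.prob (pair_pmf A B) {(x, y). R y}"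
    by (rule measure_Un_le) auto
  finally show ?thesis by (simp add: prob_pair_fst prob_pair_snd)
qed

lemma binomial_below_half:
  assumes "0 \<le> q" "q \<le> 1"
  shows "measure_pmf.prob (binomial_pmf l q) {x. real x < q * real l / 2} \<le> exp (- (q\<^sup>2 * real l / 2))"
proof (cases "l = 0")
  case True
  then show ?thesis using assms by simp
next
  case False
  have bd: "binomial_distribution q" using assms by unfold_locales auto
  have "measure_pmf.prob (binomial_pmf l q) {x. real x < q * real l / 2} \<le>
      measure_pmf.prob (binomial_pmf l q) {x. real x \<le> real l * q - real l * q / 2}"
    by (intro measure_pmf.finite_measure_mono) (auto simp: mult.commute)
  also have "\<dots> \<le> exp (- 2 * (real l * q / 2)\<^sup>2 / real l)"
    using False assms by (intro binomial_distribution.prob_le[OF bd]) auto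
  also have "- 2 * (real l * q / 2)\<^sup>2 / real l = - (q\<^sup>2 * real l / 2)"
    using False by (simp add: power2_eq_square field_simps)
  finally show ?thesis .
qed

text \<open>The midpoint j (p + q) / 2 separates the two means. If x is at most y, one of the counts
  has crossed it, which is a deviation by at least j (p - q) / 2.\<close>

lemma binomial_diff_nonpos:
  assumes pq: "0 < q" "q < p" "p \<le> 1" and kj: "k \<le> j"
  shows "binom_pair_prob j p k q {(x, y). x \<le> y}
    \<le> 2 * exp (- (real j * (p - q)\<^sup>2 / 2))"
proof (cases "j = 0")
  case True
  then show ?thesis using order_trans[OF measure_pmf.prob_le_1, of 2] by simp
next
  case False
  define r where "r = (p + q) / 2"
  define D where "D = real j * (p - q) / 2"
  have bd: "binomial_distribution p" "binomial_distribution q"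
    using pq by (auto intro!: binomial_distribution.intro)
  have "binom_pair_prob j p k q {(x, y). x \<le> y} \<le>
      measure_pmf.prob (binomial_pmf j p) {x. real x \<le> j * r} + measure_pmf.prob (binomial_pmf k q) {y. j * r \<le> real y}"
    by (rule prob_pair_or) linarith
  also have "measure_pmf.prob (binomial_pmf j p) {x. real x \<le> j * r} \<le> exp (- (real j * (p - q)\<^sup>2 / 2))"
  proof -
    have "j * r = j * p - D" by (simp add: r_def D_def field_simps)
    then have "measure_pmf.prob (binomial_pmf j p) {x. real x \<le> j * r} \<le> exp (- 2 * D\<^sup>2 / j)"
      using binomial_distribution.prob_le[OF bd(1), of j D] False pq by (simp add: D_def)
    also have "- 2 * D\<^sup>2 / j = - (real j * (p - q)\<^sup>2 / 2)"
      using False by (simp add: D_def power2_eq_square field_simps)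
    finally show ?thesis .
  qed
  also have "measure_pmf.prob (binomial_pmf k q) {y. j * r \<le> real y} \<le> exp (- (real j * (p - q)\<^sup>2 / 2))"
  proof (cases "k = 0")
    case True
    have "0 < r" using pq by (simp add: r_def)
    then have "0 < j * r" using False by simp
    then have "{y::nat. j * r \<le> real y} \<inter> {0} = {}" by (auto simp: not_le)
    moreover have "measure_pmf.prob (binomial_pmf k q) {y. j * r \<le> real y} = measure_pmf.prob (return_pmf 0) {y::nat. j * r \<le> real y}"
      using True pq binomial_pmf_0[of q] by simp
    ultimately show ?thesis using False \<open>0 < r\<close> by (simp add: mult_le_0_iff)
  next
    case k: False
    define e where "e = j * r - k * q"
    have "real k * q \<le> j * q" using kj pq by simp
    moreover have "e - D = j * q - k * q" by (simp add: e_def D_def r_def field_simps)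
    moreover have "0 \<le> D" using pq by (simp add: D_def)
    ultimately have e: "D \<le> e" "0 \<le> D" by linarith+
    have "measure_pmf.prob (binomial_pmf k q) {y. k * q + e \<le> real y} \<le> exp (- 2 * e\<^sup>2 / k)"
      using k e by (intro binomial_distribution.prob_ge[OF bd(2)]) auto
    also have "\<dots> \<le> exp (- (real j * (p - q)\<^sup>2 / 2))"
    proof -
      have "real j * (p - q)\<^sup>2 / 2 = 2 * (D\<^sup>2 / j)" 
        using False by (simp add: D_def power2_eq_square field_simps)
      also have "\<dots> \<le> 2 * (e\<^sup>2 / k)"
        using e kj k by (intro mult_left_mono frac_le power_mono) auto
      finally show ?thesis by simp
    qed
    finally show ?thesis by (simp add: e_def)
  qed
  finally show ?thesis by simp
qed

lemma binomial_diff_deviation: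
  assumes q: "0 \<le> q" "q \<le> 1" and p: "0 \<le> p" "p \<le> 1" and t: "0 \<le> t" and a: "0 < a"
  shows "binom_pair_prob a q b p
      {(x, y). real x - real y < real a * q - real b * p - 2 * t}
    \<le> exp (- 2 * t\<^sup>2 / real a) + exp (- 2 * t\<^sup>2 / real b)"
proof -
  have bd: "binomial_distribution p" "binomial_distribution q"
    using p q by (auto intro!: binomial_distribution.intro)
  have "binom_pair_prob a q b p
      {(x, y). real x - real y < real a * q - real b * p - 2 * t} \<le>
     measure_pmf.prob (binomial_pmf a q) {x. real x \<le> a * q - t} + measure_pmf.prob (binomial_pmf b p) {y. b * p + t \<le> real y}"
    by (rule prob_pair_or) linarith
  also have "measure_pmf.prob (binomial_pmf a q) {x. real x \<le> a * q - t} \<le> exp (- 2 * t\<^sup>2 / a)"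
    using a t by (intro binomial_distribution.prob_le[OF bd(2)]) auto
  also have "measure_pmf.prob (binomial_pmf b p) {y. b * p + t \<le> real y} \<le> exp (- 2 * t\<^sup>2 / b)"
    \<comment> \<open>For \<open>b = 0\<close> the right-hand side is exp 0 = 1, because division by
      zero yields 0.\<close>
    using t binomial_distribution.prob_ge[OF bd(1), of b t] by (cases "b = 0") auto
  finally show ?thesis by simp
qed

section \<open>Union bound and moment bounds for counts of vertices\<close>

lemma prob_exists_le:
  assumes "finite B" "\<And>v. v \<in> B \<Longrightarrow> measure_pmf.prob G {E. Q v E} \<le> \<eta>"
  shows "measure_pmf.prob G {E. \<exists>v\<in>B. Q v E} \<le> real (card B) * \<eta>"
proof -
  have "{E. \<exists>v\<in>B. Q v E} = (\<Union>v\<in>B. {E. Q v E})" by auto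
  then have "measure_pmf.prob G {E. \<exists>v\<in>B. Q v E} \<le> (\<Sum>v\<in>B. measure_pmf.prob G {E. Q v E})"
    using assms(1) by (simp add: measure_UNION_le)
  also have "\<dots> \<le> (\<Sum>v\<in>B. \<eta>)" using assms by (intro sum_mono) auto
  finally show ?thesis by simp
qed

lemma expectation_card:
  assumes "finite B"
  shows "measure_pmf.expectation G (\<lambda>E. real (card {v \<in> B. Q v E})) = (\<Sum>v\<in>B. measure_pmf.prob G {E. Q v E})"
proof -
  have "real (card {v \<in> B. Q v E}) = (\<Sum>v\<in>B. indicator {E. Q v E} E)" for E
    using assms by (simp add: indicator_def sum_of_bool_eq Int_def)
  then show ?thesis
    by (simp add: Bochner_Integration.integral_sum measure_pmf.integrable_const_bound[where B=1])
qed

text \<open>Markov's inequality: for upper bounds on a count, dependence between the vertices is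
  harmless.\<close>

lemma prob_card_ge:
  assumes B: "finite B" and m: "0 < m" and "\<And>v. v \<in> B \<Longrightarrow> measure_pmf.prob G {E. Q v E} \<le> \<pi>"
  shows "measure_pmf.prob G {E. m \<le> real (card {v \<in> B. Q v E})} \<le> real (card B) * \<pi> / m"
proof -
  let ?N = "\<lambda>E. real (card {v \<in> B. Q v E})"
  have "?N E \<le> real (card B)" for E using B by (auto intro!: card_mono)
  then have int: "integrable G ?N"
    by (intro measure_pmf.integrable_const_bound[where B="real (card B)"]) auto
  have ind: "integrable G (indicator {E. m \<le> ?N E} :: _ \<Rightarrow> real)"
    by (intro measure_pmf.integrable_const_bound[where B=1]) auto
  have "measure_pmf.prob G {E. m \<le> ?N E} = measure_pmf.expectation G (indicator {E. m \<le> ?N E})" by simp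
  also have "\<dots> \<le> measure_pmf.expectation G (\<lambda>E. ?N E / m)"
    using int m ind by (intro integral_mono) (auto simp: indicator_def field_simps)
  also have "\<dots> = (\<Sum>v\<in>B. measure_pmf.prob G {E. Q v E}) / m"
    by (simp add: expectation_card[OF B])
  also have "\<dots> \<le> (\<Sum>v\<in>B. \<pi>) / m"
    using assms by (intro divide_right_mono sum_mono) auto
  finally show ?thesis by simp
qed

text \<open>Chebyshev's inequality at half the mean. The first error term comes from the diagonal of
  the second moment, the other from the excess of the pair probabilities over
  \<open>\<pi>\<^sup>2\<close>.\<close>

lemma prob_card_small:
  assumes B: "finite B" "B \<noteq> {}" and \<pi>: "0 < \<pi>" and \<beta>: "0 \<le> \<beta>" and one: "\<And>v. v \<in> B \<Longrightarrow> measure_pmf.prob G {E. Q v E} = \<pi>"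
    and two: "\<And>u v. u \<in> B \<Longrightarrow> v \<in> B \<Longrightarrow> u \<noteq> v \<Longrightarrow> measure_pmf.prob G {E. Q u E \<and> Q v E} \<le> \<beta>"
  shows "measure_pmf.prob G {E. real (card {v \<in> B. Q v E}) \<le> real (card B) * \<pi> / 2}
    \<le> 4 / (real (card B) * \<pi>) + 4 * (\<beta> / \<pi>\<^sup>2 - 1)"
proof -
  define N where "N E = real (card {v \<in> B. Q v E})" for E
  define b where "b = real (card B)"
  define \<mu> where "\<mu> = b * \<pi>"
  let ?E = "measure_pmf.expectation G"
  have b: "0 < b" using B by (simp add: b_def card_gt_0_iff)
  have \<mu>: "0 < \<mu>" using b \<pi> by (simp add: \<mu>_def)
  have N_sum: "N E = (\<Sum>v\<in>B. indicator {E. Q v E} E)" for E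
    using B by (simp add: N_def indicator_def sum_of_bool_eq Int_def)
  have Nb: "0 \<le> N E" "N E \<le> b" for E using B by (auto simp: N_def b_def intro!: card_mono)
  then have N2b: "(N E)\<^sup>2 \<le> b\<^sup>2" for E by (intro power_mono)
  have int1: "integrable G N"
    using Nb by (intro measure_pmf.integrable_const_bound[where B=b]) auto
  have int2: "integrable G (\<lambda>E. (N E)\<^sup>2)"
    using N2b by (intro measure_pmf.integrable_const_bound[where B="b\<^sup>2"]) auto
  have EN: "?E N = \<mu>"
    unfolding N_def expectation_card[OF B(1)] using one by (simp add: \<mu>_def b_def)
  have sq: "(N E)\<^sup>2 = (\<Sum>u\<in>B. \<Sum>v\<in>B. indicator {E. Q u E \<and> Q v E} E)" for E
    unfolding N_sum power2_eq_square sum_product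
    by (intro sum.cong refl) (auto simp: indicator_def)
  have "?E (\<lambda>E. (N E)\<^sup>2) = (\<Sum>u\<in>B. \<Sum>v\<in>B. measure_pmf.prob G {E. Q u E \<and> Q v E})"
    unfolding sq by (simp add: Bochner_Integration.integral_sum measure_pmf.integrable_const_bound[where B=1])
  also have "\<dots> \<le> (\<Sum>u\<in>B. \<pi> + b * \<beta>)"
  proof (intro sum_mono)
    fix u assume u: "u \<in> B"
    have "(\<Sum>v\<in>B. measure_pmf.prob G {E. Q u E \<and> Q v E}) =
        measure_pmf.prob G {E. Q u E \<and> Q u E} + (\<Sum>v\<in>B-{u}. measure_pmf.prob G {E. Q u E \<and> Q v E})"
      by (rule sum.remove[OF B(1) u])
    also have "\<dots> \<le> \<pi> + (\<Sum>v\<in>B-{u}. \<beta>)"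
      using one[OF u] two[OF u] by (intro add_mono sum_mono) auto
    also have "\<dots> \<le> \<pi> + b * \<beta>"
      using card_Diff1_le[of B u] \<beta> by (auto simp: b_def intro!: mult_right_mono simp del: card_Diff_insert)
    finally show "(\<Sum>v\<in>B. measure_pmf.prob G {E. Q u E \<and> Q v E}) \<le> \<pi> + b * \<beta>" .
  qed
  also have "\<dots> = b * (\<pi> + b * \<beta>)" by (simp add: b_def)
  finally have E2: "?E (\<lambda>E. (N E)\<^sup>2) \<le> b * (\<pi> + b * \<beta>)" .
  have "measure_pmf.variance G N = ?E (\<lambda>E. (N E)\<^sup>2) - (?E N)\<^sup>2"
    using int1 int2 by (rule measure_pmf.variance_eq)
  then have var: "measure_pmf.variance G N \<le> b * (\<pi> + b * \<beta>) - \<mu>\<^sup>2"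
    using E2 EN by simp
  have "measure_pmf.prob G {E. N E \<le> \<mu> / 2} \<le> measure_pmf.prob G {E \<in> space G. \<mu> / 2 \<le> \<bar>N E - ?E N\<bar>}"
    using \<mu> by (intro measure_pmf.finite_measure_mono) (auto simp: EN abs_if)
  also have "\<dots> \<le> measure_pmf.variance G N / (\<mu> / 2)\<^sup>2"
    using \<mu> int2 by (intro measure_pmf.Chebyshev_inequality) auto
  also have "\<dots> \<le> (b * (\<pi> + b * \<beta>) - \<mu>\<^sup>2) / (\<mu> / 2)\<^sup>2"
    using var by (intro divide_right_mono) auto
  also have "\<dots> = 4 / (b * \<pi>) + 4 * (\<beta> / \<pi>\<^sup>2 - 1)"
    using b \<pi> by (simp add: \<mu>_def field_simps power2_eq_square)
  finally show ?thesis by (simp add: N_def \<mu>_def b_def)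
qed

section \<open>Events along the trajectory\<close>

text \<open>The state space is uncountable, so events involving two consecutive states need not be
  measurable for the product of the discrete \<open>\<sigma>\<close>-algebras; they are covered by measurable sets.\<close>

definition covered :: "'a measure \<Rightarrow> 'a set \<Rightarrow> real \<Rightarrow> bool" where
  "covered M A \<eta> \<longleftrightarrow> (\<exists>Z\<in>sets M. A \<subseteq> Z \<and> measure M Z \<le> \<eta>)"

lemma covered_mono: "covered M A \<eta> \<Longrightarrow> B \<subseteq> A \<Longrightarrow> \<eta> \<le> \<eta>' \<Longrightarrow> covered M B \<eta>'"
  unfolding covered_def by (elim bexE conjE) (rule bexI, auto)

lemma covered_Un: "covered M A \<eta> \<Longrightarrow> covered M B \<theta> \<Longrightarrow> covered M (A \<union> B) (\<eta> + \<theta>)"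
proof -
  assume "covered M A \<eta>" "covered M B \<theta>"
  then obtain Y Z where YZ: "Y \<in> sets M" "A \<subseteq> Y" "measure M Y \<le> \<eta>" "Z \<in> sets M" "B \<subseteq> Z" "measure M Z \<le> \<theta>"
    unfolding covered_def by auto
  then have "measure M (Y \<union> Z) \<le> \<eta> + \<theta>"
    using measure_Un_le[of Y M Z] by linarith
  with YZ show ?thesis unfolding covered_def by (intro bexI[of _ "Y \<union> Z"]) auto
qed

lemma covered_UN_finite:
  assumes "finite I" "\<And>i. i \<in> I \<Longrightarrow> covered M (A i) \<eta>"
  shows "covered M (\<Union>i\<in>I. A i) (real (card I) * \<eta>)"
  using assms
proof (induction I)
  case empty
  then show ?case by (auto simp: covered_def intro!: bexI[of _ "{}"])
next
  case (insert i I)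
  then have "covered M (A i \<union> (\<Union>i\<in>I. A i)) (\<eta> + real (card I) * \<eta>)"
    by (intro covered_Un) auto
  then show ?case using insert by (simp add: algebra_simps)
qed

text \<open>For almost sure properties that must hold on all days simultaneously.\<close>

lemma (in finite_measure) covered_UN_null:
  assumes "\<And>i::nat. covered M (A i) 0"
  shows "covered M (\<Union>i. A i) 0"
proof -
  obtain Z where Z: "\<And>i. Z i \<in> sets M" "\<And>i. A i \<subseteq> Z i" "\<And>i. measure M (Z i) \<le> 0"
  proof -
    have "\<forall>i. \<exists>Z. Z \<in> sets M \<and> A i \<subseteq> Z \<and> measure M Z \<le> 0"
      using assms unfolding covered_def by auto
    from choice[OF this] show ?thesis using that by auto
  qed
  have "Z i \<in> null_sets M" for i
    using Z(1,3)[of i] measure_nonneg[of M "Z i"] by (simp add: null_sets_def emeasure_eq_measure)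
  then have "(\<Union>i. Z i) \<in> null_sets M" by (intro null_sets_UN) 
  then have "measure M (\<Union>i. Z i) = 0" "(\<Union>i. Z i) \<in> sets M" by (auto simp: null_sets_def measure_def)
  then show ?thesis unfolding covered_def using Z(2) by (intro bexI[of _ "\<Union>i. Z i"]) auto
qed

lemma (in finite_measure) covered_measure_le:
  assumes "covered M A \<eta>"
  shows "measure M A \<le> \<eta>"
proof (cases "A \<in> sets M")
  case True
  obtain Z where "Z \<in> sets M" "A \<subseteq> Z" "measure M Z \<le> \<eta>" using assms unfolding covered_def by auto
  with finite_measure_mono[of A Z] show ?thesis by linarith
next
  \<comment> \<open>A set outside \<open>sets M\<close> has measure 0 by convention, so the bound
    persists.\<close>
  case False
  obtain Z where "Z \<in> sets M" "A \<subseteq> Z" "measure M Z \<le> \<eta>" using assms unfolding covered_def by auto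
  with measure_nonneg[of M Z] show ?thesis using measure_notin_sets[OF False] by linarith
qed

text \<open>Days after \<open>t\<close> carry \<open>undefined\<close>, so that a finite path
  determines exactly one function and the laws for all \<open>t\<close> live on one type.\<close>

fun path_pmf :: "real \<Rightarrow> real \<Rightarrow> nat set \<Rightarrow> opinions \<Rightarrow> nat \<Rightarrow> (nat \<Rightarrow> state) pmf" where
  "path_pmf p q V w 0 = map_pmf (\<lambda>x. (\<lambda>_. undefined)(0 := x)) (initial_law p q V w)"
| "path_pmf p q V w (Suc t) =
     bind_pmf (path_pmf p q V w t) (\<lambda>h. map_pmf (\<lambda>y. h(Suc t := y)) (next_day p q V (h t)))"

lemma path_pmf_undefined: "h \<in> set_pmf (path_pmf p q V w t) \<Longrightarrow> t < s \<Longrightarrow> h s = undefined"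
  by (induction t arbitrary: h s) auto

text \<open>The product coincides with that of \<open>trajectory_law_cylinder\<close>, which ties
  this discrete law to the measure on infinite trajectories.\<close>

lemma pmf_path_pmf:
  assumes "\<And>s. t < s \<Longrightarrow> h s = undefined"
  shows "pmf (path_pmf p q V w t) h =
    pmf (initial_law p q V w) (h 0) * (\<Prod>s<t. pmf (next_day p q V (h s)) (h (Suc s)))"
  using assms
proof (induction t arbitrary: h)
  case 0
  have "inj (\<lambda>x. (\<lambda>_. undefined :: state)(0 := x))"
    by (auto simp: inj_def fun_eq_iff)
  from pmf_map_inj'[OF this, of "initial_law p q V w" "h 0"]
  have "pmf (path_pmf p q V w 0) ((\<lambda>_. undefined)(0 := h 0)) = pmf (initial_law p q V w) (h 0)" by simp
  moreover have "(\<lambda>_. undefined)(0 := h 0) = h" using 0 by (auto simp: fun_eq_iff)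
  ultimately show ?case by simp
next
  case (Suc t)
  \<comment> \<open>The only shorter path from which the last draw can lead to
    \<open>h\<close>.\<close>
  define g where "g = h(Suc t := undefined)"
  let ?N = "\<lambda>k. map_pmf (\<lambda>y. k(Suc t := y)) (next_day p q V (k t))"
  have N: "pmf (?N k) h = pmf (next_day p q V (h t)) (h (Suc t)) * indicator {g} k"
    if k: "k \<in> set_pmf (path_pmf p q V w t)" for k
  proof (cases "k = g")
    case True
    have "inj (\<lambda>y. k(Suc t := y))" by (auto simp: inj_def fun_eq_iff)
    from pmf_map_inj'[OF this, of "next_day p q V (k t)" "h (Suc t)"]
    show ?thesis using True by (simp add: g_def)
  next
    case False
    have "h \<notin> set_pmf (?N k)"
    proof
      assume "h \<in> set_pmf (?N k)"
      then have "\<exists>y. h = k(Suc t := y)" by auto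
      then have "g = k(Suc t := undefined)" by (auto simp: g_def)
      also have "\<dots> = k" using path_pmf_undefined[OF k, of "Suc t"] by (auto simp: fun_eq_iff)
      finally show False using False by simp
    qed
    then have "pmf (?N k) h = 0" unfolding pmf_eq_0_set_pmf .
    then show ?thesis using False by simp
  qed
  have "pmf (path_pmf p q V w (Suc t)) h = measure_pmf.expectation (path_pmf p q V w t) (\<lambda>k. pmf (?N k) h)"
    by (simp add: pmf_bind)
  also have "\<dots> = measure_pmf.expectation (path_pmf p q V w t)
      (\<lambda>k. pmf (next_day p q V (h t)) (h (Suc t)) * indicator {g} k)"
    using N by (intro integral_cong_AE) (auto simp: AE_measure_pmf_iff)
  also have "\<dots> = pmf (next_day p q V (h t)) (h (Suc t)) * pmf (path_pmf p q V w t) g"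
    by (simp add: measure_pmf_single)
  also have "pmf (path_pmf p q V w t) g =
      pmf (initial_law p q V w) (g 0) * (\<Prod>s<t. pmf (next_day p q V (g s)) (g (Suc s)))"
    using Suc.prems by (intro Suc.IH) (auto simp: g_def Suc_lessI)
  also have "\<dots> = pmf (initial_law p q V w) (h 0) * (\<Prod>s<t. pmf (next_day p q V (h s)) (h (Suc s)))"
    by (auto simp: g_def intro!: arg_cong2[where f="(*)"] prod.cong)
  finally show ?case by (simp add: mult_ac)
qed

text \<open>Although \<open>A\<close> is arbitrary, the support of the path law is countable. The
  supported paths outside \<open>A\<close> form a countable disjoint union of measurable cylinders,
  and the complement of that union is the cover.\<close>

lemma trajectory_covered:
  "covered (trajectory_law p q V w) {\<omega>. (\<lambda>s. if s \<le> t then \<omega> s else undefined) \<in> A}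
    (measure_pmf.prob (path_pmf p q V w t) A)"
proof -
  let ?M = "trajectory_law p q V w" and ?P = "path_pmf p q V w t"
  interpret prob_space ?M by (rule prob_space_trajectory_law)
  define S where "S = set_pmf ?P - A"
  define cyl where "cyl h = {\<omega>. \<forall>s\<le>t. \<omega> s = h s}" for h :: "nat \<Rightarrow> state"
  have cS: "countable S" by (simp add: S_def)
  have cyl: "cyl h \<in> sets ?M" for h
  proof -
    have "cyl h = (\<Inter>s\<in>{..t}. {\<omega>. (\<lambda>x. x = h s) (\<omega> s)})" by (auto simp: cyl_def)
    also have "\<dots> \<in> sets ?M"
    proof (rule sets.finite_INT)
      fix s show "{\<omega>. (\<lambda>x. x = h s) (\<omega> s)} \<in> sets ?M" by (rule sets_trajectory_lawI)
    qed auto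
    finally show ?thesis .
  qed
  have disj: "disjoint_family_on cyl S"
    unfolding disjoint_family_on_def
  proof (intro ballI impI)
    fix h k assume hk: "h \<in> S" "k \<in> S" "h \<noteq> k"
    then obtain s where s: "h s \<noteq> k s" by (auto simp: fun_eq_iff)
    have "s \<le> t"
    proof (rule ccontr)
      assume "\<not> s \<le> t"
      then show False using s hk path_pmf_undefined[of h p q V w t s] path_pmf_undefined[of k p q V w t s]
        by (simp add: S_def)
    qed
    then show "cyl h \<inter> cyl k = {}" using s by (auto simp: cyl_def)
  qed
  have "emeasure ?M (\<Union>h\<in>S. cyl h) = (\<integral>\<^sup>+h. emeasure ?M (cyl h) \<partial>count_space S)"
    using cyl cS disj by (intro emeasure_UN_countable) auto
  also have "\<dots> = (\<integral>\<^sup>+h. pmf ?P h \<partial>count_space S)"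
  proof (intro nn_integral_cong)
    fix h assume "h \<in> space (count_space S)"
    then have "h s = undefined" if "t < s" for s using path_pmf_undefined that by (auto simp: S_def)
    then show "emeasure ?M (cyl h) = ennreal (pmf ?P h)"
      unfolding emeasure_eq_measure cyl_def trajectory_law_cylinder by (subst pmf_path_pmf) auto
  qed
  also have "\<dots> = emeasure ?P S" by (rule nn_integral_pmf)
  finally have "measure ?M (\<Union>h\<in>S. cyl h) = measure_pmf.prob ?P S"
    by (simp add: measure_def)
  also have "measure_pmf.prob ?P S = measure_pmf.prob ?P (- A)"
    by (intro measure_prob_cong_0) (auto simp: S_def set_pmf_iff)
  also have "\<dots> = 1 - measure_pmf.prob ?P A"
    using measure_pmf.prob_compl[of A ?P] by (simp add: Compl_eq_Diff_UNIV)
  finally have 1: "measure ?M (\<Union>h\<in>S. cyl h) = 1 - measure_pmf.prob ?P A" .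
  define Z where "Z = space ?M - (\<Union>h\<in>S. cyl h)"
  have U: "(\<Union>h\<in>S. cyl h) \<in> sets ?M" using cyl cS by (intro sets.countable_UN') auto
  have "measure ?M Z = measure_pmf.prob ?P A"
    unfolding Z_def using prob_compl[OF U] 1 by simp
  moreover have "{\<omega>. (\<lambda>s. if s \<le> t then \<omega> s else undefined) \<in> A} \<subseteq> Z"
  proof
    fix \<omega> assume a: "\<omega> \<in> {\<omega>. (\<lambda>s. if s \<le> t then \<omega> s else undefined) \<in> A}"
    have "\<omega> \<notin> cyl h" if h: "h \<in> S" for h
    proof
      assume "\<omega> \<in> cyl h"
      then have "(\<lambda>s. if s \<le> t then \<omega> s else undefined) = h"
        using h path_pmf_undefined[of h p q V w t] by (auto simp: cyl_def fun_eq_iff S_def)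
      then show False using a h by (auto simp: S_def)
    qed
    then show "\<omega> \<in> Z" by (auto simp: Z_def)
  qed
  moreover have "Z \<in> sets ?M" unfolding Z_def using U by (rule sets.compl_sets)
  ultimately show ?thesis unfolding covered_def by (intro bexI[of _ Z]) auto
qed

lemma trajectory_initial_covered:
  "covered (trajectory_law p q V w) {\<omega>. Q (\<omega> 0)} (measure_pmf.prob (initial_law p q V w) {x. Q x})"
  using trajectory_covered[of p q V w 0 "{h. Q (h 0)}"] by (simp add: vimage_def)

text \<open>The assumed bound is uniform in the current state, so it may be averaged over whatever
  law day \<open>t\<close> has.\<close>

lemma trajectory_step_covered:
  assumes "\<And>x. measure_pmf.prob (next_day p q V x) {y. Q x y} \<le> \<eta>"
  shows "covered (trajectory_law p q V w) {\<omega>. Q (\<omega> t) (\<omega> (Suc t))} \<eta>"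
proof -
  have "measure_pmf.prob (path_pmf p q V w (Suc t)) {h. Q (h t) (h (Suc t))} =
     measure_pmf.expectation (path_pmf p q V w t) (\<lambda>h. measure_pmf.prob (next_day p q V (h t)) {y. Q (h t) y})"
    by (simp add: measure_bind_pmf vimage_def)
  also have "\<dots> \<le> \<eta>"
    by (intro measure_pmf.integral_le_const measure_pmf.integrable_const_bound[where B=1])
      (auto simp: assms)
  finally have "measure_pmf.prob (path_pmf p q V w (Suc t)) {h. Q (h t) (h (Suc t))} \<le> \<eta>" .
  from covered_mono[OF trajectory_covered[of p q V w "Suc t"] _ this] show ?thesis by simp
qed

section \<open>Monotone trajectories\<close>

definition nbr_sum :: "nat set \<Rightarrow> edges \<Rightarrow> opinions \<Rightarrow> nat \<Rightarrow> int" where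
  "nbr_sum V E W v = (\<Sum>j\<in>{j \<in> V. {v, j} \<in> E}. W j)"

lemma majority_eq: "majority V E W v = (if nbr_sum V E W v \<noteq> 0 then sgn (nbr_sum V E W v) else W v)"
  by (simp add: majority_def nbr_sum_def Let_def)

lemma nbr_sum_of_bool: "finite V \<Longrightarrow> nbr_sum V E W v = (\<Sum>j\<in>V. W j * of_bool ({v, j} \<in> E))"
  unfolding nbr_sum_def by (simp add: sum.inter_filter if_distrib of_bool_def cong: if_cong)

lemma deg_into_of_bool: "finite J \<Longrightarrow> int (deg_into E v J) = (\<Sum>j\<in>J. of_bool ({v, j} \<in> E))"
  unfolding deg_into_def by (simp add: sum_of_bool_eq Int_def)

lemma nbr_sum_deg_into:
  assumes V: "finite V" and W: "\<And>i. i \<in> V \<Longrightarrow> W i \<in> {-1, 1}" and E: "E \<subseteq> [V]\<^bsup>2\<^esup>"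
  shows "nbr_sum V E W v = int (deg_into E v (plus_side V W - {v})) - int (deg_into E v (minus_side V W - {v}))"
proof -
  have vv: "{v, v} \<notin> E" using E by (auto simp: nsets_def)
  let ?g = "\<lambda>j. W j * of_bool ({v, j} \<in> E)"
  have Vs: "V = plus_side V W \<union> minus_side V W" "plus_side V W \<inter> minus_side V W = {}"
    using W by (auto simp: plus_side_def minus_side_def)
  have fin: "finite (plus_side V W)" "finite (minus_side V W)"
    using V by (auto simp: plus_side_def minus_side_def)
  have "nbr_sum V E W v = (\<Sum>j\<in>plus_side V W. ?g j) + (\<Sum>j\<in>minus_side V W. ?g j)"
    unfolding nbr_sum_of_bool[OF V] by (subst Vs(1), rule sum.union_disjoint) (use fin Vs in auto)
  also have "(\<Sum>j\<in>plus_side V W. ?g j) = (\<Sum>j\<in>plus_side V W - {v}. of_bool ({v, j} \<in> E))"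
    using vv fin by (intro sum.mono_neutral_cong_right) (auto simp: plus_side_def)
  also have "(\<Sum>j\<in>minus_side V W. ?g j) = (\<Sum>j\<in>minus_side V W - {v}. - of_bool ({v, j} \<in> E))"
    using vv fin by (intro sum.mono_neutral_cong_right) (auto simp: minus_side_def)
  finally show ?thesis using fin by (simp add: deg_into_of_bool sum_negf)
qed

text \<open>The almost sure part of a transition; pairs with an endpoint that changed are left
  free.\<close>

definition valid_step :: "nat set \<Rightarrow> state \<Rightarrow> state \<Rightarrow> bool" where
  "valid_step V x y \<longleftrightarrow> fst y = majority V (snd x) (fst x) \<and> snd y \<subseteq> [V]\<^bsup>2\<^esup> \<and>
     (\<forall>e\<in>[V]\<^bsup>2\<^esup>. (\<forall>i\<in>e. fst y i = fst x i) \<longrightarrow> (e \<in> snd y \<longleftrightarrow> e \<in> snd x))"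

text \<open>The conditions on \<open>A\<close> and on the values are part of the event, so that its
  probability is small from every previous state, also from those where the monotone picture has
  already failed.\<close>

definition fresh_bad :: "nat set \<Rightarrow> nat set \<Rightarrow> state \<Rightarrow> state \<Rightarrow> bool" where
  "fresh_bad V A x y \<longleftrightarrow> A \<subseteq> plus_side V (fst y) \<and> (\<forall>i\<in>V. fst y i \<in> {-1, 1}) \<and>
     (\<exists>v\<in>V. fst x v = -1 \<and> fst y v = 1 \<and> nbr_sum V (snd y) (fst y) v \<le> 0)"

definition flipped :: "nat set \<Rightarrow> state \<Rightarrow> state \<Rightarrow> nat set" where
  "flipped V x y = {j \<in> V. fst x j = -1 \<and> fst y j = 1}"

text \<open>Concentration of the fresh edges towards the flipped set needs a minimum size
  \<open>l\<close> of that set; smaller batches are never counted as failures.\<close>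

definition fresh_few :: "real \<Rightarrow> real \<Rightarrow> nat set \<Rightarrow> nat set \<Rightarrow> state \<Rightarrow> state \<Rightarrow> bool" where
  "fresh_few q l V A x y \<longleftrightarrow> A \<subseteq> plus_side V (fst y) \<and>
     (\<exists>v\<in>minus_side V (fst y). l \<le> real (card (flipped V x y)) \<and>
        real (deg_into (snd y) v (flipped V x y)) < q * real (card (flipped V x y)) / 2)"

text \<open>All randomness is packed into these assumptions, and the arguments inside the locale are
  deterministic. The condition \<open>fresh\<close> is imposed only up to day \<open>card V\<close>,
  since by then the opinions have stopped moving; this keeps the union bound finite.\<close>

locale good_path =
  fixes V :: "nat set" and w :: opinions and \<omega> :: "nat \<Rightarrow> state"
  assumes V: "finite V"
    and w: "\<And>i. i \<in> V \<Longrightarrow> w i \<in> {-1, 1}"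
    and start: "fst (\<omega> 0) = w" "snd (\<omega> 0) \<subseteq> [V]\<^bsup>2\<^esup>"
    and step: "\<And>t. valid_step V (\<omega> t) (\<omega> (Suc t))"
    and init: "\<And>v. v \<in> plus_side V w \<Longrightarrow> 0 < nbr_sum V (snd (\<omega> 0)) w v"
    and fresh: "\<And>t. t \<le> card V \<Longrightarrow> \<not> fresh_bad V (plus_side V w) (\<omega> t) (\<omega> (Suc t))"
begin

definition W :: "nat \<Rightarrow> opinions" where "W t = fst (\<omega> t)"
definition E :: "nat \<Rightarrow> edges" where "E t = snd (\<omega> t)"
definition S :: "nat \<Rightarrow> nat \<Rightarrow> int" where "S t v = nbr_sum V (E t) (W t) v"
definition R :: "nat \<Rightarrow> nat set" where "R t = {j \<in> V. w j = -1 \<and> W t j = 1}"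

lemma W0: "W 0 = w" using start by (simp add: W_def)

lemma E_sub: "E t \<subseteq> [V]\<^bsup>2\<^esup>"
proof (cases t)
  case 0
  then show ?thesis using start by (simp add: E_def)
next
  case (Suc s)
  then show ?thesis
    using step[of s, unfolded valid_step_def, THEN conjunct2, THEN conjunct1] by (simp add: E_def)
qed

lemma W_Suc: "W (Suc t) v = (if S t v \<noteq> 0 then sgn (S t v) else W t v)"
  using step[of t, unfolded valid_step_def, THEN conjunct1] by (simp add: W_def S_def E_def majority_eq)

lemma keep: "u \<in> V \<Longrightarrow> v \<in> V \<Longrightarrow> W (Suc t) u = W t u \<Longrightarrow> W (Suc t) v = W t v \<Longrightarrow>
    {u, v} \<in> E (Suc t) \<longleftrightarrow> {u, v} \<in> E t"
proof (cases "u = v")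
  case True
  then show ?thesis using E_sub[of t] E_sub[of "Suc t"] by (auto simp: nsets_def)
next
  case False
  assume uv: "u \<in> V" "v \<in> V" "W (Suc t) u = W t u" "W (Suc t) v = W t v"
  then have "{u, v} \<in> [V]\<^bsup>2\<^esup>" using False by (intro doubleton_in_nsets2)
  with step[of t, unfolded valid_step_def, THEN conjunct2, THEN conjunct2] uv
  show ?thesis unfolding W_def E_def by (elim ballE[of _ _ "{u, v}"]) auto
qed

lemma W_val: "v \<in> V \<Longrightarrow> W t v = -1 \<or> W t v = 1"
proof (induction t)
  case 0
  then show ?case using w by (auto simp: W0)
next
  case (Suc t)
  then show ?case unfolding W_Suc by (auto simp: sgn_if)
qed

text \<open>While only minus vertices flip, the sum at an old plus vertex cannot decrease: a
  neighbour that keeps its opinion contributes as before, one that flips goes from a contribution at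
  most 0 to one at least 0. A newly plus vertex has a positive sum by \<open>fresh\<close>.\<close>

lemma inv: "t \<le> Suc (card V) \<Longrightarrow> plus_side V w \<subseteq> plus_side V (W t) \<and> (\<forall>v\<in>V. W t v = 1 \<longrightarrow> 0 < S t v)"
proof (induction t)
  case 0
  then show ?case using init by (auto simp: W0 S_def E_def plus_side_def)
next
  case (Suc t)
  then have IH: "plus_side V w \<subseteq> plus_side V (W t)" "\<And>v. v \<in> V \<Longrightarrow> W t v = 1 \<Longrightarrow> 0 < S t v"
    by auto
  have mono: "W (Suc t) v = 1" if "v \<in> V" "W t v = 1" for v
    using IH(2)[OF that] by (simp add: W_Suc)
  have A: "plus_side V w \<subseteq> plus_side V (W (Suc t))"
    using IH(1) mono by (auto simp: plus_side_def)
  have "0 < S (Suc t) v" if v: "v \<in> V" "W (Suc t) v = 1" for v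
  proof (cases "W t v = 1")
    case True
    have "W t j * of_bool ({v, j} \<in> E t) \<le> W (Suc t) j * of_bool ({v, j} \<in> E (Suc t))" if j: "j \<in> V" for j
    proof (cases "W (Suc t) j = W t j")
      case True
      then show ?thesis using keep[OF v(1) j, of t] v \<open>W t v = 1\<close> by simp
    next
      case False
      then have "W t j = -1" "W (Suc t) j = 1"
        using W_val[OF j, of t] W_val[OF j, of "Suc t"] mono[OF j] by auto
      then show ?thesis by simp
    qed
    then have "S t v \<le> S (Suc t) v"
      unfolding S_def nbr_sum_of_bool[OF V] by (intro sum_mono)
    then show ?thesis using IH(2)[OF v(1) True] by simp
  next
    case False
    then have "W t v = -1" using W_val v by auto
    then show ?thesis
      using fresh[of t] A v W_val[of _ "Suc t"] Suc.prems
      unfolding fresh_bad_def W_def[symmetric] E_def[symmetric] S_def by force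
  qed
  with A show ?case by blast
qed

lemma mono_step: "t \<le> Suc (card V) \<Longrightarrow> v \<in> V \<Longrightarrow> W t v = 1 \<Longrightarrow> W (Suc t) v = 1"
  using inv[of t] by (simp add: W_Suc)

text \<open>If nobody changes, every pair keeps its status, so all sums and hence the next opinions
  repeat.\<close>

lemma frozen_step:
  assumes "\<forall>v\<in>V. W (Suc t) v = W t v"
  shows "\<forall>v\<in>V. W (Suc (Suc t)) v = W (Suc t) v"
proof
  fix v assume v: "v \<in> V"
  have "S (Suc t) v = S t v"
    unfolding S_def nbr_sum_of_bool[OF V]
    using keep[OF v, of _ t] assms v by (intro sum.cong) auto
  then have "W (Suc (Suc t)) v = (if S t v \<noteq> 0 then sgn (S t v) else W t v)"
    using assms v by (simp add: W_Suc[of "Suc t"])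
  then show "W (Suc (Suc t)) v = W (Suc t) v"
    by (simp add: W_Suc[of t])
qed

lemma frozen:
  assumes "\<forall>v\<in>V. W (Suc t) v = W t v" "t \<le> s"
  shows "(\<forall>v\<in>V. W (Suc s) v = W s v) \<and> (\<forall>v\<in>V. W s v = W t v)"
  using assms(2)
proof (induction rule: dec_induct)
  case base
  then show ?case using assms by simp
next
  case (step n)
  then show ?case using frozen_step[of n] by simp
qed

text \<open>Every day that is not frozen adds a plus vertex, and there are only
  \<open>card V\<close> vertices.\<close>

lemma ex_frozen: "\<exists>t\<le>card V. \<forall>v\<in>V. W (Suc t) v = W t v"
proof (rule ccontr)
  assume no: "\<not> ?thesis"
  have "t \<le> card (plus_side V (W t))" if "t \<le> Suc (card V)" for t
    using that
  proof (induction t)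
    case (Suc t)
    then obtain v where v: "v \<in> V" "W (Suc t) v \<noteq> W t v" using no by auto
    have vp: "W (Suc t) v = 1" "W t v \<noteq> 1"
      using v W_val[OF v(1), of t] W_val[OF v(1), of "Suc t"] mono_step[of t v] Suc.prems by auto
    have "plus_side V (W t) \<subset> plus_side V (W (Suc t))"
      using mono_step[of t] Suc.prems v vp by (auto simp: plus_side_def)
    then have "card (plus_side V (W t)) < card (plus_side V (W (Suc t)))"
      using V by (intro psubset_card_mono) (auto simp: plus_side_def)
    then show ?case using Suc by simp
  qed simp
  from this[of "Suc (card V)"] have "Suc (card V) \<le> card (plus_side V (W (Suc (card V))))" by simp
  also have "\<dots> \<le> card V" using V by (intro card_mono) (auto simp: plus_side_def)
  finally show False by simp
qed

text \<open>The finite horizon of \<open>mono_step\<close> suffices because a frozen day occurs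
  within it.\<close>

lemma mono: "v \<in> V \<Longrightarrow> s \<le> t \<Longrightarrow> W s v = 1 \<Longrightarrow> W t v = 1"
proof (induction t)
  case (Suc t)
  show ?case
  proof (cases "s = Suc t")
    case False
    then have 1: "W t v = 1" using Suc by auto
    show ?thesis
    proof (cases "t \<le> card V")
      case True
      then show ?thesis using mono_step 1 Suc by auto
    next
      case False
      obtain u where u: "u \<le> card V" "\<forall>v\<in>V. W (Suc u) v = W u v" using ex_frozen by blast
      then show ?thesis using frozen[OF u(2), of t] False 1 Suc by auto
    qed
  qed (use Suc in auto)
qed simp

lemma minus_not_win:
  assumes "plus_side V w \<noteq> {}"
  shows "\<omega> \<notin> minus_wins V"
proof
  assume "\<omega> \<in> minus_wins V"
  then obtain t where "card (minus_side V (W t)) = card V"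
    by (auto simp: minus_wins_def minus_wins_on_def opinion_def W_def)
  then have "minus_side V (W t) = V"
    using V by (intro card_subset_eq) (auto simp: minus_side_def)
  then have eq: "\<And>v. v \<in> V \<Longrightarrow> W t v = -1" by (auto simp: minus_side_def)
  obtain v where "v \<in> V" "w v = 1" using assms by (auto simp: plus_side_def)
  then have "W t v = -1" "W t v = 1"
    using eq[of v] mono[of v 0 t] by (auto simp: W0)
  then show False by simp
qed

text \<open>By monotonicity a vertex that shows its initial opinion on day \<open>t\<close> has
  never changed, so a pair of such vertices was never resampled.\<close>

lemma keep_initial:
  assumes u: "u \<in> V" "W t u = w u" and v: "v \<in> V" "W t v = w v"
  shows "{u, v} \<in> E t \<longleftrightarrow> {u, v} \<in> E 0"
proof -
  have const: "W s x = w x" if "x \<in> V" "W t x = w x" "s \<le> t" for s x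
    using that mono[of x 0 s] mono[of x s t] W_val[of x s] w[of x] by (auto simp: W0)
  have "s \<le> t \<Longrightarrow> {u, v} \<in> E s \<longleftrightarrow> {u, v} \<in> E 0" for s
  proof (induction s)
    case (Suc s)
    then show ?case using keep[OF u(1) v(1), of s] const[OF u, of s] const[OF u, of "Suc s"]
        const[OF v, of s] const[OF v, of "Suc s"] by simp
  qed simp
  from this[of t] show ?thesis by blast
qed

lemma finite_R: "finite (R t)" using V by (simp add: R_def)

text \<open>A converted vertex used to contribute - 1 along its initial edge to \<open>v\<close> and
  now contributes + 1 along its resampled edge. Therefore the old degree and the new degree into
  \<open>R t\<close> are both added.\<close>

lemma S_eq:
  assumes v: "v \<in> V" "W t v = -1"
  shows "S t v = S 0 v + int (deg_into (E t) v (R t)) + int (deg_into (E 0) v (R t))"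
proof -
  have wv: "w v = -1" using mono[of v 0 t] v w[of v] by (auto simp: W0)
  have RV: "R t \<subseteq> V" by (auto simp: R_def)
  let ?g = "\<lambda>s j. W s j * of_bool ({v, j} \<in> E s) :: int"
  have split: "S s v = (\<Sum>j\<in>V - R t. ?g s j) + (\<Sum>j\<in>R t. ?g s j)" for s
    unfolding S_def nbr_sum_of_bool[OF V] by (rule sum.subset_diff[OF RV V])
  have "(\<Sum>j\<in>V - R t. ?g t j) = (\<Sum>j\<in>V - R t. ?g 0 j)"
  proof (intro sum.cong refl)
    fix j assume j: "j \<in> V - R t"
    then have "W t j = w j"
      using W_val[of j t] mono[of j 0 t] w[of j] by (auto simp: R_def W0)
    then show "?g t j = ?g 0 j" using keep_initial[OF v(1) _ , of t j] j v wv by (simp add: W0)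
  qed
  moreover have "(\<Sum>j\<in>R t. ?g t j) = int (deg_into (E t) v (R t))"
    unfolding deg_into_of_bool[OF finite_R] by (intro sum.cong) (auto simp: R_def)
  moreover have "(\<Sum>j\<in>R t. ?g 0 j) = - int (deg_into (E 0) v (R t))"
    unfolding deg_into_of_bool[OF finite_R] sum_negf[symmetric] by (intro sum.cong) (auto simp: R_def W0)
  ultimately show ?thesis using split[of t] split[of 0] by simp
qed

lemma deg_into_le: "deg_into E' v (R t) \<le> card (R t)"
  unfolding deg_into_def using finite_R by (intro card_mono) auto

lemma halting:
  assumes A: "plus_side V w \<noteq> {}" and m: "m \<le> real (card (minus_side V w))"
    and few: "real (card {v \<in> minus_side V w. - 2 * m < real_of_int (S 0 v)}) < m"
  shows "\<omega> \<in> halts V"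
proof -
  let ?X = "{v \<in> minus_side V w. - 2 * m < real_of_int (S 0 v)}"
  have finX: "finite ?X" using V by (simp add: minus_side_def)
  have RX: "R t \<subseteq> ?X" for t
  proof (induction t)
    case 0
    then show ?case by (auto simp: R_def W0)
  next
    case (Suc t)
    have cR: "real (card (R t)) < m" using card_mono[OF finX Suc] few by linarith
    show ?case
    proof
      fix v assume v: "v \<in> R (Suc t)"
      show "v \<in> ?X"
      proof (cases "W t v = 1")
        case True
        then show ?thesis using v Suc by (auto simp: R_def)
      next
        case False
        then have vt: "v \<in> V" "W t v = -1" "w v = -1" "W (Suc t) v = 1" using v W_val[of v t] by (auto simp: R_def)
        then have "0 < S t v" by (auto simp: W_Suc sgn_if split: if_splits)
        \<comment> \<open>Both degrees in \<open>S_eq\<close> are at most the size of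
          \<open>R t\<close>; this is where the factor 2 in the trap set \<open>?X\<close> comes
          from.\<close>
        then have "- (2 * int (card (R t))) < S 0 v"
          using S_eq[OF vt(1,2)] deg_into_le[of "E t" v t] deg_into_le[of "E 0" v t] by linarith
        then have "- (2 * real (card (R t))) < real_of_int (S 0 v)" by linarith
        then show ?thesis using cR vt by (auto simp: minus_side_def)
      qed
    qed
  qed
  \<comment> \<open>Since \<open>m\<close> does not exceed the number of minus vertices, the trap
    set misses one of them. It never converts, which rules out plus consensus.\<close>
  have "?X \<noteq> minus_side V w" using few m by auto
  then obtain v where v: "v \<in> minus_side V w" "v \<notin> ?X" by blast
  then have stay: "W t v \<noteq> 1" "v \<in> V" for t using RX[of t] by (auto simp: R_def minus_side_def)
  have "\<omega> \<notin> plus_wins V"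
  proof
    assume "\<omega> \<in> plus_wins V"
    then obtain t where "card (plus_side V (W t)) = card V"
      by (auto simp: plus_wins_def plus_wins_on_def opinion_def W_def)
    then have "plus_side V (W t) = V"
      using V by (intro card_subset_eq) (auto simp: plus_side_def)
    then show False using stay by (auto simp: plus_side_def)
  qed
  moreover obtain t where "\<forall>v\<in>V. W (Suc t) v = W t v" using ex_frozen by blast
  then have "\<forall>s\<ge>t. \<forall>i\<in>V. opinion \<omega> (Suc s) i = opinion \<omega> s i"
    using frozen[of t] unfolding opinion_def W_def[symmetric] by blast
  then have "\<exists>T. \<forall>t\<ge>T. \<forall>i\<in>V. opinion \<omega> (Suc t) i = opinion \<omega> t i" by (rule exI)
  ultimately show ?thesis using minus_not_win[OF A] by (auto simp: halts_def)
qed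

lemma plus_wins_onI:
  assumes "\<And>v. v \<in> minus_side V w \<Longrightarrow> W t v = 1"
  shows "\<omega> \<in> plus_wins_on V t"
proof -
  have "W t v = 1" if "v \<in> V" for v
    using assms[of v] w[OF that] that mono[of v 0 t] by (auto simp: minus_side_def W0)
  then have "plus_side V (W t) = V" by (auto simp: plus_side_def)
  then show ?thesis by (simp add: plus_wins_on_def opinion_def W_def)
qed

section \<open>Consensus on the first three days\<close>

lemma first_day:
  assumes "\<And>v. v \<in> minus_side V w \<Longrightarrow> 0 < S 0 v"
  shows "\<omega> \<in> plus_wins_on V 1"
proof (rule plus_wins_onI)
  fix v assume "v \<in> minus_side V w"
  from assms[OF this] show "W 1 v = 1" using W_Suc[of 0 v] by simp
qed

lemma plus_mono: "plus_side V w \<subseteq> plus_side V (W t)"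
  using mono[of _ 0 t] by (auto simp: plus_side_def W0)

lemma R1: "R 1 = {v \<in> minus_side V w. 0 < S 0 v}"
  by (auto simp: R_def minus_side_def W_Suc W0 sgn_if split: if_splits)

lemma R_mono: "s \<le> t \<Longrightarrow> R s \<subseteq> R t"
  using mono[of _ s t] by (auto simp: R_def)

text \<open>Subtracting \<open>l\<close> makes the bound trivial for batches smaller than
  \<open>l\<close>, so that later estimates need no case distinction.\<close>

lemma fresh_degree:
  assumes few: "\<not> fresh_few q l V (plus_side V w) (\<omega> t) (\<omega> (Suc t))" and q: "0 \<le> q" and l: "0 \<le> l"
    and v: "v \<in> V" "W (Suc t) v = -1"
  shows "q * (real (card (R (Suc t) - R t)) - l) / 2 \<le> real (deg_into (E (Suc t)) v (R (Suc t) - R t))"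
proof -
  have F: "flipped V (\<omega> t) (\<omega> (Suc t)) = R (Suc t) - R t"
  proof -
    have "W t j \<noteq> 1 \<and> W (Suc t) j = 1 \<longrightarrow> w j = -1" if "j \<in> V" for j
      using w[OF that] mono[OF that, of 0 t] by (auto simp: W0)
    then show ?thesis using W_val[of _ t]
      by (auto simp: flipped_def R_def W_def[symmetric])
  qed
  show ?thesis
  proof (cases "l \<le> real (card (R (Suc t) - R t))")
    case True
    have "q * real (card (R (Suc t) - R t)) / 2 \<le> real (deg_into (E (Suc t)) v (R (Suc t) - R t))"
      using few plus_mono[of "Suc t"] v True unfolding fresh_few_def F W_def[symmetric] E_def[symmetric]
      by (auto simp: minus_side_def not_less)
    moreover have "0 \<le> q * l" using q l by simp
    ultimately show ?thesis by (simp add: algebra_simps)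
  next
    case False
    then have "q * (real (card (R (Suc t) - R t)) - l) / 2 \<le> 0" using q by (simp add: mult_nonneg_nonpos)
    then show ?thesis by linarith
  qed
qed

lemma R0: "R 0 = {}" by (auto simp: R_def W0)

lemma second_day_sum:
  assumes few: "\<not> fresh_few q l V (plus_side V w) (\<omega> 0) (\<omega> 1)" and q: "0 \<le> q" and l: "0 \<le> l"
    and v: "v \<in> V" "W 1 v = -1"
  shows "real_of_int (S 0 v) + q * (real (card (R 1)) - l) / 2 \<le> real_of_int (S 1 v)"
  using fresh_degree[OF few[unfolded One_nat_def] q l, of v] v S_eq[of v 1] R0 by simp

lemma second_day_flip:
  assumes few: "\<not> fresh_few q l V (plus_side V w) (\<omega> 0) (\<omega> 1)" and q: "0 \<le> q" and l: "0 \<le> l"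
    and v: "v \<in> minus_side V w" "- (q * (real (card (R 1)) - l) / 2) < real_of_int (S 0 v)"
  shows "W 2 v = 1"
proof (cases "W 1 v = 1")
  case True
  then show ?thesis using mono[of v 1 2] v by (auto simp: minus_side_def)
next
  case False
  then have "W 1 v = -1" "v \<in> V" using v W_val[of v 1] by (auto simp: minus_side_def)
  from second_day_sum[OF few q l this(2,1)] v have "0 < S 1 v" by linarith
  then show ?thesis using W_Suc[of 1 v] by (simp add: numeral_2_eq_2)
qed

text \<open>Here \<open>c\<close> bounds the worst initial deficit, and the first batch supplies
  every remaining vertex with at least that many fresh plus edges.\<close>

lemma second_day:
  assumes few: "\<not> fresh_few q l V (plus_side V w) (\<omega> 0) (\<omega> 1)" and q: "0 \<le> q" and l: "0 \<le> l"
    and c: "\<And>v. v \<in> minus_side V w \<Longrightarrow> - c < real_of_int (S 0 v)"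
    and N: "c \<le> q * (real (card {v \<in> minus_side V w. 0 < S 0 v}) - l) / 2"
  shows "\<omega> \<in> plus_wins_on V 2"
proof (rule plus_wins_onI)
  fix v assume v: "v \<in> minus_side V w"
  show "W 2 v = 1"
    using second_day_flip[OF few q l v] c[OF v] N unfolding R1 by linarith
qed

text \<open>The first batch lowers the level from 0 to \<open>- s\<close>, and everything above that
  level is converted by day two. The vertices of \<open>R 2\<close> arrive in two batches with
  independent concentration defects, whence \<open>2 * l\<close>.\<close>

lemma third_day:
  assumes few: "\<not> fresh_few q l V (plus_side V w) (\<omega> 0) (\<omega> 1)" "\<not> fresh_few q l V (plus_side V w) (\<omega> 1) (\<omega> 2)"
    and q: "0 \<le> q" and l: "0 \<le> l"
    and c: "\<And>v. v \<in> minus_side V w \<Longrightarrow> - c < real_of_int (S 0 v)"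
    and s: "s \<le> q * (real (card {v \<in> minus_side V w. 0 < S 0 v}) - l) / 2"
    and N: "c \<le> q * (real (card {v \<in> minus_side V w. - s < real_of_int (S 0 v)}) - 2 * l) / 2"
  shows "\<omega> \<in> plus_wins_on V 3"
proof (rule plus_wins_onI)
  fix v assume v: "v \<in> minus_side V w"
  have R2: "{v \<in> minus_side V w. - s < real_of_int (S 0 v)} \<subseteq> R 2"
  proof
    fix u assume u: "u \<in> {v \<in> minus_side V w. - s < real_of_int (S 0 v)}"
    then have "- (q * (real (card (R 1)) - l) / 2) < real_of_int (S 0 u)" using s unfolding R1 by auto
    then have "W 2 u = 1" using u by (intro second_day_flip[OF few(1) q l]) auto
    then show "u \<in> R 2" using u by (auto simp: R_def minus_side_def)
  qed
  show "W 3 v = 1"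
  proof (cases "W 2 v = 1")
    case True
    then show ?thesis using mono[of v 2 3] v by (auto simp: minus_side_def)
  next
    case False
    then have v2: "v \<in> V" "W 2 v = -1" using v W_val[of v 2] by (auto simp: minus_side_def)
    then have v1: "W 1 v = -1" using W_val[of v 1] mono[of v 1 2] by auto
    have R12: "R 1 \<subseteq> R 2" by (rule R_mono) simp
    have d1: "q * (real (card (R 1)) - l) / 2 \<le> real (deg_into (E 1) v (R 1))"
      using fresh_degree[OF few(1)[unfolded One_nat_def] q l, of v] v1 v2 R0 by simp
    have d2: "q * (real (card (R 2 - R 1)) - l) / 2 \<le> real (deg_into (E 2) v (R 2 - R 1))"
      using fresh_degree[of q l 1 v] few(2) q l v2 by (simp add: numeral_2_eq_2)
    \<comment> \<open>Neither \<open>v\<close> nor the first batch changes on day two, so the edges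
      resampled on day one survive.\<close>
    have "deg_into (E 2) v (R 1) = deg_into (E 1) v (R 1)"
    proof (rule deg_into_cong_edges)
      fix j assume j: "j \<in> R 1"
      then have "j \<in> V" "W 1 j = 1" "W 2 j = 1" using R12 by (auto simp: R_def)
      then show "{v, j} \<in> E 2 \<longleftrightarrow> {v, j} \<in> E 1"
        using keep[of v j 1] v1 v2 by (simp add: numeral_2_eq_2)
    qed
    moreover have "int (deg_into (E 2) v (R 2)) = int (deg_into (E 2) v (R 2 - R 1)) + int (deg_into (E 2) v (R 1))"
      using finite_R[of 2] finite_subset[OF R12 finite_R[of 2]]
      by (simp only: deg_into_of_bool finite_Diff sum.subset_diff[OF R12 finite_R[of 2]])
    moreover have "card (R 2) = card (R 2 - R 1) + card (R 1)"
      using R12 finite_R[of 2] by (metis card_Diff_subset card_mono finite_subset le_add_diff_inverse2)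
    ultimately have "q * (real (card (R 2)) - 2 * l) / 2 \<le> real (deg_into (E 2) v (R 2))"
      using d1 d2 by (simp add: algebra_simps add_divide_distrib diff_divide_distrib)
    moreover have "real (card {v \<in> minus_side V w. - s < real_of_int (S 0 v)}) \<le> real (card (R 2))"
      using card_mono[OF finite_R R2] by simp
    then have "q * (real (card {v \<in> minus_side V w. - s < real_of_int (S 0 v)}) - 2 * l) / 2 \<le> q * (real (card (R 2)) - 2 * l) / 2"
      using q by (intro divide_right_mono mult_left_mono) auto
    ultimately have "c \<le> real (deg_into (E 2) v (R 2))" using N by linarith
    then have "0 < S 2 v" using S_eq[OF v2] c[OF v] by linarith
    then show ?thesis using W_Suc[of 2 v] by (simp add: numeral_3_eq_3 numeral_2_eq_2)
  qed
qed

end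

section \<open>Reduction to the initial graph\<close>

lemma edge_prob_pair: "i \<noteq> j \<Longrightarrow> edge_prob p q W {i, j} = (if W i * W j = 1 then p else q)"
  by (simp add: edge_prob_def)

lemma next_day_eq:
  "next_day p q V (W, E) = map_pmf (Pair (majority V E W)) (indep_graph V
     (\<lambda>e. if \<forall>i\<in>e. majority V E W i = W i then of_bool (e \<in> E) else edge_prob p q (majority V E W) e))"
  by (simp add: next_day_def rewire_def Let_def)

text \<open>Only the pairs at \<open>v\<close> need block-model probabilities. The lemma thus
  applies to the initial graph and also after a rewiring, where all pairs at a vertex that has just
  flipped are fresh. The \<open>m - 1\<close> accounts for \<open>v\<close> itself.\<close>

lemma nbr_sum_nonpos_prob:
  fixes V :: "nat set"
  assumes V: "finite V" and W: "\<And>i. i \<in> V \<Longrightarrow> W i \<in> {-1, 1}" and pq: "0 < q" "q < p" "p \<le> 1"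
    and v: "v \<in> V" "W v = 1" and f: "\<And>j. j \<in> V \<Longrightarrow> j \<noteq> v \<Longrightarrow> f {v, j} = edge_prob p q W {v, j}"
    and m: "m \<le> card (plus_side V W)" "card (minus_side V W) < m"
  shows "measure_pmf.prob (indep_graph V f) {E. nbr_sum V E W v \<le> 0} \<le> 2 * exp (- (real (m - 1) * (p - q)\<^sup>2 / 2))"
proof -
  let ?J = "plus_side V W - {v}" and ?K = "minus_side V W - {v}"
  have fin: "finite (plus_side V W)" "finite (minus_side V W)" using V by (auto simp: plus_side_def minus_side_def)
  have vK: "?K = minus_side V W" using v by (auto simp: minus_side_def)
  have cJ: "m - 1 \<le> card ?J" using m fin v by (simp add: plus_side_def)
  have law: "map_pmf (\<lambda>E. (deg_into E v ?J, deg_into E v ?K)) (indep_graph V f) =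
      pair_pmf (binomial_pmf (card ?J) p) (binomial_pmf (card ?K) q)"
  proof (rule deg_into_pair_distr[OF V v(1)])
    fix j
    show "f {v, j} = p" if "j \<in> ?J" using that v by (subst f) (auto simp: plus_side_def edge_prob_pair)
    show "f {v, j} = q" if "j \<in> ?K"
    proof -
      have "v \<noteq> j" using that by auto
      then show ?thesis using that v by (subst f) (auto simp: minus_side_def edge_prob_pair)
    qed
  qed (use pq in \<open>auto simp: plus_side_def minus_side_def\<close>)
  have "measure_pmf.prob (indep_graph V f) {E. nbr_sum V E W v \<le> 0} =
      measure_pmf.prob (indep_graph V f) {E. deg_into E v ?J \<le> deg_into E v ?K}"
  proof (intro measure_pmf.finite_measure_eq_AE)
    show "AE E in indep_graph V f. (E \<in> {E. nbr_sum V E W v \<le> 0}) = (E \<in> {E. deg_into E v ?J \<le> deg_into E v ?K})"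
      by (intro AE_pmfI) (auto simp: nbr_sum_deg_into[OF V W set_indep_graph])
  qed auto
  also have "\<dots> = measure_pmf.prob (map_pmf (\<lambda>E. (deg_into E v ?J, deg_into E v ?K)) (indep_graph V f)) {(x, y). x \<le> y}"
    by (simp add: vimage_def)
  also have "\<dots> \<le> 2 * exp (- (real (card ?J) * (p - q)\<^sup>2 / 2))"
    unfolding law using cJ m vK by (intro binomial_diff_nonpos pq) simp
  also have "\<dots> \<le> 2 * exp (- (real (m - 1) * (p - q)\<^sup>2 / 2))"
    using cJ by (auto intro!: mult_right_mono divide_right_mono)
  finally show ?thesis .
qed

locale block_model =
  fixes p q :: real and V :: "nat set" and w :: opinions and m n :: nat
  assumes pq: "0 < q" "q < p" "p \<le> 1" and V: "finite V" and lab: "labelling V m n w" and nm: "n < m"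
begin

abbreviation "A \<equiv> plus_side V w"
abbreviation "B \<equiv> minus_side V w"
abbreviation "M \<equiv> trajectory_law p q V w"
abbreviation "Pr \<equiv> measure_pmf.prob (sbm p q V w)"
abbreviation "adv E v \<equiv> nbr_sum V E w v"

lemma w: "i \<in> V \<Longrightarrow> w i \<in> {-1, 1}" and cA: "card A = m" and cB: "card B = n"
  using lab by (auto simp: labelling_def)

lemma sides: "V = A \<union> B" "A \<inter> B = {}" "finite A" "finite B"
  using w V by (auto simp: plus_side_def minus_side_def)

lemma cV: "card V = m + n"
  using sides cA cB by (metis card_Un_disjoint)

definition \<eta> :: real where "\<eta> = 2 * exp (- (real (m - 1) * (p - q)\<^sup>2 / 2))"

text \<open>If the guards in \<open>fresh_bad\<close> fail, the event is impossible. Otherwise the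
  new majority still contains \<open>A\<close>, and a flipped vertex sees a completely resampled
  neighbourhood.\<close>

lemma fresh_bad_prob: "measure_pmf.prob (next_day p q V x) {y. fresh_bad V A x y} \<le> real (card V) * \<eta>"
proof -
  obtain W E where x: "x = (W, E)" by (cases x)
  define W' where "W' = majority V E W"
  define f where "f = (\<lambda>e. if \<forall>i\<in>e. W' i = W i then of_bool (e \<in> E) else edge_prob p q W' e)"
  have nd: "next_day p q V x = map_pmf (Pair W') (indep_graph V f)"
    unfolding x next_day_eq W'_def f_def ..
  show ?thesis
  proof (cases "A \<subseteq> plus_side V W' \<and> (\<forall>i\<in>V. W' i \<in> {-1, 1})")
    case False
    then have "{y. fresh_bad V A x y} \<inter> range (Pair W') = {}" by (auto simp: fresh_bad_def)
    then have "measure_pmf.prob (next_day p q V x) {y. fresh_bad V A x y} = 0"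
      by (auto simp: nd vimage_def measure_pmf_zero_iff)
    then show ?thesis by (simp add: \<eta>_def)
  next
    case True
    have cp: "m \<le> card (plus_side V W')" 
      using True V card_mono[of "plus_side V W'" A] cA by (auto simp: plus_side_def)
    have "minus_side V W' \<subseteq> B" using True w by (force simp: plus_side_def minus_side_def)
    from card_mono[OF sides(4) this] have cm: "card (minus_side V W') < m" using cB nm by simp
    have "measure_pmf.prob (next_day p q V x) {y. fresh_bad V A x y} \<le>
        measure_pmf.prob (indep_graph V f) {E'. \<exists>v\<in>{v \<in> V. W v = -1 \<and> W' v = 1}. nbr_sum V E' W' v \<le> 0}"
      unfolding nd by (auto simp: vimage_def fresh_bad_def x intro!: measure_pmf.finite_measure_mono)
    also have "\<dots> \<le> real (card {v \<in> V. W v = -1 \<and> W' v = 1}) * \<eta>"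
    proof (rule prob_exists_le)
      fix v assume v: "v \<in> {v \<in> V. W v = -1 \<and> W' v = 1}"
      show "measure_pmf.prob (indep_graph V f) {E. nbr_sum V E W' v \<le> 0} \<le> \<eta>"
        unfolding \<eta>_def
        using v True cp cm by (intro nbr_sum_nonpos_prob V pq) (auto simp: f_def)
    qed (use V in auto)
    also have "\<dots> \<le> real (card V) * \<eta>"
      using V by (intro mult_right_mono) (auto simp: \<eta>_def intro!: card_mono)
    finally show ?thesis .
  qed
qed

text \<open>A pair between a vertex that is now minus and one that has just turned plus is resampled
  with probability \<open>q\<close>, so these degrees are binomial and Hoeffding applies.\<close>

lemma fresh_few_prob:
  "measure_pmf.prob (next_day p q V x) {y. fresh_few q l V A x y} \<le> real n * exp (- (q\<^sup>2 * l / 2))"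
proof -
  obtain W E where x: "x = (W, E)" by (cases x)
  define W' where "W' = majority V E W"
  define f where "f = (\<lambda>e. if \<forall>i\<in>e. W' i = W i then of_bool (e \<in> E) else edge_prob p q W' e)"
  define F where "F = {j \<in> V. W j = -1 \<and> W' j = 1}"
  have nd: "next_day p q V x = map_pmf (Pair W') (indep_graph V f)"
    unfolding x next_day_eq W'_def f_def ..
  show ?thesis
  proof (cases "A \<subseteq> plus_side V W' \<and> l \<le> real (card F)")
    case False
    then have "{y. fresh_few q l V A x y} \<inter> range (Pair W') = {}"
      by (auto simp: fresh_few_def flipped_def F_def x)
    then have "measure_pmf.prob (next_day p q V x) {y. fresh_few q l V A x y} = 0"
      by (auto simp: nd vimage_def measure_pmf_zero_iff)
    then show ?thesis by simp
  next
    case True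
    have sub: "minus_side V W' \<subseteq> B" using True w by (force simp: plus_side_def minus_side_def)
    then have fin: "finite (minus_side V W')" "card (minus_side V W') \<le> n"
      using card_mono[OF sides(4)] cB finite_subset sides(4) by auto
    have "measure_pmf.prob (next_day p q V x) {y. fresh_few q l V A x y} \<le>
        measure_pmf.prob (indep_graph V f) {E'. \<exists>v\<in>minus_side V W'. real (deg_into E' v F) < q * real (card F) / 2}"
      unfolding nd by (auto simp: vimage_def fresh_few_def flipped_def F_def x intro!: measure_pmf.finite_measure_mono)
    also have "\<dots> \<le> real (card (minus_side V W')) * exp (- (q\<^sup>2 * l / 2))"
    proof (rule prob_exists_le[OF fin(1)])
      fix v assume v: "v \<in> minus_side V W'"
      have law: "map_pmf (\<lambda>E'. deg_into E' v F) (indep_graph V f) = binomial_pmf (card F) q"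
      proof (rule deg_into_distr[OF V])
        fix j assume j: "j \<in> F"
        then have "v \<noteq> j" using v by (auto simp: minus_side_def F_def)
        then show "f {v, j} = q" using j v by (auto simp: minus_side_def F_def f_def edge_prob_pair)
      qed (use v pq in \<open>auto simp: minus_side_def F_def\<close>)
      have "measure_pmf.prob (indep_graph V f) {E'. real (deg_into E' v F) < q * real (card F) / 2} =
          measure_pmf.prob (map_pmf (\<lambda>E'. deg_into E' v F) (indep_graph V f)) {x. real x < q * real (card F) / 2}"
        by (simp add: vimage_def)
      also have "\<dots> \<le> exp (- (q\<^sup>2 * real (card F) / 2))"
        unfolding law using pq by (intro binomial_below_half) auto
      also have "\<dots> \<le> exp (- (q\<^sup>2 * l / 2))"
        using True by (auto intro!: mult_left_mono)
      finally show "measure_pmf.prob (indep_graph V f) {E'. real (deg_into E' v F) < q * real (card F) / 2} \<le> exp (- (q\<^sup>2 * l / 2))" .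
    qed
    also have "\<dots> \<le> real n * exp (- (q\<^sup>2 * l / 2))"
      using fin by (intro mult_right_mono) auto
    finally show ?thesis .
  qed
qed

text \<open>Kept pairs are drawn with probability 0 or 1, so the support of the next state respects
  them.\<close>

lemma valid_step_prob: "measure_pmf.prob (next_day p q V x) {y. \<not> valid_step V x y} = 0"
proof -
  obtain W E where x: "x = (W, E)" by (cases x)
  have "valid_step V x y" if y: "y \<in> set_pmf (next_day p q V x)" for y
  proof -
    define W' where "W' = majority V E W"
    define f where "f = (\<lambda>e. if \<forall>i\<in>e. W' i = W i then of_bool (e \<in> E) else edge_prob p q W' e)"
    obtain E' where E': "y = (W', E')" "E' \<in> set_pmf (indep_graph V f)"
      using y unfolding x next_day_eq W'_def[symmetric] f_def[symmetric] by auto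
    then obtain b where b: "b \<in> set_pmf (Pi_pmf ([V]\<^bsup>2\<^esup>) False (\<lambda>e. bernoulli_pmf (f e)))" "E' = {e \<in> [V]\<^bsup>2\<^esup>. b e}"
      by (auto simp: indep_graph_def)
    have be: "b e \<longleftrightarrow> e \<in> E" if e: "e \<in> [V]\<^bsup>2\<^esup>" "\<forall>i\<in>e. W' i = W i" for e
    proof -
      have "b e \<in> set_pmf (bernoulli_pmf (of_bool (e \<in> E)))"
        using b(1) e unfolding set_Pi_pmf[OF finite_nsets2[OF V]] PiE_dflt_def f_def by fastforce
      then show ?thesis by (cases "e \<in> E"; cases "b e") (auto simp: set_pmf_iff)
    qed
    show ?thesis
      unfolding valid_step_def using be set_indep_graph[OF E'(2)]
      by (auto simp: E'(1) x W'_def[symmetric] b(2))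
  qed
  then show ?thesis by (auto simp: measure_pmf_zero_iff)
qed

lemma initial_prob: "measure_pmf.prob (initial_law p q V w) {x. Q (snd x)} = Pr {E. Q E}"
  by (simp add: initial_law_def vimage_def)

lemma sbm_initial_bad: "Pr {E. \<exists>v\<in>A. adv E v \<le> 0} \<le> real m * \<eta>"
proof -
  have "Pr {E. \<exists>v\<in>A. adv E v \<le> 0} \<le> real (card A) * \<eta>"
    unfolding sbm_def
  proof (rule prob_exists_le[OF sides(3)])
    fix v assume "v \<in> A"
    then show "measure_pmf.prob (indep_graph V (edge_prob p q w)) {E. adv E v \<le> 0} \<le> \<eta>"
      unfolding \<eta>_def using cA cB nm w by (intro nbr_sum_nonpos_prob V pq) (auto simp: plus_side_def)
  qed
  then show ?thesis by (simp add: cA)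
qed

text \<open>A generous total for the failure of the initial plus vertices and of the fresh vertices
  on days up to \<open>card V\<close>.\<close>

definition \<gamma> :: real where "\<gamma> = (2 * real m + 2) * (2 * real m) * \<eta>"

text \<open>Validity is a countable union of null events (\<open>X3\<close>), whereas the
  quantitative events are needed on finitely many days only (\<open>X4\<close>).\<close>

lemma good_path_covered: "covered M {\<omega>. \<not> good_path V w \<omega>} \<gamma>"
proof -
  interpret MM: prob_space M by (rule prob_space_trajectory_law)
  define X1 where "X1 = {\<omega>::nat \<Rightarrow> state. (\<lambda>x. \<not> (fst x = w \<and> snd x \<subseteq> [V]\<^bsup>2\<^esup>)) (\<omega> 0)}"
  define X2 where "X2 = {\<omega>::nat \<Rightarrow> state. (\<lambda>x. \<exists>v\<in>A. nbr_sum V (snd x) w v \<le> 0) (\<omega> 0)}"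
  define X3 where "X3 = (\<Union>t. {\<omega>. (\<lambda>x y. \<not> valid_step V x y) (\<omega> t) (\<omega> (Suc t))})"
  define X4 where "X4 = (\<Union>t\<in>{..card V}. {\<omega>. (\<lambda>x y. fresh_bad V A x y) (\<omega> t) (\<omega> (Suc t))})"
  have "measure_pmf.prob (initial_law p q V w) {x. \<not> (fst x = w \<and> snd x \<subseteq> [V]\<^bsup>2\<^esup>)} = 0"
    by (auto simp: measure_pmf_zero_iff initial_law_def sbm_def dest!: set_indep_graph)
  then have 1: "covered M X1 0"
    unfolding X1_def using trajectory_initial_covered[of p q V w "\<lambda>x. \<not> (fst x = w \<and> snd x \<subseteq> [V]\<^bsup>2\<^esup>)"] by simp
  have "covered M X2 (measure_pmf.prob (initial_law p q V w) {x. \<exists>v\<in>A. nbr_sum V (snd x) w v \<le> 0})"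
    unfolding X2_def by (rule trajectory_initial_covered)
  then have 2: "covered M X2 (real m * \<eta>)"
    by (rule covered_mono) (use sbm_initial_bad initial_prob[of "\<lambda>E. \<exists>v\<in>A. adv E v \<le> 0"] in auto)
  have 3: "covered M X3 0"
    unfolding X3_def
    by (intro MM.covered_UN_null trajectory_step_covered) (simp add: valid_step_prob)
  have 4: "covered M X4 (real (card {..card V}) * (real (card V) * \<eta>))"
    unfolding X4_def by (intro covered_UN_finite trajectory_step_covered fresh_bad_prob) auto
  have "covered M ((X1 \<union> X2) \<union> (X3 \<union> X4)) ((0 + real m * \<eta>) + (0 + real (card {..card V}) * (real (card V) * \<eta>)))"
    by (intro covered_Un 1 2 3 4)
  moreover have "{\<omega>. \<not> good_path V w \<omega>} \<subseteq> (X1 \<union> X2) \<union> (X3 \<union> X4)"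
  proof
    fix \<omega> assume a: "\<omega> \<in> {\<omega>. \<not> good_path V w \<omega>}"
    show "\<omega> \<in> (X1 \<union> X2) \<union> (X3 \<union> X4)"
    proof (rule ccontr)
      assume no: "\<omega> \<notin> (X1 \<union> X2) \<union> (X3 \<union> X4)"
      have "good_path V w \<omega>"
      proof
        show "valid_step V (\<omega> t) (\<omega> (Suc t))" for t using no by (auto simp: X3_def)
        show "\<not> fresh_bad V A (\<omega> t) (\<omega> (Suc t))" if "t \<le> card V" for t using no that by (auto simp: X4_def)
        show "0 < nbr_sum V (snd (\<omega> 0)) w v" if "v \<in> A" for v using no that by (force simp: X2_def)
      qed (use no V w in \<open>auto simp: X1_def\<close>)
      then show False using a by simp
    qed
  qed
  moreover have "(0 + real m * \<eta>) + (0 + real (card {..card V}) * (real (card V) * \<eta>)) \<le> \<gamma>"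
  proof -
    have \<eta>: "0 \<le> \<eta>" by (simp add: \<eta>_def)
    have c: "real (card V) \<le> 2 * real m" "real (card V) \<le> 2 * real m - 1" using cV nm by linarith+
    have "real m + (real (card V) + 1) * real (card V) \<le> 2 * real m + 2 * real m * (2 * real m)"
      using c by (intro add_mono mult_mono) auto
    also have "\<dots> \<le> (2 * real m + 2) * (2 * real m)" by (simp add: algebra_simps)
    finally show ?thesis
      unfolding \<gamma>_def using mult_right_mono[OF _ \<eta>] by (fastforce simp: algebra_simps)
  qed
  ultimately show ?thesis using covered_mono by blast
qed

lemma static_covered:
  "covered M {\<omega>. Q (snd (\<omega> 0))} (Pr {E. Q E})"
  using trajectory_initial_covered[of p q V w "\<lambda>x. Q (snd x)"] by (simp add: initial_prob)

lemma prob_ge_of_covered: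
  assumes "X \<in> sets M" "covered M (- X) \<theta>"
  shows "1 - \<theta> \<le> measure M X"
proof -
  interpret MM: prob_space M by (rule prob_space_trajectory_law)
  have "measure M (- X) \<le> \<theta>" by (rule MM.covered_measure_le[OF assms(2)])
  moreover have "measure M (- X) = 1 - measure M X"
    using MM.prob_compl[OF assms(1)] by (simp add: Compl_eq_Diff_UNIV)
  ultimately show ?thesis by simp
qed

lemma S0_eq: "good_path V w \<omega> \<Longrightarrow> good_path.S V \<omega> 0 v = nbr_sum V (snd (\<omega> 0)) w v"
  by (simp add: good_path.S_def good_path.E_def good_path.W0)

lemma m_pos: "A \<noteq> {}" using cA nm by (metis card.empty not_less_zero)

lemma minus_wins_prob: "measure M (minus_wins V) \<le> \<gamma>"
proof -
  interpret MM: prob_space M by (rule prob_space_trajectory_law)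
  have "covered M (minus_wins V) \<gamma>"
    using good_path_covered
    by (rule covered_mono) (use good_path.minus_not_win m_pos in auto)
  then show ?thesis by (rule MM.covered_measure_le)
qed

lemma halts_prob:
  assumes \<mu>: "\<mu> \<le> real n"
  shows "1 - (\<gamma> + Pr {E. \<mu> \<le> real (card {v \<in> B. - 2 * \<mu> < real_of_int (adv E v)})})
    \<le> measure M (halts V)"
proof (rule prob_ge_of_covered[OF sets_halts[OF V] covered_mono[OF covered_Un[OF good_path_covered static_covered]]])
  show "- halts V \<subseteq> {\<omega>. \<not> good_path V w \<omega>} \<union>
      {\<omega>. \<mu> \<le> real (card {v \<in> B. - 2 * \<mu> < real_of_int (nbr_sum V (snd (\<omega> 0)) w v)})}" (is "_ \<subseteq> ?R")
  proof
    fix \<omega> assume \<omega>: "\<omega> \<in> - halts V"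
    show "\<omega> \<in> ?R"
    proof (rule ccontr)
      assume no: "\<not> ?thesis"
      then have g: "good_path V w \<omega>" by simp
      have "\<omega> \<in> halts V"
        by (rule good_path.halting[OF g m_pos, of \<mu>]) (use no \<mu> cB S0_eq[OF g] in \<open>auto simp: not_le\<close>)
      then show False using \<omega> by simp
    qed
  qed
qed simp

lemma first_day_prob:
  "1 - (\<gamma> + Pr {E. \<exists>v\<in>B. adv E v \<le> 0}) \<le> measure M (plus_wins_on V 1)"
proof (rule prob_ge_of_covered[OF sets_wins_on(1) covered_mono[OF covered_Un[OF good_path_covered static_covered]]])
  show "- plus_wins_on V 1 \<subseteq> {\<omega>. \<not> good_path V w \<omega>} \<union> {\<omega>. \<exists>v\<in>B. nbr_sum V (snd (\<omega> 0)) w v \<le> 0}" (is "_ \<subseteq> ?R")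
  proof
    fix \<omega> assume \<omega>: "\<omega> \<in> - plus_wins_on V 1"
    show "\<omega> \<in> ?R"
    proof (rule ccontr)
      assume no: "\<not> ?thesis"
      then have g: "good_path V w \<omega>" by simp
      have "\<omega> \<in> plus_wins_on V 1"
        by (rule good_path.first_day[OF g]) (use no S0_eq[OF g] in \<open>auto simp: not_le\<close>)
      then show False using \<omega> by simp
    qed
  qed
qed simp

lemma second_day_prob:
  assumes l: "0 \<le> l"
  shows "1 - (\<gamma> + real n * exp (- (q\<^sup>2 * l / 2))
     + Pr {E. \<exists>v\<in>B. real_of_int (adv E v) \<le> - c}
     + Pr {E. q * (real (card {v \<in> B. 0 < adv E v}) - l) / 2 < c})
   \<le> measure M (plus_wins_on V 2)"
proof (rule prob_ge_of_covered[OF sets_wins_on(1) covered_mono[OF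
      covered_Un[OF covered_Un[OF covered_Un[OF good_path_covered
      trajectory_step_covered[where Q="fresh_few q l V A" and t=0, OF fresh_few_prob]] static_covered] static_covered]]])
  show "- plus_wins_on V 2 \<subseteq> {\<omega>. \<not> good_path V w \<omega>} \<union> {\<omega>. fresh_few q l V A (\<omega> 0) (\<omega> (Suc 0))} \<union>
      {\<omega>. \<exists>v\<in>B. real_of_int (nbr_sum V (snd (\<omega> 0)) w v) \<le> - c} \<union>
      {\<omega>. q * (real (card {v \<in> B. 0 < nbr_sum V (snd (\<omega> 0)) w v}) - l) / 2 < c}" (is "_ \<subseteq> ?R")
  proof
    fix \<omega> assume \<omega>: "\<omega> \<in> - plus_wins_on V 2"
    show "\<omega> \<in> ?R"
    proof (rule ccontr)
      assume no: "\<not> ?thesis"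
      then have g: "good_path V w \<omega>" by simp
      have "\<omega> \<in> plus_wins_on V 2"
        by (rule good_path.second_day[OF g, of q l c]) (use no l pq S0_eq[OF g] in \<open>auto simp: not_le not_less\<close>)
      then show False using \<omega> by simp
    qed
  qed
qed simp

lemma third_day_prob:
  assumes l: "0 \<le> l"
  shows "1 - (\<gamma> + real n * exp (- (q\<^sup>2 * l / 2)) + real n * exp (- (q\<^sup>2 * l / 2))
     + Pr {E. \<exists>v\<in>B. real_of_int (adv E v) \<le> - c}
     + Pr {E. q * (real (card {v \<in> B. 0 < adv E v}) - l) / 2 < s}
     + Pr {E. q * (real (card {v \<in> B. - s < real_of_int (adv E v)}) - 2 * l) / 2 < c})
   \<le> measure M (plus_wins_on V 3)"
proof (rule prob_ge_of_covered[OF sets_wins_on(1) covered_mono[OF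
      covered_Un[OF covered_Un[OF covered_Un[OF covered_Un[OF covered_Un[OF good_path_covered
      trajectory_step_covered[where Q="fresh_few q l V A" and t=0, OF fresh_few_prob]]
      trajectory_step_covered[where Q="fresh_few q l V A" and t=1, OF fresh_few_prob]]
      static_covered] static_covered] static_covered]]])
  show "- plus_wins_on V 3 \<subseteq> {\<omega>. \<not> good_path V w \<omega>} \<union> {\<omega>. fresh_few q l V A (\<omega> 0) (\<omega> (Suc 0))} \<union>
      {\<omega>. fresh_few q l V A (\<omega> 1) (\<omega> (Suc 1))} \<union>
      {\<omega>. \<exists>v\<in>B. real_of_int (nbr_sum V (snd (\<omega> 0)) w v) \<le> - c} \<union>
      {\<omega>. q * (real (card {v \<in> B. 0 < nbr_sum V (snd (\<omega> 0)) w v}) - l) / 2 < s} \<union>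
      {\<omega>. q * (real (card {v \<in> B. - s < real_of_int (nbr_sum V (snd (\<omega> 0)) w v)}) - 2 * l) / 2 < c}" (is "_ \<subseteq> ?R")
  proof
    fix \<omega> assume \<omega>: "\<omega> \<in> - plus_wins_on V 3"
    show "\<omega> \<in> ?R"
    proof (rule ccontr)
      assume no: "\<not> ?thesis"
      then have g: "good_path V w \<omega>" by simp
      have "\<omega> \<in> plus_wins_on V 3"
        by (rule good_path.third_day[OF g, of q l c s])
          (use no l pq S0_eq[OF g] in \<open>auto simp: not_le not_less numeral_2_eq_2\<close>)
      then show False using \<omega> by simp
    qed
  qed
qed simp

end

section \<open>Counts of minus vertices by their initial sum\<close>

context block_model
begin

text \<open>The set \<open>K\<close> is \<open>{v}\<close> for one vertex and \<open>{u, v}\<close>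
  for a pair. The subset \<open>A0\<close> allows a number of plus neighbours that does not depend
  on the true size of the plus side.\<close>

lemma sbm_deg_law:
  assumes v: "v \<in> B" "v \<in> K" and K: "K \<subseteq> B" and A0: "A0 \<subseteq> A"
  shows "map_pmf (\<lambda>E. (deg_into E v A0, deg_into E v (B - K))) (sbm p q V w) =
    pair_pmf (binomial_pmf (card A0) q) (binomial_pmf (n - card K) p)"
proof -
  have c: "card (B - K) = n - card K"
    using K sides cB by (simp add: card_Diff_subset finite_subset)
  have "map_pmf (\<lambda>E. (deg_into E v A0, deg_into E v (B - K))) (sbm p q V w) =
    pair_pmf (binomial_pmf (card A0) q) (binomial_pmf (card (B - K)) p)"
    unfolding sbm_def
  proof (rule deg_into_pair_distr[OF V])
    fix j
    have ne: "v \<noteq> j" if "j \<in> A0 \<union> (B - K)"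
      using that v A0 sides by auto
    show "edge_prob p q w {v, j} = q" if "j \<in> A0"
      using ne that v A0 by (auto simp: edge_prob_pair plus_side_def minus_side_def)
    show "edge_prob p q w {v, j} = p" if "j \<in> B - K"
      using ne that v by (auto simp: edge_prob_pair plus_side_def minus_side_def)
  qed (use v A0 sides pq in auto)
  then show ?thesis by (simp only: c)
qed

lemma sbm_deg_prob:
  assumes v: "v \<in> B" "v \<in> K" and K: "K \<subseteq> B" and A0: "A0 \<subseteq> A"
  shows "Pr {E. Q (deg_into E v A0) (deg_into E v (B - K))} =
    binom_pair_prob (card A0) q (n - card K) p {(i, j). Q i j}"
  unfolding sbm_deg_law[OF assms, symmetric] by (simp add: vimage_def)

lemma nbr_sum_minus:
  assumes v: "v \<in> B" and E: "E \<in> set_pmf (sbm p q V w)"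
  shows "adv E v = int (deg_into E v A) - int (deg_into E v (B - {v}))"
proof -
  have "A - {v} = A" using v sides by auto
  moreover have "adv E v = int (deg_into E v (A - {v})) - int (deg_into E v (B - {v}))"
    using E unfolding sbm_def by (intro nbr_sum_deg_into V w set_indep_graph)
  ultimately show ?thesis by simp
qed

lemma nbr_sum_minus_ge:
  assumes v: "v \<in> B" and E: "E \<in> set_pmf (sbm p q V w)" and A0: "A0 \<subseteq> A"
  shows "int (deg_into E v A0) - int (deg_into E v (B - {v})) \<le> adv E v"
proof -
  have "deg_into E v A0 \<le> deg_into E v A"
    unfolding deg_into_def using A0 sides by (intro card_mono) auto
  then show ?thesis unfolding nbr_sum_minus[OF v E] by simp
qed

lemma sbm_mono_AE:
  assumes "\<And>E. E \<in> set_pmf (sbm p q V w) \<Longrightarrow> P E \<Longrightarrow> Q E"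
  shows "Pr {E. P E} \<le> Pr {E. Q E}"
  using assms by (intro measure_pmf.finite_measure_mono_AE) (auto intro!: AE_pmfI)

lemma static_few:
  assumes \<mu>: "0 < \<mu>"
  shows "Pr {E. \<mu> \<le> real (card {v \<in> B. - 2 * \<mu> < real_of_int (adv E v)})}
    \<le> real n * binom_pair_prob m q (n - 1) p {(i, j). - (2 * \<mu>) \<le> real i - real j} / \<mu>"
  unfolding cB[symmetric]
proof (rule prob_card_ge[OF sides(4) \<mu>])
  fix v assume v: "v \<in> B"
  have "Pr {E. - 2 * \<mu> < real_of_int (adv E v)} \<le>
    Pr {E. - (2 * \<mu>) \<le> real (deg_into E v A) - real (deg_into E v (B - {v}))}"
    by (intro sbm_mono_AE) (auto simp: nbr_sum_minus[OF v])
  also have "\<dots> = binom_pair_prob (card A) q (n - card {v}) p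
      {(i, j). - (2 * \<mu>) \<le> real i - real j}"
    by (rule sbm_deg_prob[OF v]) (use v in auto)
  finally show "Pr {E. - 2 * \<mu> < real_of_int (adv E v)} \<le>
      binom_pair_prob m q (card B - 1) p {(i, j). - (2 * \<mu>) \<le> real i - real j}"
    by (simp add: cA cB)
qed

text \<open>Ignoring plus neighbours only lowers the sum, so a subset of size \<open>a\<close> may
  stand in for the whole plus side.\<close>

lemma static_all:
  assumes a: "a \<le> m"
  shows "Pr {E. \<exists>v\<in>B. real_of_int (adv E v) \<le> - c}
    \<le> real n * binom_pair_prob a q (n - 1) p {(i, j). real i - real j \<le> - c}"
proof -
  obtain A0 where A0: "A0 \<subseteq> A" "card A0 = a"
    using obtain_subset_with_card_n[of a A] a cA by metis
  have "Pr {E. \<exists>v\<in>B. real_of_int (adv E v) \<le> - c} \<le> real (card B) *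
     binom_pair_prob a q (n - 1) p {(i, j). real i - real j \<le> - c}"
  proof (rule prob_exists_le[OF sides(4)])
    fix v assume v: "v \<in> B"
    have "Pr {E. real_of_int (adv E v) \<le> - c} \<le>
      Pr {E. real (deg_into E v A0) - real (deg_into E v (B - {v})) \<le> - c}"
    proof (intro sbm_mono_AE)
      fix E assume "E \<in> set_pmf (sbm p q V w)" "real_of_int (adv E v) \<le> - c"
      then show "real (deg_into E v A0) - real (deg_into E v (B - {v})) \<le> - c"
        using nbr_sum_minus_ge[OF v _ A0(1), of E] by linarith
    qed
    also have "\<dots> = binom_pair_prob (card A0) q (n - card {v}) p
        {(i, j). real i - real j \<le> - c}"
      by (rule sbm_deg_prob[OF v]) (use v A0 in auto)
    finally show "Pr {E. real_of_int (adv E v) \<le> - c} \<le>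
      binom_pair_prob a q (n - 1) p {(i, j). real i - real j \<le> - c}"
      by (simp add: A0)
  qed
  then show ?thesis by (simp add: cB)
qed

lemma deg_into_remove:
  assumes "u \<in> B" "u \<noteq> v"
  shows "deg_into E v (B - {u, v}) \<le> deg_into E v (B - {v})"
    and "deg_into E v (B - {v}) \<le> deg_into E v (B - {u, v}) + 1"
proof -
  have eq: "B - {v} = insert u (B - {u, v})" using assms by auto
  have "int (deg_into E v (B - {v})) = of_bool ({v, u} \<in> E) + int (deg_into E v (B - {u, v}))"
    unfolding eq using sides(4) by (subst (1 2) deg_into_of_bool) (auto simp del: of_bool_eq_1_iff)
  then show "deg_into E v (B - {u, v}) \<le> deg_into E v (B - {v})"
    and "deg_into E v (B - {v}) \<le> deg_into E v (B - {u, v}) + 1"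
    by (auto simp: of_bool_def split: if_splits)
qed

text \<open>Two counts \<open>deg_into E u \<dots>\<close> and \<open>deg_into E v \<dots>\<close> are correlated only through the pair
  \<open>{u, v}\<close>; leaving it out makes them independent and costs a single point probability \<open>\<rho>\<close>.\<close>

lemma static_many:
  assumes a: "a \<le> m" and n: "0 < n"
    and \<pi>: "\<pi> = diff_tail a q (n - 1) p s"
    and \<pi>0: "0 < \<pi>"
    and \<rho>: "\<rho> = diff_point a q (n - 2) p (\<lfloor>- s\<rfloor> + 1)"
  shows "Pr {E. real (card {v \<in> B. - s < real_of_int (adv E v)}) \<le> real n * \<pi> / 2}
    \<le> 4 / (real n * \<pi>) + 4 * ((1 + \<rho> / \<pi>)\<^sup>2 - 1)"
proof -
  obtain A0 where A0: "A0 \<subseteq> A" "card A0 = a"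
    using obtain_subset_with_card_n[of a A] a cA by metis
  define T where "T E v = real (deg_into E v A0) - real (deg_into E v (B - {v}))" for E v
  let ?G = "sbm p q V w"
  let ?a0 = "diff_tail a q (n - 2) p s"
  have one: "Pr {E. - s < T E v} = \<pi>" if v: "v \<in> B" for v
    using sbm_deg_prob[of v "{v}" A0 "\<lambda>i j. - s < real i - real j"] v A0 by (simp add: T_def \<pi>)
  have pair: "?a0 \<le> \<pi> + \<rho> \<and> Pr {E. - s < T E u \<and> - s < T E v} \<le> ?a0\<^sup>2"
    if uv: "u \<in> B" "v \<in> B" "u \<noteq> v" for u v
  proof
    have c2: "card {u, v} = 2" using uv by simp
    have law: "Pr {E. Q (deg_into E x A0) (deg_into E x (B - {u, v}))} =
      binom_pair_prob a q (n - 2) p {(i, j). Q i j}" if "x = u \<or> x = v" for x Q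
      using sbm_deg_prob[of x "{u, v}" A0 Q, unfolded c2 A0(2)] uv that A0(1) by auto
    have "?a0 = Pr {E. - s < real (deg_into E v A0) - real (deg_into E v (B - {u, v}))}"
      by (rule law[symmetric]) simp
    \<comment> \<open>Putting the pair \<open>{u, v}\<close> back lowers the difference by at most
      1. The tail event is lost only if the difference was the least integer above
      \<open>- s\<close>.\<close>
    also have "\<dots> \<le> Pr ({E. - s < T E v} \<union>
        {E. int (deg_into E v A0) - int (deg_into E v (B - {u, v})) = \<lfloor>- s\<rfloor> + 1})"
    proof (rule measure_pmf.finite_measure_mono)
      show "{E. - s < real (deg_into E v A0) - real (deg_into E v (B - {u, v}))} \<subseteq> {E. - s < T E v} \<union>
        {E. int (deg_into E v A0) - int (deg_into E v (B - {u, v})) = \<lfloor>- s\<rfloor> + 1}"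
      proof
        fix E assume E: "E \<in> {E. - s < real (deg_into E v A0) - real (deg_into E v (B - {u, v}))}"
        define d where "d = int (deg_into E v A0) - int (deg_into E v (B - {u, v}))"
        have d: "- s < real_of_int d" using E by (simp add: d_def)
        have T: "real_of_int d - 1 \<le> T E v"
          using deg_into_remove(2)[OF uv(1,3), of E] by (simp add: T_def d_def)
        show "E \<in> {E. - s < T E v} \<union> {E. int (deg_into E v A0) - int (deg_into E v (B - {u, v})) = \<lfloor>- s\<rfloor> + 1}"
        proof (cases "- s < real_of_int d - 1")
          case True
          then show ?thesis using T by simp
        next
          case False
          then have "d = \<lfloor>- s\<rfloor> + 1" using d by linarith
          then show ?thesis by (simp add: d_def)
        qed
      qed
    qed auto
    also have "\<dots> \<le> Pr {E. - s < T E v} +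
        Pr {E. int (deg_into E v A0) - int (deg_into E v (B - {u, v})) = \<lfloor>- s\<rfloor> + 1}"
      by (rule measure_Un_le) auto
    also have "Pr {E. int (deg_into E v A0) - int (deg_into E v (B - {u, v})) = \<lfloor>- s\<rfloor> + 1} = \<rho>"
      unfolding \<rho> by (rule law) simp
    finally show "?a0 \<le> \<pi> + \<rho>" using one[OF uv(2)] by simp
  next
    let ?X = "\<lambda>E x. (deg_into E x A0, deg_into E x (B - {u, v}))"
    let ?P = "pair_pmf (binomial_pmf a q) (binomial_pmf (n - 2) p)"
    let ?S = "{(i, j). - s < real i - real j}"
    have c2: "card {u, v} = 2" using uv by simp
    have law: "map_pmf (\<lambda>E. ?X E x) ?G = ?P" if "x = u \<or> x = v" for x
      using sbm_deg_law[of x "{u, v}" A0, unfolded c2 A0(2)] uv that A0(1) by auto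
    have nA: "u \<notin> A0" "v \<notin> A0" using uv A0 sides by auto
    have "map_pmf (\<lambda>E. (?X E u, ?X E v)) ?G = pair_pmf (map_pmf (\<lambda>E. ?X E u) ?G) (map_pmf (\<lambda>E. ?X E v) ?G)"
      unfolding sbm_def by (rule deg_into_indep[OF V uv(3)]) (use nA in auto)
    then have joint: "map_pmf (\<lambda>E. (?X E u, ?X E v)) ?G = pair_pmf ?P ?P"
      by (simp add: law)
    \<comment> \<open>Leaving out a minus neighbour can only raise a difference, so the joint event
      implies both reduced events, and these are independent.\<close>
    have "Pr {E. - s < T E u \<and> - s < T E v} \<le> Pr {E. ?X E u \<in> ?S \<and> ?X E v \<in> ?S}"
    proof (rule measure_pmf.finite_measure_mono)
      show "{E. - s < T E u \<and> - s < T E v} \<subseteq> {E. ?X E u \<in> ?S \<and> ?X E v \<in> ?S}"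
      proof
        fix E assume "E \<in> {E. - s < T E u \<and> - s < T E v}"
        then show "E \<in> {E. ?X E u \<in> ?S \<and> ?X E v \<in> ?S}"
          using deg_into_remove(1)[OF uv(1,3), of E] deg_into_remove(1)[of v u E] uv
          by (auto simp: T_def insert_commute)
      qed
    qed auto
    also have "\<dots> = measure_pmf.prob (map_pmf (\<lambda>E. (?X E u, ?X E v)) ?G) (?S \<times> ?S)"
      by (simp add: vimage_def)
    also have "\<dots> = measure_pmf.prob ?P ?S * measure_pmf.prob ?P ?S"
      unfolding joint by (rule measure_pmf_prob_product) auto
    finally show "Pr {E. - s < T E u \<and> - s < T E v} \<le> ?a0\<^sup>2"
      by (simp add: power2_eq_square)
  qed
  have \<rho>0: "0 \<le> \<rho>" by (simp add: \<rho>)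
  have two: "Pr {E. - s < T E u \<and> - s < T E v} \<le> (\<pi> + \<rho>)\<^sup>2"
    if uv: "u \<in> B" "v \<in> B" "u \<noteq> v" for u v
  proof -
    have "?a0\<^sup>2 \<le> (\<pi> + \<rho>)\<^sup>2" using pair[OF uv] by (intro power_mono) auto
    then show ?thesis using pair[OF uv] by linarith
  qed
  have Bne: "B \<noteq> {}" using cB n by auto
  have "Pr {E. real (card {v \<in> B. - s < real_of_int (adv E v)}) \<le> real n * \<pi> / 2} \<le>
     Pr {E. real (card {v \<in> B. - s < T E v}) \<le> real (card B) * \<pi> / 2}"
  proof (rule sbm_mono_AE)
    fix E assume E: "E \<in> set_pmf ?G" "real (card {v \<in> B. - s < real_of_int (adv E v)}) \<le> real n * \<pi> / 2"
    have "{v \<in> B. - s < T E v} \<subseteq> {v \<in> B. - s < real_of_int (adv E v)}"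
    proof
      fix v assume v: "v \<in> {v \<in> B. - s < T E v}"
      then show "v \<in> {v \<in> B. - s < real_of_int (adv E v)}"
        using nbr_sum_minus_ge[OF _ E(1) A0(1), of v] by (auto simp: T_def)
    qed
    then have "card {v \<in> B. - s < T E v} \<le> card {v \<in> B. - s < real_of_int (adv E v)}"
      using sides(4) by (intro card_mono) auto
    then show "real (card {v \<in> B. - s < T E v}) \<le> real (card B) * \<pi> / 2" unfolding cB using E(2) by linarith
  qed
  also have "\<dots> \<le> 4 / (real (card B) * \<pi>) + 4 * ((\<pi> + \<rho>)\<^sup>2 / \<pi>\<^sup>2 - 1)"
    by (rule prob_card_small[OF sides(4) Bne \<pi>0 _ one two]) auto
  also have "(\<pi> + \<rho>)\<^sup>2 / \<pi>\<^sup>2 = (1 + \<rho> / \<pi>)\<^sup>2"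
    using \<pi>0 by (simp add: power_divide[symmetric] add_divide_distrib)
  finally show ?thesis by (simp add: cB)
qed

end

section \<open>Moderate deviations\<close>

lemma bern_mgf_deriv:
  assumes "0 \<le> r" "r \<le> 1"
  shows "((\<lambda>x. ln (bern_mgf r x)) has_real_derivative tilted r x) (at x)"
    and "(tilted r has_real_derivative (tilted r x - (tilted r x)\<^sup>2)) (at x)"
    and "((\<lambda>x. tilted r x - (tilted r x)\<^sup>2) has_real_derivative (1 - 2 * tilted r x) * (tilted r x - (tilted r x)\<^sup>2)) (at x)"
proof -
  have pos: "0 < bern_mgf r x" for x using bern_mgf_pos[OF assms] .
  have d: "(bern_mgf r has_real_derivative r * exp x) (at x)" for x
    unfolding bern_mgf_def[abs_def] by (auto intro!: derivative_eq_intros)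
  show "((\<lambda>x. ln (bern_mgf r x)) has_real_derivative tilted r x) (at x)"
    using pos[of x] by (auto intro!: derivative_eq_intros d simp: tilted_def)
  show t: "(tilted r has_real_derivative (tilted r x - (tilted r x)\<^sup>2)) (at x)" 
  proof -
    have "((\<lambda>x. r * exp x / bern_mgf r x) has_real_derivative
        (r * exp x * bern_mgf r x - r * exp x * (r * exp x)) / (bern_mgf r x * bern_mgf r x)) (at x)"
      using pos[of x] by (auto intro!: derivative_eq_intros d)
    moreover have "(r * exp x * bern_mgf r x - r * exp x * (r * exp x)) / (bern_mgf r x * bern_mgf r x) =
        tilted r x - (tilted r x)\<^sup>2"
      using pos[of x] by (simp add: tilted_def power2_eq_square diff_divide_distrib)
    ultimately show ?thesis by (simp add: tilted_def[abs_def])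
  qed
  show "((\<lambda>x. tilted r x - (tilted r x)\<^sup>2) has_real_derivative (1 - 2 * tilted r x) * (tilted r x - (tilted r x)\<^sup>2)) (at x)"
    by (auto intro!: derivative_eq_intros t simp: algebra_simps power2_eq_square)
qed

lemma third_cumulant_bound:
  fixes t :: real
  assumes "0 \<le> t" "t \<le> 1"
  shows "\<bar>(1 - 2 * t) * (t - t\<^sup>2)\<bar> \<le> 1"
proof -
  have "0 \<le> t * (1 - t)" "t * (1 - t) \<le> 1" using assms by (auto intro: mult_le_one)
  then have "\<bar>t - t\<^sup>2\<bar> \<le> 1" by (simp add: power2_eq_square algebra_simps)
  moreover have "\<bar>1 - 2 * t\<bar> \<le> 1" using assms by (simp add: abs_le_iff)
  ultimately show ?thesis unfolding abs_mult by (intro mult_le_one) auto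
qed

text \<open>The third derivative is the third cumulant of the tilted Bernoulli law and is at most 1
  in absolute value, so the remainder is uniform in \<open>r\<close>.\<close>

lemma ln_bern_mgf_expansion:
  assumes r: "0 \<le> r" "r \<le> 1"
  shows "\<bar>ln (bern_mgf r x) - (r * x + r * (1 - r) * x\<^sup>2 / 2)\<bar> \<le> \<bar>x\<bar> ^ 3 / 6"
proof -
  define f where "f m = [\<lambda>x. ln (bern_mgf r x), tilted r, \<lambda>x. tilted r x - (tilted r x)\<^sup>2,
     \<lambda>x. (1 - 2 * tilted r x) * (tilted r x - (tilted r x)\<^sup>2)] ! m" for m :: nat
  have der: "\<forall>m t. m < 3 \<and> \<bar>t\<bar> \<le> \<bar>x\<bar> \<longrightarrow> (f m has_real_derivative f (Suc m) t) (at t)"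
  proof (intro allI impI)
    fix m :: nat and t assume m: "m < 3 \<and> \<bar>t\<bar> \<le> \<bar>x\<bar>"
    then have "m = 0 \<or> m = 1 \<or> m = 2" by auto
    then show "(f m has_real_derivative f (Suc m) t) (at t)"
      using bern_mgf_deriv[OF r, of t] by (auto simp: f_def)
  qed
  obtain t where t: "(\<lambda>x. ln (bern_mgf r x)) x = (\<Sum>m<3. f m 0 / fact m * x ^ m) + f 3 t / fact 3 * x ^ 3"
    using Maclaurin_bi_le[of f "\<lambda>x. ln (bern_mgf r x)" 3 x] der by (auto simp: f_def)
  have "f 0 0 = 0" "f 1 0 = r" "f 2 0 = r * (1 - r)"
    by (simp_all add: f_def bern_mgf_def tilted_def power2_eq_square algebra_simps)
  then have "ln (bern_mgf r x) - (r * x + r * (1 - r) * x\<^sup>2 / 2) = f 3 t / 6 * x ^ 3"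
    using t by (simp add: eval_nat_numeral)
  moreover have "\<bar>f 3 t\<bar> \<le> 1"
    using third_cumulant_bound tilted_bounds[OF r, of t] by (simp add: f_def)
  then have "\<bar>f 3 t / 6 * x ^ 3\<bar> \<le> \<bar>x\<bar> ^ 3 / 6"
    using mult_right_mono[of "\<bar>f 3 t\<bar>" 1 "\<bar>x\<bar> ^ 3"] by (simp add: abs_mult power_abs)
  ultimately show ?thesis by (simp only:)
qed

lemma ln_bern_mgf_bounds:
  assumes r: "0 \<le> r" "r \<le> 1" and x: "0 \<le> x"
  shows "\<bar>ln (bern_mgf r x) - (r * x + r * (1 - r) * x\<^sup>2 / 2)\<bar> \<le> x ^ 3 / 6"
    and "\<bar>ln (bern_mgf r (- x)) - (- (r * x) + r * (1 - r) * x\<^sup>2 / 2)\<bar> \<le> x ^ 3 / 6"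
proof -
  have "r * - x = - (r * x)" "(- x)\<^sup>2 = x\<^sup>2" "\<bar>- x\<bar> = x" "\<bar>x\<bar> = x" using x by simp_all
  then show "\<bar>ln (bern_mgf r x) - (r * x + r * (1 - r) * x\<^sup>2 / 2)\<bar> \<le> x ^ 3 / 6"
    and "\<bar>ln (bern_mgf r (- x)) - (- (r * x) + r * (1 - r) * x\<^sup>2 / 2)\<bar> \<le> x ^ 3 / 6"
    using ln_bern_mgf_expansion[OF r, of x] ln_bern_mgf_expansion[OF r, of "- x"] by (simp_all only:)
qed

lemma tilted_expansion:
  assumes r: "0 \<le> r" "r \<le> 1"
  shows "\<bar>tilted r x - (r + r * (1 - r) * x)\<bar> \<le> x\<^sup>2 / 2"
proof -
  define f where "f m = [tilted r, \<lambda>x. tilted r x - (tilted r x)\<^sup>2,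
     \<lambda>x. (1 - 2 * tilted r x) * (tilted r x - (tilted r x)\<^sup>2)] ! m" for m :: nat
  have der: "\<forall>m t. m < 2 \<and> \<bar>t\<bar> \<le> \<bar>x\<bar> \<longrightarrow> (f m has_real_derivative f (Suc m) t) (at t)"
  proof (intro allI impI)
    fix m :: nat and t assume m: "m < 2 \<and> \<bar>t\<bar> \<le> \<bar>x\<bar>"
    then have "m = 0 \<or> m = 1" by auto
    then show "(f m has_real_derivative f (Suc m) t) (at t)"
      using bern_mgf_deriv[OF r, of t] by (auto simp: f_def)
  qed
  obtain t where t: "tilted r x = (\<Sum>m<2. f m 0 / fact m * x ^ m) + f 2 t / fact 2 * x ^ 2"
    using Maclaurin_bi_le[of f "tilted r" 2 x] der by (auto simp: f_def)
  have "f 0 0 = r" "f 1 0 = r * (1 - r)"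
    by (simp_all add: f_def bern_mgf_def tilted_def power2_eq_square algebra_simps)
  then have "tilted r x - (r + r * (1 - r) * x) = f 2 t / 2 * x\<^sup>2"
    using t by (simp add: eval_nat_numeral)
  moreover have "\<bar>f 2 t\<bar> \<le> 1"
    using third_cumulant_bound tilted_bounds[OF r, of t] by (simp add: f_def)
  then have "\<bar>f 2 t / 2 * x\<^sup>2\<bar> \<le> x\<^sup>2 / 2"
    using mult_right_mono[of "\<bar>f 2 t\<bar>" 1 "x\<^sup>2"] by (simp add: abs_mult)
  ultimately show ?thesis by (simp only:)
qed

text \<open>The displacement whose product with the tilt is a multiple of ln (ln n); moving by a
  multiple of it changes tails by a power of ln n.\<close>

definition window :: "nat \<Rightarrow> real" where
  "window n = sqrt (real n * (ln (ln (real n)))\<^sup>2 / ln (real n))"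

text \<open>The tilt \<open>\<kappa> / \<sigma> * sqrt (ln n / n)\<close> centres the difference of the binomials when the number of
  plus vertices is \<open>\<kappa> * \<sigma> / q * sqrt (n * ln n)\<close> below \<open>p / q * n\<close>.\<close>

definition tilt :: "real \<Rightarrow> nat \<Rightarrow> real" where
  "tilt k n = k * sqrt (ln (real n) / real n)"

lemma tilt_algebra:
  assumes "1 \<le> ln (real n)"
  shows "tilt k n * sqrt (real n * ln (real n)) = k * ln (real n)"
    and "(tilt k n)\<^sup>2 * real n = k\<^sup>2 * ln (real n)"
    and "tilt k n * real n = k * sqrt (real n * ln (real n))"
    and "tilt k n * window n = k * ln (ln (real n))"
    and "tilt k n * sqrt (real n) = k * sqrt (ln (real n))"
proof -
  have n: "0 < real n" using assms by (cases n) auto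
  have l: "0 < ln (real n)" "0 \<le> ln (ln (real n))" using assms by auto
  have "sqrt (ln (real n) / real n) * sqrt (real n * ln (real n)) = ln (real n)"
    using n l by (simp add: real_sqrt_mult[symmetric])
  then show "tilt k n * sqrt (real n * ln (real n)) = k * ln (real n)" by (simp add: tilt_def)
  show "(tilt k n)\<^sup>2 * real n = k\<^sup>2 * ln (real n)"
    using n l by (simp add: tilt_def power_mult_distrib)
  have "sqrt (ln (real n) / real n) * real n = sqrt (real n * ln (real n))"
    using n l by (simp add: real_sqrt_divide real_sqrt_mult field_simps)
  then show "tilt k n * real n = k * sqrt (real n * ln (real n))" by (simp add: tilt_def mult.assoc)
  have "sqrt (ln (real n) / real n) * window n = ln (ln (real n))"
    unfolding window_def using n l by (simp add: real_sqrt_mult[symmetric])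
  then show "tilt k n * window n = k * ln (ln (real n))" by (simp add: tilt_def mult.assoc)
  show "tilt k n * sqrt (real n) = k * sqrt (ln (real n))"
    using n l by (simp add: tilt_def real_sqrt_divide)
qed

lemma exp_ln_bern_mgf:
  assumes "0 \<le> q" "q \<le> 1" "0 \<le> p" "p \<le> 1"
  shows "bern_mgf q x ^ a * bern_mgf p y ^ b = exp (real a * ln (bern_mgf q x) + real b * ln (bern_mgf p y))"
  using bern_mgf_pos[of q x] bern_mgf_pos[of p y] assms
  by (simp add: exp_add exp_of_nat_mult)

lemma half_le_one_minus_exp:
  fixes x :: real
  assumes "0 \<le> x" "x \<le> 1"
  shows "x / 2 \<le> 1 - exp (- x)"
proof -
  have "exp (- x) \<le> 1 / (1 + x)"
    using exp_ge_add_one_self[of x] assms by (simp add: exp_minus field_simps)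
  moreover have "x / 2 \<le> 1 - 1 / (1 + x)"
    using assms mult_left_mono[of x 1 x] by (simp add: field_simps)
  ultimately show ?thesis by linarith
qed

section \<open>Tails of the binomial difference near the threshold\<close>

locale rates =
  fixes p q \<sigma> :: real
  assumes pq: "0 < q" "q < p" "p \<le> 1" and \<sigma>_def: "\<sigma> = sqrt (p * (2 - p - q))"
begin

lemma \<sigma>: "0 < \<sigma>" "\<sigma>\<^sup>2 = p * (1 - q) + p * (1 - p)"
proof -
  have "0 < p * (2 - p - q)" using pq by simp
  then show "0 < \<sigma>" "\<sigma>\<^sup>2 = p * (1 - q) + p * (1 - p)" by (auto simp: \<sigma>_def algebra_simps)
qed

text \<open>Here \<open>\<alpha>\<close> is the real size aimed at and \<open>a\<close> an integer
  above it. Mean, variance and cubic error are kept apart so that \<open>tilt_algebra\<close> can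
  evaluate each.\<close>

lemma exponent_lower:
  assumes x: "0 \<le> x" and a: "\<alpha> \<le> a" and b: "b = N - 1" "0 \<le> b" and a0: "0 \<le> a"
  shows "x * (\<alpha> * q - N * p) + x\<^sup>2 / 2 * (\<alpha> * q * (1 - q) + (N - 1) * p * (1 - p)) - x ^ 3 / 6 * (a + N)
    \<le> a * ln (bern_mgf q x) + b * ln (bern_mgf p (- x))"
proof -
  define y where "y = x ^ 3 / 6"
  define z where "z = x\<^sup>2 / 2"
  have y: "0 \<le> y" "0 \<le> z" using x by (auto simp: y_def z_def)
  have px: "0 \<le> p * x" using pq x by auto
  have "x * (\<alpha> * q) + \<alpha> * q * (1 - q) * z - a * y = \<alpha> * (q * x + q * (1 - q) * z) - a * y"
    by (simp add: algebra_simps)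
  also have "\<dots> \<le> a * (q * x + q * (1 - q) * z) - a * y"
    using a x pq y by (intro diff_right_mono mult_right_mono add_nonneg_nonneg) auto
  also have "\<dots> = a * (q * x + q * (1 - q) * z - y)" by (simp add: algebra_simps)
  also have "\<dots> \<le> a * ln (bern_mgf q x)"
    using ln_bern_mgf_bounds(1)[of q x] pq x a0 unfolding y_def z_def by (intro mult_left_mono) linarith+
  finally have 1: "x * (\<alpha> * q) + \<alpha> * q * (1 - q) * z - a * y \<le> a * ln (bern_mgf q x)" .
  have "- (x * (N * p)) + (N - 1) * p * (1 - p) * z - N * y \<le>
      - (x * (N * p)) + (N - 1) * p * (1 - p) * z - N * y + (p * x + y)"
    using px y by simp
  also have "\<dots> = b * (- (p * x) + p * (1 - p) * z - y)" unfolding b(1) by (simp add: algebra_simps)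
  also have "\<dots> \<le> b * ln (bern_mgf p (- x))"
    using ln_bern_mgf_bounds(2)[of p x] pq x b(2) unfolding y_def z_def by (intro mult_left_mono) linarith+
  finally have 2: "- (x * (N * p)) + (N - 1) * p * (1 - p) * z - N * y \<le> b * ln (bern_mgf p (- x))" .
  have "x * (\<alpha> * q - N * p) + z * (\<alpha> * q * (1 - q) + (N - 1) * p * (1 - p)) - y * (a + N) =
     (x * (\<alpha> * q) + \<alpha> * q * (1 - q) * z - a * y) + (- (x * (N * p)) + (N - 1) * p * (1 - p) * z - N * y)"
    by (simp add: algebra_simps)
  then show ?thesis using add_mono[OF 1 2] by (simp only: y_def z_def)
qed

text \<open>The bound \<open>\<alpha> \<le> p / q * N\<close> turns the variance term into
  \<open>\<sigma>\<^sup>2 * N\<close>; the vertex missing in \<open>b = N - 1\<close> costs at most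
  \<open>x\<close>.\<close>

lemma exponent_upper:
  assumes x: "0 \<le> x" and a: "a \<le> \<alpha>" "0 \<le> a" "\<alpha> \<le> p / q * N" and b: "b = N - 1" "0 \<le> b"
  shows "a * ln (bern_mgf q x) + b * ln (bern_mgf p (- x)) \<le>
    x * (\<alpha> * q - N * p) + x\<^sup>2 / 2 * (\<sigma>\<^sup>2 * N) + x + x ^ 3 / 6 * ((p / q + 1) * N)"
proof -
  have x3: "0 \<le> x ^ 3" using x by simp
  have N: "0 \<le> N" using b by simp
  have "ln (bern_mgf q x) \<le> q * x + q * (1 - q) * x\<^sup>2 / 2 + x ^ 3 / 6"
    using ln_bern_mgf_bounds(1)[of q x] pq x by linarith
  then have 1: "a * ln (bern_mgf q x) \<le> a * (q * x + q * (1 - q) * x\<^sup>2 / 2 + x ^ 3 / 6)"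
    using a by (intro mult_left_mono)
  have "ln (bern_mgf p (- x)) \<le> - p * x + p * (1 - p) * x\<^sup>2 / 2 + x ^ 3 / 6"
    using ln_bern_mgf_bounds(2)[of p x] pq x by linarith
  then have 2: "b * ln (bern_mgf p (- x)) \<le> b * (- p * x + p * (1 - p) * x\<^sup>2 / 2 + x ^ 3 / 6)"
    using b(2) by (rule mult_left_mono)
  have 3: "a * (q * x + q * (1 - q) * x\<^sup>2 / 2 + x ^ 3 / 6) \<le> \<alpha> * (q * x) + \<alpha> * (q * (1 - q) * x\<^sup>2 / 2) + \<alpha> * (x ^ 3 / 6)"
    unfolding distrib_left using a x pq by (intro add_mono mult_right_mono) auto
  have 4: "\<alpha> * (q * (1 - q) * x\<^sup>2 / 2) \<le> p / q * N * (q * (1 - q) * x\<^sup>2 / 2)"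
    using a pq by (intro mult_right_mono) auto
  have 5: "\<alpha> * (x ^ 3 / 6) \<le> p / q * N * (x ^ 3 / 6)" using a x3 by (intro mult_right_mono) auto
  have 6: "p / q * N * (q * (1 - q) * x\<^sup>2 / 2) = p * (1 - q) * N * x\<^sup>2 / 2" using pq by simp
  have 7: "p * x \<le> x" using mult_right_mono[of p 1 x] pq x by simp
  have 8: "b * (- p * x + p * (1 - p) * x\<^sup>2 / 2 + x ^ 3 / 6) = - N * p * x + p * x + N * (p * (1 - p) * x\<^sup>2 / 2) + N * (x ^ 3 / 6)
     - (p * (1 - p) * x\<^sup>2 / 2 + x ^ 3 / 6)"
    unfolding b(1) by (simp add: algebra_simps add_divide_distrib diff_divide_distrib)
  have 9: "0 \<le> p * (1 - p) * x\<^sup>2 / 2 + x ^ 3 / 6" using pq x3 by simp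
  have "a * ln (bern_mgf q x) + b * ln (bern_mgf p (- x)) \<le>
     \<alpha> * (q * x) + p * (1 - q) * N * x\<^sup>2 / 2 + p / q * N * (x ^ 3 / 6) + (- N * p * x + x + N * (p * (1 - p) * x\<^sup>2 / 2) + N * (x ^ 3 / 6))"
    using 1 2 3 4 5 6 7 8 9 by linarith
  also have "\<dots> = x * (\<alpha> * q - N * p) + x\<^sup>2 / 2 * (\<sigma>\<^sup>2 * N) + x + x ^ 3 / 6 * ((p / q + 1) * N)"
    unfolding \<sigma>(2) by (simp add: algebra_simps add_divide_distrib diff_divide_distrib)
  finally show ?thesis .
qed

text \<open>With the tilt 1 / \<sigma> the mean contributes - ln n and the variance + ln n / 2 to
  the exponent, and the window adds the ln (ln n) term. The local bound divided by 1 - exp(- x) is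
  of order 1 / (x sqrt n), hence the final 1 / sqrt(ln n).\<close>

lemma tail_upper:
  assumes \<epsilon>: "0 < \<epsilon>"
  shows "\<exists>C>0. \<forall>\<^sub>F n in sequentially. \<forall>a s. n \<le> a \<longrightarrow>
     real a \<le> p / q * real n - \<sigma> / q * sqrt (real n * ln (real n)) - \<epsilon> * window n \<longrightarrow>
     binom_pair_prob a q (n - 1) p {(i, j). - s \<le> real i - real j}
     \<le> C * exp (- (ln (real n) / 2) - q * \<epsilon> / \<sigma> * ln (ln (real n)) + tilt (1 / \<sigma>) n * s) / sqrt (ln (real n))"
proof -
  define k where "k = 1 / \<sigma>"
  \<comment> \<open>Half the distance of \<open>q\<close> from 0 and 1: a small tilt keeps
    \<open>tilted q x\<close> at least \<open>\<rho>\<close> away from both.\<close>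
  define \<rho> where "\<rho> = min q (1 - q) / 2"
  have k: "0 < k" "k * \<sigma> = 1" using \<sigma> by (auto simp: k_def)
  have \<rho>: "0 < \<rho>" "2 * \<rho> \<le> q" "2 * \<rho> \<le> 1 - q" using pq by (auto simp: \<rho>_def)
  obtain C0 where C0: "0 < C0" "\<And>a r k. \<rho> \<le> r \<Longrightarrow> r \<le> 1 - \<rho> \<Longrightarrow> 0 < a \<Longrightarrow> pmf (binomial_pmf a r) k \<le> C0 / sqrt (real a)"
    using binomial_local_upper[OF \<rho>(1)] by blast
  define C where "C = 2 * C0 * exp 1 / k"
  have k': "0 < p / q + 1" using pq by (simp add: add_pos_pos)
  have ev1: "\<forall>\<^sub>F n in sequentially. 1 \<le> ln (real n)" by real_asymp
  have ev2: "\<forall>\<^sub>F n in sequentially. tilt k n \<le> min (1/4) (\<rho> / 2)"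
    unfolding tilt_def using k \<rho> by real_asymp
  have ev3: "\<forall>\<^sub>F n in sequentially. tilt k n + (tilt k n) ^ 3 / 6 * ((p / q + 1) * real n) \<le> 1"
    using k(1) k' unfolding tilt_def by real_asymp
  have "\<forall>\<^sub>F n in sequentially. \<forall>a s. n \<le> a \<longrightarrow>
     real a \<le> p / q * real n - \<sigma> / q * sqrt (real n * ln (real n)) - \<epsilon> * window n \<longrightarrow>
     binom_pair_prob a q (n - 1) p {(i, j). - s \<le> real i - real j}
     \<le> C * exp (- (ln (real n) / 2) - q * \<epsilon> / \<sigma> * ln (ln (real n)) + tilt k n * s) / sqrt (ln (real n))"
    using ev1 ev2 ev3
  proof eventually_elim
    case (elim n)
    define x where "x = tilt k n"
    have n1: "1 < n" using elim(1) by (cases "n \<le> 1") (auto simp: le_Suc_eq)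
    have x0: "0 < x" using k elim(1) n1 by (simp add: x_def tilt_def)
    have x1: "x \<le> 1/4" "x \<le> \<rho> / 2" using elim(2) by (auto simp: x_def)
    note T = tilt_algebra[OF elim(1), of k, folded x_def]
    show ?case
    proof (intro allI impI)
      fix a s
      assume a: "n \<le> a" and le: "real a \<le> p / q * real n - \<sigma> / q * sqrt (real n * ln (real n)) - \<epsilon> * window n"
      define \<alpha> where "\<alpha> = p / q * real n - \<sigma> / q * sqrt (real n * ln (real n)) - \<epsilon> * window n"
      have "\<bar>tilted q x - (q + q * (1 - q) * x)\<bar> \<le> x\<^sup>2 / 2" using pq by (intro tilted_expansion) auto
      moreover have "0 \<le> q * (1 - q) * x" "q * (1 - q) * x \<le> x" using pq x0 by (auto simp: mult_left_le_one_le mult_le_one)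
      moreover have "x\<^sup>2 \<le> x" using x0 x1 by (simp add: power2_eq_square mult_left_le)
      ultimately have t: "\<rho> \<le> tilted q x" "tilted q x \<le> 1 - \<rho>" using x1 \<rho> by linarith+
      have K: "pmf (binomial_pmf a (tilted q x)) i \<le> C0 / sqrt (real n)" for i
      proof -
        have "pmf (binomial_pmf a (tilted q x)) i \<le> C0 / sqrt (real a)" using t a n1 by (intro C0) auto
        also have "\<dots> \<le> C0 / sqrt (real n)" using a n1 C0(1) by (intro divide_left_mono) auto
        finally show ?thesis .
      qed
      have ub: "\<alpha> \<le> p / q * real n" 
      proof -
        have "0 \<le> \<sigma> / q * sqrt (real n * ln (real n))" "0 \<le> \<epsilon> * window n"
          using \<epsilon> \<sigma>(1) pq elim(1) by (simp_all add: window_def)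
        then show ?thesis unfolding \<alpha>_def by linarith
      qed
      have "real a * ln (bern_mgf q x) + real (n - 1) * ln (bern_mgf p (- x)) \<le>
        x * (\<alpha> * q - real n * p) + x\<^sup>2 / 2 * (\<sigma>\<^sup>2 * real n) + x + x ^ 3 / 6 * ((p / q + 1) * real n)"
        using x0 le ub n1 by (intro exponent_upper) (auto simp: \<alpha>_def of_nat_diff)
      also have "\<dots> \<le> x * (\<alpha> * q - real n * p) + x\<^sup>2 / 2 * (\<sigma>\<^sup>2 * real n) + 1"
        using elim(3) by (simp add: x_def)
      also have "x * (\<alpha> * q - real n * p) = - \<sigma> * (x * sqrt (real n * ln (real n))) - q * \<epsilon> * (x * window n)"
        using pq by (simp add: \<alpha>_def field_simps)
      also have "\<dots> = - ln (real n) - q * \<epsilon> / \<sigma> * ln (ln (real n))"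
        unfolding T using k by (simp add: k_def)
      also have "x\<^sup>2 / 2 * (\<sigma>\<^sup>2 * real n) = \<sigma>\<^sup>2 / 2 * (x\<^sup>2 * real n)" by simp
      also have "\<dots> = ln (real n) / 2"
        unfolding T using \<sigma>(1) by (simp add: k_def power_divide)
      finally have ex: "real a * ln (bern_mgf q x) + real (n - 1) * ln (bern_mgf p (- x)) \<le>
         (- (ln (real n) / 2) - q * \<epsilon> / \<sigma> * ln (ln (real n))) + 1" by simp
      have e1: "x / 2 \<le> 1 - exp (- x)" using x0 x1 by (intro half_le_one_minus_exp) auto
      have "binom_pair_prob a q (n - 1) p {(i, j). - s \<le> real i - real j} \<le>
         bern_mgf q x ^ a * bern_mgf p (- x) ^ (n - 1) * (C0 / sqrt (real n)) * exp (x * s) / (1 - exp (- x))"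
        using pq x0 by (intro binomial_diff_tail_upper K) auto
      also have "bern_mgf q x ^ a * bern_mgf p (- x) ^ (n - 1) = exp (real a * ln (bern_mgf q x) + real (n - 1) * ln (bern_mgf p (- x)))"
        using pq by (intro exp_ln_bern_mgf) auto
      also have "\<dots> * (C0 / sqrt (real n)) * exp (x * s) / (1 - exp (- x)) \<le>
         exp ((- (ln (real n) / 2) - q * \<epsilon> / \<sigma> * ln (ln (real n))) + 1) * (C0 / sqrt (real n)) * exp (x * s) / (x / 2)"
        using ex e1 x0 C0(1) by (intro frac_le mult_right_mono mult_nonneg_nonneg) auto
      also have "\<dots> = 2 * C0 * exp 1 * exp (- (ln (real n) / 2) - q * \<epsilon> / \<sigma> * ln (ln (real n)) + x * s) / (x * sqrt (real n))"
        by (simp add: exp_add mult_ac)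
      also have "\<dots> = C * exp (- (ln (real n) / 2) - q * \<epsilon> / \<sigma> * ln (ln (real n)) + tilt k n * s) / sqrt (ln (real n))"
        unfolding T by (simp add: C_def x_def)
      finally show "binom_pair_prob a q (n - 1) p {(i, j). - s \<le> real i - real j} \<le>
         C * exp (- (ln (real n) / 2) - q * \<epsilon> / \<sigma> * ln (ln (real n)) + tilt k n * s) / sqrt (ln (real n))" .
    qed
  qed
  moreover have "0 < C" using C0(1) k by (simp add: C_def)
  ultimately show ?thesis unfolding k_def by blast
qed

text \<open>The factor \<open>\<kappa>\<close> scales the distance below p n / q: 1 is the critical
  value, used for the third day, and smaller values serve the second day.\<close>

definition threshold :: "real \<Rightarrow> real \<Rightarrow> nat \<Rightarrow> real" where
  "threshold \<kappa> \<epsilon> n = p / q * real n - \<kappa> * \<sigma> / q * sqrt (real n * ln (real n)) + \<epsilon> * window n"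

lemma threshold_mult: "threshold \<kappa> \<epsilon> n * q = p * real n - \<kappa> * \<sigma> * sqrt (real n * ln (real n)) + q * \<epsilon> * window n"
  using pq by (simp add: threshold_def field_simps)

text \<open>The spare \<open>+ 1\<close> leaves room for rounding up to an integer.\<close>

lemma threshold_bounds:
  assumes \<kappa>: "0 < \<kappa>" and \<epsilon>: "0 \<le> \<epsilon>"
  shows "\<forall>\<^sub>F n in sequentially. real n \<le> threshold \<kappa> \<epsilon> n \<and> threshold \<kappa> \<epsilon> n + 1 \<le> p / q * real n"
proof -
  define r where "r = p / q - 1"
  define h where "h = \<kappa> * \<sigma> / q"
  have r: "0 < r" using pq by (simp add: r_def)
  have h: "0 < h" using \<kappa> \<sigma> pq by (simp add: h_def)
  have 1: "\<forall>\<^sub>F n in sequentially. h * sqrt (real n * ln (real n)) \<le> r * real n" using r h by real_asymp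
  have 2: "\<forall>\<^sub>F n in sequentially. \<epsilon> * window n + 1 \<le> h * sqrt (real n * ln (real n))"
    unfolding window_def using h \<epsilon> by (cases "\<epsilon> = 0"; simp) real_asymp+
  have 3: "\<forall>\<^sub>F n in sequentially. 0 \<le> window n" unfolding window_def by real_asymp
  show ?thesis using 1 2 3
  proof eventually_elim
    case (elim n)
    have "threshold \<kappa> \<epsilon> n = real n + r * real n - h * sqrt (real n * ln (real n)) + \<epsilon> * window n"
      by (simp add: threshold_def r_def h_def algebra_simps)
    moreover have "p / q * real n = real n + r * real n" by (simp add: r_def algebra_simps)
    moreover have "0 \<le> \<epsilon> * window n" using \<epsilon> elim(3) by simp
    ultimately show ?case using elim(1,2) by linarith
  qed
qed

text \<open>The equation \<open>bal\<close> makes the shift of the two means under the tilt cancel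
  the deficit \<open>Y\<close>. Only lower order terms remain, which will be at most sqrt n.\<close>

lemma mean_balance:
  assumes x: "0 \<le> x" "x \<le> 1" and N: "1 \<le> N" and a: "\<alpha> \<le> a" "a \<le> \<alpha> + 1" "0 \<le> a" "a \<le> p / q * N"
    and \<alpha>: "\<alpha> * q = p * N - Y + Z" "0 \<le> Y" "0 \<le> Z" and bal: "x * (\<sigma>\<^sup>2 * N) = Y"
  shows "\<bar>a * tilted q x - (N - 1) * tilted p (- x)\<bar> \<le> 2 * Z + 4 + x * Y + (p / q + 1) * (x\<^sup>2 * N) / 2"
proof -
  define e1 where "e1 = tilted q x - (q + q * (1 - q) * x)"
  define e2 where "e2 = tilted p (- x) - (p - p * (1 - p) * x)"
  define \<theta> where "\<theta> = a - \<alpha>"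
  have \<theta>: "0 \<le> \<theta>" "\<theta> \<le> 1" using a by (auto simp: \<theta>_def)
  have e1: "\<bar>e1\<bar> \<le> x\<^sup>2 / 2" using tilted_expansion[of q x] pq by (simp add: e1_def)
  have e2: "\<bar>e2\<bar> \<le> x\<^sup>2 / 2" using tilted_expansion[of p "- x"] pq by (simp add: e2_def)
  have ae: "\<bar>a * e1\<bar> \<le> p / q * N * (x\<^sup>2 / 2)"
    unfolding abs_mult using e1 a by (intro mult_mono) auto
  have be: "\<bar>(N - 1) * e2\<bar> \<le> N * (x\<^sup>2 / 2)"
    unfolding abs_mult using e2 N by (intro mult_mono) auto
  have aq: "a * q = p * N - Y + Z + \<theta> * q" unfolding \<alpha>(1)[symmetric] by (simp add: \<theta>_def algebra_simps)
  have "a * tilted q x - (N - 1) * tilted p (- x) =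
      a * q + x * (1 - q) * (a * q) + a * e1 - (N - 1) * p + x * (N - 1) * p * (1 - p) - (N - 1) * e2"
    by (simp add: e1_def e2_def algebra_simps)
  also have "\<dots> = - Y + x * (\<sigma>\<^sup>2 * N) + Z + \<theta> * q + p + x * (1 - q) * (Z - Y + \<theta> * q) - x * p * (1 - p) + a * e1 - (N - 1) * e2"
    unfolding aq \<sigma>(2) by (simp add: algebra_simps)
  finally have eq: "a * tilted q x - (N - 1) * tilted p (- x) =
      Z + \<theta> * q + p + x * (1 - q) * (Z - Y + \<theta> * q) - x * p * (1 - p) + a * e1 - (N - 1) * e2"
    using bal by simp
  have 1: "0 \<le> \<theta> * q" "\<theta> * q \<le> 1" using \<theta> pq by (auto intro: mult_le_one)
  have x1: "0 \<le> x * (1 - q)" "x * (1 - q) \<le> x" "x * (1 - q) \<le> 1" using x pq by (auto intro: mult_le_one mult_left_le)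
  have 2: "0 \<le> x * (1 - q) * Z" "x * (1 - q) * Z \<le> Z" using x1 \<alpha> by (auto simp: mult_left_le_one_le)
  have 3: "0 \<le> x * (1 - q) * Y" "x * (1 - q) * Y \<le> x * Y" using x1 \<alpha> by (auto intro: mult_right_mono mult_nonneg_nonneg)
  have 4: "0 \<le> x * (1 - q) * (\<theta> * q)" "x * (1 - q) * (\<theta> * q) \<le> 1" using x1 1 by (auto intro: mult_le_one mult_nonneg_nonneg)
  have 5: "0 \<le> x * p * (1 - p)" "x * p * (1 - p) \<le> 1" using x pq by (auto intro!: mult_le_one mult_nonneg_nonneg)
  have "x * (1 - q) * (Z - Y + \<theta> * q) = x * (1 - q) * Z - x * (1 - q) * Y + x * (1 - q) * (\<theta> * q)"
    by (simp add: algebra_simps)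
  moreover have "(p / q + 1) * (x\<^sup>2 * N) / 2 = p / q * N * (x\<^sup>2 / 2) + N * (x\<^sup>2 / 2)" by (simp add: algebra_simps)
  ultimately show ?thesis using eq ae be 1 2 3 4 5 pq \<alpha> by linarith
qed

text \<open>Uniformity in \<open>a\<close> absorbs the rounding, and uniformity in \<open>s\<close>
  allows levels depending on n. The second inequality, a point against a tail, is the decorrelation
  error required by \<open>static_many\<close>.\<close>

definition lower_tail_bounds :: "real \<Rightarrow> real \<Rightarrow> real \<Rightarrow> real \<Rightarrow> nat \<Rightarrow> bool" where
  "lower_tail_bounds \<kappa> \<epsilon> c D n \<longleftrightarrow>
     (\<forall>a s. threshold \<kappa> \<epsilon> n \<le> real a \<longrightarrow> real a \<le> threshold \<kappa> \<epsilon> n + 1 \<longrightarrow> \<bar>s\<bar> \<le> sqrt (real n) \<longrightarrow>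
        c * exp (- (\<kappa>\<^sup>2 / 2 * ln (real n)) + \<kappa> * q * \<epsilon> / \<sigma> * ln (ln (real n)) + tilt (\<kappa> / \<sigma>) n * s) / sqrt (ln (real n))
          \<le> diff_tail a q (n - 1) p s \<and>
        diff_point a q (n - 2) p (\<lfloor>- s\<rfloor> + 1) \<le> D * tilt (\<kappa> / \<sigma>) n * diff_tail a q (n - 1) p s)"

text \<open>Upper bound for the point and lower bound for the tail share the same exponential
  factors. These cancel in the ratio and leave a constant times the tilt.\<close>

lemma tail_lower:
  assumes \<kappa>: "0 < \<kappa>" "\<kappa> \<le> 1" and \<epsilon>: "0 \<le> \<epsilon>"
  shows "\<exists>c>0. \<exists>D>0. \<forall>\<^sub>F n in sequentially. lower_tail_bounds \<kappa> \<epsilon> c D n"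
proof -
  define k where "k = \<kappa> / \<sigma>"
  define \<rho> where "\<rho> = min q (1 - q) / 2"
  have k: "0 < k" "k * \<sigma> = \<kappa>" using \<sigma> \<kappa> by (auto simp: k_def)
  have \<rho>: "0 < \<rho>" "2 * \<rho> \<le> q" "2 * \<rho> \<le> 1 - q" using pq by (auto simp: \<rho>_def)
  obtain C0 where C0: "0 < C0" "\<And>a r k. \<rho> \<le> r \<Longrightarrow> r \<le> 1 - \<rho> \<Longrightarrow> 0 < a \<Longrightarrow> pmf (binomial_pmf a r) k \<le> C0 / sqrt (real a)"
    using binomial_local_upper[OF \<rho>(1)] by blast
  obtain c0 where c0: "0 < c0" "\<And>q p x a b s. 0 \<le> q \<Longrightarrow> q \<le> 1 \<Longrightarrow> 0 \<le> p \<Longrightarrow> p \<le> 1 \<Longrightarrow> 0 < x \<Longrightarrow> x \<le> 1 / 4 \<Longrightarrow> 0 < b \<Longrightarrow>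
      \<rho> \<le> tilted q x \<Longrightarrow> tilted q x \<le> 1 - \<rho> \<Longrightarrow> 8 * 4 / (\<rho> * (1 - \<rho>)) \<le> sqrt (real a) \<Longrightarrow>
      sqrt (real b) + \<bar>real a * tilted q x - real b * tilted p (- x)\<bar> + \<bar>s\<bar> + 1 / x \<le> 4 * sqrt (real a) \<Longrightarrow>
      c0 / (x * sqrt (real a)) * bern_mgf q x ^ a * bern_mgf p (- x) ^ b * exp (x * s)
      \<le> diff_tail a q b p s"
    \<comment> \<open>Window width 4, since each of the four terms in the window condition will be
      at most sqrt a.\<close>
    using binomial_diff_tail_lower[OF \<rho>(1), of 4] by auto
  define r where "r = p / q"
  have r: "1 < r" using pq by (simp add: r_def)
  \<comment> \<open>The factor exp(- 1) pays for the lower order terms of the exponent,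
    \<open>k\<close> comes from x sqrt n = k sqrt(ln n), and \<open>sqrt r\<close> from a at most r
    n.\<close>
  define c where "c = c0 * exp (- 1) / (k * sqrt r)"
  define D where "D = 3 * C0 / c0"
  define Q where "Q = 32 / (\<rho> * (1 - \<rho>))"
  have ev1: "\<forall>\<^sub>F n in sequentially. 1 \<le> ln (real n)" by real_asymp
  have ev2: "\<forall>\<^sub>F n in sequentially. tilt k n \<le> min (1/4) (\<rho> / 2)"
    unfolding tilt_def using k \<rho> by real_asymp
  have ev3: "\<forall>\<^sub>F n in sequentially. (tilt k n)\<^sup>2 / 2 * (\<kappa> * \<sigma> * sqrt (real n * ln (real n)) + 1) + (tilt k n) ^ 3 / 6 * ((r + 1) * real n) \<le> 1"
    using k(1) r \<kappa>(1) \<sigma>(1) unfolding tilt_def by real_asymp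
  have ev4: "\<forall>\<^sub>F n in sequentially. Q \<le> sqrt (real n)" by real_asymp
  have ev5: "\<forall>\<^sub>F n in sequentially. 2 * (q * \<epsilon> * window n) + 4 + \<kappa>\<^sup>2 * ln (real n) + (r + 1) * (k\<^sup>2 * ln (real n)) / 2 \<le> sqrt (real n)"
    using k(1) r \<epsilon> \<kappa>(1) \<sigma>(1) pq unfolding window_def by (cases "\<epsilon> = 0"; simp) real_asymp+
  have ev6: "\<forall>\<^sub>F n in sequentially. 1 / tilt k n \<le> sqrt (real n)"
    using k(1) unfolding tilt_def by real_asymp
  have "\<forall>\<^sub>F n in sequentially. lower_tail_bounds \<kappa> \<epsilon> c D n"
    using ev1 ev2 ev3 ev4 ev5 ev6 threshold_bounds[OF \<kappa>(1) \<epsilon>]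
  proof eventually_elim
    case (elim n)
    define x where "x = tilt k n"
    define X where "X = sqrt (real n * ln (real n))"
    have n1: "1 < n" using elim(1) by (cases "n \<le> 1") (auto simp: le_Suc_eq)
    have x0: "0 < x" using k elim(1) n1 by (simp add: x_def tilt_def)
    have x1: "x \<le> 1/4" "x \<le> \<rho> / 2" using elim(2) by (auto simp: x_def)
    note T = tilt_algebra[OF elim(1), of k, folded x_def X_def]
    have X0: "0 \<le> X" using elim(1) by (simp add: X_def)
    have w0: "0 \<le> window n" using elim(1) by (simp add: window_def)
    have "\<bar>tilted q x - (q + q * (1 - q) * x)\<bar> \<le> x\<^sup>2 / 2" using pq by (intro tilted_expansion) auto
    moreover have "0 \<le> q * (1 - q) * x" "q * (1 - q) * x \<le> x" using pq x0 by (auto simp: mult_left_le_one_le mult_le_one)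
    moreover have "x\<^sup>2 \<le> x" using x0 x1 by (simp add: power2_eq_square mult_left_le)
    ultimately have t: "\<rho> \<le> tilted q x" "tilted q x \<le> 1 - \<rho>" using x1 \<rho> by linarith+
    show ?case
      unfolding lower_tail_bounds_def k_def[symmetric]
    proof (intro allI impI)
      fix a s
      assume a: "threshold \<kappa> \<epsilon> n \<le> real a" "real a \<le> threshold \<kappa> \<epsilon> n + 1" and s: "\<bar>s\<bar> \<le> sqrt (real n)"
      define \<pi> where "\<pi> = diff_tail a q (n - 1) p s"
      define \<Phi> where "\<Phi> = bern_mgf q x ^ a * bern_mgf p (- x) ^ (n - 1)"
      have an: "real n \<le> real a" "real a \<le> r * real n" using a elim(7) by (auto simp: r_def)
      have sn: "sqrt (real n) \<le> sqrt (real a)" using an by simp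
      have bal: "x * (\<sigma>\<^sup>2 * real n) = \<kappa> * \<sigma> * X"
      proof -
        have "x * (\<sigma>\<^sup>2 * real n) = \<sigma>\<^sup>2 * (x * real n)" by simp
        also have "\<dots> = (k * \<sigma>) * \<sigma> * X" unfolding T by (simp add: power2_eq_square)
        finally show ?thesis using k by simp
      qed
      have xX: "x * (\<kappa> * \<sigma> * X) = \<kappa>\<^sup>2 * ln (real n)"
      proof -
        have "x * (\<kappa> * \<sigma> * X) = \<kappa> * \<sigma> * (x * X)" by simp
        also have "\<dots> = \<kappa> * (k * \<sigma>) * ln (real n)" unfolding T by simp
        finally show ?thesis using k by (simp add: power2_eq_square)
      qed
      have th: "threshold \<kappa> \<epsilon> n * q = p * real n - \<kappa> * \<sigma> * X + q * \<epsilon> * window n"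
        unfolding X_def by (rule threshold_mult)
      have "\<bar>real a * tilted q x - (real n - 1) * tilted p (- x)\<bar> \<le>
         2 * (q * \<epsilon> * window n) + 4 + x * (\<kappa> * \<sigma> * X) + (p / q + 1) * (x\<^sup>2 * real n) / 2"
        using x0 x1 n1 a an X0 w0 \<kappa> \<epsilon> \<sigma> pq
        by (intro mean_balance[OF _ _ _ _ _ _ _ th _ _ bal]) (auto simp: r_def)
      also have "\<dots> \<le> sqrt (real n)"
        using elim(5) unfolding T xX by (simp add: r_def)
      finally have mean: "\<bar>real a * tilted q x - real (n - 1) * tilted p (- x)\<bar> \<le> sqrt (real n)"
        using n1 by (simp add: of_nat_diff)
      have "c0 / (x * sqrt (real a)) * bern_mgf q x ^ a * bern_mgf p (- x) ^ (n - 1) * exp (x * s) \<le> \<pi>"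
        unfolding \<pi>_def
      proof (rule c0(2))
        have "sqrt (real (n - 1)) \<le> sqrt (real n)" by simp
        then show "sqrt (real (n - 1)) + \<bar>real a * tilted q x - real (n - 1) * tilted p (- x)\<bar> + \<bar>s\<bar> + 1 / x \<le> 4 * sqrt (real a)"
          using mean s sn elim(6) unfolding x_def[symmetric] by linarith
        show "8 * 4 / (\<rho> * (1 - \<rho>)) \<le> sqrt (real a)" using order_trans[OF elim(4) sn] by (simp add: Q_def)
      qed (use pq x0 x1 t n1 in auto)
      then have low: "c0 / (x * sqrt (real a)) * \<Phi> * exp (x * s) \<le> \<pi>" by (simp add: \<Phi>_def mult.assoc)
      have "x * (threshold \<kappa> \<epsilon> n * q - real n * p) + x\<^sup>2 / 2 * (threshold \<kappa> \<epsilon> n * q * (1 - q) + (real n - 1) * p * (1 - p))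
          - x ^ 3 / 6 * (real a + real n) \<le> real a * ln (bern_mgf q x) + real (n - 1) * ln (bern_mgf p (- x))"
        using x0 a n1 by (intro exponent_lower) (auto simp: of_nat_diff)
      moreover have "x * (threshold \<kappa> \<epsilon> n * q - real n * p) = - (\<kappa>\<^sup>2 * ln (real n)) + \<kappa> * q * \<epsilon> / \<sigma> * ln (ln (real n))"
      proof -
        have "x * (threshold \<kappa> \<epsilon> n * q - real n * p) = - (x * (\<kappa> * \<sigma> * X)) + q * \<epsilon> * (x * window n)"
          unfolding th by (simp add: algebra_simps)
        then show ?thesis unfolding xX T by (simp add: k_def)
      qed
      moreover have "\<kappa>\<^sup>2 / 2 * ln (real n) - x\<^sup>2 / 2 * (\<kappa> * \<sigma> * X + 1) \<le>
         x\<^sup>2 / 2 * (threshold \<kappa> \<epsilon> n * q * (1 - q) + (real n - 1) * p * (1 - p))"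
      proof -
        have "\<sigma>\<^sup>2 * real n - (\<kappa> * \<sigma> * X + 1) \<le> threshold \<kappa> \<epsilon> n * q * (1 - q) + (real n - 1) * p * (1 - p)"
        proof -
          have "0 \<le> (1 - q) * (q * \<epsilon> * window n)" using pq \<epsilon> w0 by simp
          moreover have "(1 - q) * (\<kappa> * \<sigma> * X) \<le> \<kappa> * \<sigma> * X" using pq \<kappa> \<sigma> X0 by (intro mult_left_le_one_le) auto
          moreover have "p * (1 - p) \<le> 1" using pq by (intro mult_le_one) auto
          moreover have "threshold \<kappa> \<epsilon> n * q * (1 - q) + (real n - 1) * p * (1 - p) =
             \<sigma>\<^sup>2 * real n - (1 - q) * (\<kappa> * \<sigma> * X) + (1 - q) * (q * \<epsilon> * window n) - p * (1 - p)"
            unfolding th \<sigma>(2) by (simp add: algebra_simps)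
          ultimately show ?thesis by linarith
        qed
        then have "x\<^sup>2 / 2 * (\<sigma>\<^sup>2 * real n - (\<kappa> * \<sigma> * X + 1)) \<le> x\<^sup>2 / 2 * (threshold \<kappa> \<epsilon> n * q * (1 - q) + (real n - 1) * p * (1 - p))"
          by (intro mult_left_mono) auto
        moreover have "x\<^sup>2 / 2 * (\<sigma>\<^sup>2 * real n) = \<kappa>\<^sup>2 / 2 * ln (real n)"
        proof -
          have "x\<^sup>2 / 2 * (\<sigma>\<^sup>2 * real n) = \<sigma>\<^sup>2 / 2 * (x\<^sup>2 * real n)" by simp
          also have "\<dots> = (k * \<sigma>)\<^sup>2 / 2 * ln (real n)" unfolding T by (simp add: power_mult_distrib)
          finally show ?thesis using k by simp
        qed
        ultimately show ?thesis by (simp add: right_diff_distrib)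
      qed
      moreover have "x ^ 3 / 6 * (real a + real n) \<le> x ^ 3 / 6 * ((r + 1) * real n)"
        using an x0 by (intro mult_left_mono) (auto simp: algebra_simps)
      ultimately have ex: "- (\<kappa>\<^sup>2 / 2 * ln (real n)) + \<kappa> * q * \<epsilon> / \<sigma> * ln (ln (real n)) - 1 \<le>
         real a * ln (bern_mgf q x) + real (n - 1) * ln (bern_mgf p (- x))"
        using elim(3) unfolding x_def[symmetric] X_def[symmetric] by linarith
      have \<Phi>: "\<Phi> = exp (real a * ln (bern_mgf q x) + real (n - 1) * ln (bern_mgf p (- x)))"
        unfolding \<Phi>_def using pq by (intro exp_ln_bern_mgf) auto
      have "c * exp (- (\<kappa>\<^sup>2 / 2 * ln (real n)) + \<kappa> * q * \<epsilon> / \<sigma> * ln (ln (real n)) + x * s) / sqrt (ln (real n)) =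
          c0 / (k * sqrt (ln (real n)) * sqrt r) * exp (- (\<kappa>\<^sup>2 / 2 * ln (real n)) + \<kappa> * q * \<epsilon> / \<sigma> * ln (ln (real n)) - 1) * exp (x * s)"
      proof -
        have "exp (- 1) * exp (L + x * s) = exp (L - 1) * exp (x * s)" for L :: real
          by (simp add: exp_add[symmetric])
        note this[of "- (\<kappa>\<^sup>2 / 2 * ln (real n)) + \<kappa> * q * \<epsilon> / \<sigma> * ln (ln (real n))"]
        then show ?thesis unfolding c_def times_divide_eq_left mult.assoc by (simp only: mult_ac divide_divide_eq_left)
      qed
      also have "\<dots> = c0 / (x * sqrt (r * real n)) * exp (- (\<kappa>\<^sup>2 / 2 * ln (real n)) + \<kappa> * q * \<epsilon> / \<sigma> * ln (ln (real n)) - 1) * exp (x * s)"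
        unfolding T(5)[symmetric] by (simp add: real_sqrt_mult mult_ac)
      also have "\<dots> \<le> c0 / (x * sqrt (real a)) * \<Phi> * exp (x * s)"
        unfolding \<Phi> using ex an x0 n1 c0(1) by (intro mult_right_mono mult_mono divide_left_mono mult_left_mono) auto
      also note low
      finally have main: "c * exp (- (\<kappa>\<^sup>2 / 2 * ln (real n)) + \<kappa> * q * \<epsilon> / \<sigma> * ln (ln (real n)) + x * s) / sqrt (ln (real n)) \<le> \<pi>" .
      have "diff_point a q (n - 2) p (\<lfloor>- s\<rfloor> + 1)
         \<le> bern_mgf q x ^ a * bern_mgf p (- x) ^ (n - 2) * (C0 / sqrt (real a)) * exp (- x * real_of_int (\<lfloor>- s\<rfloor> + 1))"
        using pq t an n1 by (intro binomial_diff_point_upper C0(2)) auto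
      \<comment> \<open>Passing from \<open>n - 2\<close> to \<open>n - 1\<close> minus vertices
        costs one factor \<open>bern_mgf p (- x)\<close>, which is at least 3/4 for the small
        tilt.\<close>
      also have "\<dots> \<le> bern_mgf q x ^ a * (3 * bern_mgf p (- x) ^ (n - 1)) * (C0 / sqrt (real a)) * exp (x * s)"
      proof -
        have mp: "0 < bern_mgf p (- x)" "0 < bern_mgf q x" using pq by (auto intro!: bern_mgf_pos)
        have "1 \<le> 3 * bern_mgf p (- x)"
        proof -
          have "1 - x \<le> exp (- x)" using exp_ge_add_one_self[of "- x"] by simp
          then have "3 / 4 \<le> exp (- x)" using x1 by linarith
          then have "p * (1 - exp (- x)) \<le> 1 * (1 / 4)" using pq x0 by (intro mult_mono) auto
          then have "3 / 4 \<le> bern_mgf p (- x)" by (simp add: bern_mgf_def right_diff_distrib)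
          then show ?thesis by linarith
        qed
        then have "bern_mgf p (- x) ^ (n - 2) * 1 \<le> bern_mgf p (- x) ^ (n - 2) * (3 * bern_mgf p (- x))"
          using mp by (intro mult_left_mono) auto
        moreover have "n - 1 = Suc (n - 2)" using n1 by simp
        ultimately have 1: "bern_mgf p (- x) ^ (n - 2) \<le> 3 * bern_mgf p (- x) ^ (n - 1)" by (simp add: mult_ac)
        have "- x * real_of_int (\<lfloor>- s\<rfloor> + 1) \<le> x * s"
        proof -
          have "- s \<le> real_of_int (\<lfloor>- s\<rfloor> + 1)" by linarith
          then have "x * (- s) \<le> x * real_of_int (\<lfloor>- s\<rfloor> + 1)" using x0 by (intro mult_left_mono) auto
          then show ?thesis by simp
        qed
        then show ?thesis using 1 mp C0(1) by (intro mult_mono) auto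
      qed
      also have "\<dots> = D * x * (c0 / (x * sqrt (real a)) * \<Phi> * exp (x * s))"
        using x0 c0(1) by (simp add: D_def \<Phi>_def field_simps)
      also have "\<dots> \<le> D * x * \<pi>"
        using low x0 C0(1) c0(1) by (intro mult_left_mono) (auto simp: D_def)
      finally show "c * exp (- (\<kappa>\<^sup>2 / 2 * ln (real n)) + \<kappa> * q * \<epsilon> / \<sigma> * ln (ln (real n)) + tilt k n * s) / sqrt (ln (real n))
       \<le> diff_tail a q (n - 1) p s \<and>
     diff_point a q (n - 2) p (\<lfloor>- s\<rfloor> + 1)
       \<le> D * tilt k n * diff_tail a q (n - 1) p s"
        using main unfolding \<pi>_def x_def by simp
    qed
  qed
  moreover have "0 < c" "0 < D" using c0 C0 k r by (auto simp: c_def D_def)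
  ultimately show ?thesis by blast
qed

end

section \<open>The phases of the model\<close>

text \<open>Restates \<open>static_many\<close> in the form used by the lemmas on the second and
  third day, with an explicit lower bound \<open>g\<close> in place of the tail probability.\<close>

lemma (in block_model) static_many_bound:
  assumes a: "a \<le> m" and n: "0 < n" and g: "0 < g"
    and low: "g \<le> diff_tail a q (n - 1) p s"
    and point: "diff_point a q (n - 2) p (\<lfloor>- s\<rfloor> + 1)
      \<le> r * diff_tail a q (n - 1) p s"
    and c: "c \<le> q * (real n * g / 2 - l) / 2"
  shows "Pr {E. q * (real (card {v \<in> B. - s < real_of_int (adv E v)}) - l) / 2 < c}
    \<le> 4 / (real n * g) + 4 * ((1 + r)\<^sup>2 - 1)"
proof -
  define \<pi> where "\<pi> = diff_tail a q (n - 1) p s"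
  define \<rho> where "\<rho> = diff_point a q (n - 2) p (\<lfloor>- s\<rfloor> + 1)"
  have \<pi>: "g \<le> \<pi>" "0 < \<pi>" using low g by (auto simp: \<pi>_def)
  have \<rho>: "0 \<le> \<rho>" "\<rho> \<le> r * \<pi>" using point by (auto simp: \<pi>_def \<rho>_def)
  have "Pr {E. q * (real (card {v \<in> B. - s < real_of_int (adv E v)}) - l) / 2 < c} \<le>
    Pr {E. real (card {v \<in> B. - s < real_of_int (adv E v)}) \<le> real n * \<pi> / 2}"
  proof (rule sbm_mono_AE)
    fix E assume "q * (real (card {v \<in> B. - s < real_of_int (adv E v)}) - l) / 2 < c"
    from less_le_trans[OF this c]
    have "real (card {v \<in> B. - s < real_of_int (adv E v)}) < real n * g / 2"
      using pq by (simp add: divide_less_cancel mult_less_cancel_left_pos)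
    also have "\<dots> \<le> real n * \<pi> / 2" using \<pi> by (intro divide_right_mono mult_left_mono) auto
    finally show "real (card {v \<in> B. - s < real_of_int (adv E v)}) \<le> real n * \<pi> / 2" by simp
  qed
  also have "\<dots> \<le> 4 / (real n * \<pi>) + 4 * ((1 + \<rho> / \<pi>)\<^sup>2 - 1)"
    by (rule static_many[OF a n \<pi>_def \<pi>(2) \<rho>_def])
  also have "\<dots> \<le> 4 / (real n * g) + 4 * ((1 + r)\<^sup>2 - 1)"
  proof -
    have "\<rho> / \<pi> \<le> r" using \<rho> \<pi> by (simp add: divide_le_eq)
    then have "(1 + \<rho> / \<pi>)\<^sup>2 \<le> (1 + r)\<^sup>2" using \<rho> \<pi> by (intro power_mono) auto
    moreover have "4 / (real n * \<pi>) \<le> 4 / (real n * g)"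
      using \<pi> g n by (intro divide_left_mono mult_left_mono) auto
    ultimately show ?thesis by (intro add_mono mult_left_mono diff_right_mono) auto
  qed
  finally show ?thesis .
qed

context rates
begin

text \<open>Chosen so that Hoeffding's bound for a deviation \<tau> sqrt(n ln n) is at most n^(-2)
  for binomials of size up to (p / q + 1) n; a union over n vertices then still vanishes.\<close>

definition \<tau> :: real where "\<tau> = sqrt (p / q + 1)"

lemma \<tau>: "0 < \<tau>" "\<tau>\<^sup>2 = p / q + 1"
proof -
  have "0 < p / q + 1" using pq by (simp add: add_pos_pos)
  then show "0 < \<tau>" "\<tau>\<^sup>2 = p / q + 1" by (auto simp: \<tau>_def)
qed

lemma deviation:
  assumes n: "2 \<le> n" and a: "0 < a" "real a \<le> (p / q + 1) * real n"
    and d: "d < real a * q - (real n - 1) * p - 2 * (\<tau> * sqrt (real n * ln (real n)))"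
  shows "real n * binom_pair_prob a q (n - 1) p {(i, j). real i - real j \<le> d} \<le> 2 / real n"
proof -
  define t where "t = \<tau> * sqrt (real n * ln (real n))"
  have l0: "0 \<le> ln (real n)" using n by simp
  have t: "0 \<le> t" "t\<^sup>2 = (p / q + 1) * real n * ln (real n)"
    using \<tau> l0 by (auto simp: t_def power_mult_distrib)
  have e: "exp (- 2 * t\<^sup>2 / real b) \<le> 1 / (real n)\<^sup>2" if b: "0 < b" "real b \<le> (p / q + 1) * real n" for b
  proof -
    have "2 * ln (real n) * real b \<le> 2 * ln (real n) * ((p / q + 1) * real n)"
      using b l0 by (intro mult_left_mono) auto
    then have "2 * ln (real n) \<le> 2 * t\<^sup>2 / real b"
      using b unfolding t(2) by (subst pos_le_divide_eq) (auto simp: mult_ac)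
    then have "exp (- 2 * t\<^sup>2 / real b) \<le> exp (- (2 * ln (real n)))" by simp
    also have "\<dots> = 1 / (real n)\<^sup>2"
    proof -
      have "exp (2 * ln (real n)) = (real n)\<^sup>2" using n by (simp add: exp_double)
      then show ?thesis by (simp add: exp_minus inverse_eq_divide)
    qed
    finally show ?thesis .
  qed
  have "binom_pair_prob a q (n - 1) p {(i, j). real i - real j \<le> d} \<le>
     binom_pair_prob a q (n - 1) p
       {(i, j). real i - real j < real a * q - real (n - 1) * p - 2 * t}"
    using d n by (intro measure_pmf.finite_measure_mono) (auto simp: t_def of_nat_diff)
  also have "\<dots> \<le> exp (- 2 * t\<^sup>2 / real a) + exp (- 2 * t\<^sup>2 / real (n - 1))"
    using pq t a by (intro binomial_diff_deviation) auto
  also have "\<dots> \<le> 1 / (real n)\<^sup>2 + 1 / (real n)\<^sup>2"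
  proof (intro add_mono e)
    have "1 * real n \<le> (p / q + 1) * real n" using pq by (intro mult_right_mono) auto
    then show "real (n - 1) \<le> (p / q + 1) * real n" by (rule order_trans[rotated]) simp
  qed (use a n in auto)
  finally have "real n * binom_pair_prob a q (n - 1) p {(i, j). real i - real j \<le> d}
     \<le> real n * (1 / (real n)\<^sup>2 + 1 / (real n)\<^sup>2)"
    by (intro mult_left_mono) auto
  also have "\<dots> = 2 / real n" using n by (simp add: power2_eq_square field_simps)
  finally show ?thesis .
qed

lemma threshold_const_eq: "threshold_const p q = \<sigma> / q"
  by (simp add: threshold_const_def \<sigma>_def)

end

lemma tendsto_one_of_error:
  assumes "\<forall>\<^sub>F n in sequentially. 1 - e n \<le> f n" "\<And>n. f n \<le> 1" "e \<longlonglongrightarrow> (0::real)"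
  shows "f \<longlonglongrightarrow> (1::real)"
proof (rule tendsto_sandwich[OF assms(1)])
  show "(\<lambda>n. 1 - e n) \<longlonglongrightarrow> 1" using tendsto_diff[OF tendsto_const assms(3), of 1] by simp
qed (use assms(2) in auto)

lemma model_prob_le_1: "model_prob p q \<Delta> w n A \<le> 1"
  unfolding model_prob_def by (rule prob_space.prob_le_1[OF prob_space_trajectory_law])

section \<open>The five statements along a sequence of models\<close>

locale started = rates +
  fixes \<Delta> :: "nat \<Rightarrow> nat" and w :: "nat \<Rightarrow> opinions"
  assumes start: "valid_start \<Delta> w"
begin

lemma block: "1 \<le> n \<Longrightarrow> block_model p q {1..2 * n + \<Delta> n} (w n) (n + \<Delta> n) n"
  using start pq unfolding valid_start_def by unfold_locales (auto simp: Suc_le_eq)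

definition err :: "nat \<Rightarrow> real" where
  "err n = (2 * real (n + \<Delta> n) + 2) * (2 * real (n + \<Delta> n)) * (2 * exp (- (real (n + \<Delta> n - 1) * (p - q)\<^sup>2 / 2)))"

lemma err_eq: "1 \<le> n \<Longrightarrow> block_model.\<gamma> p q (n + \<Delta> n) = err n"
  by (simp only: err_def block_model.\<gamma>_def[OF block] block_model.\<eta>_def[OF block])

text \<open>As \<open>\<Delta>\<close> may grow arbitrarily fast, the error is compared with a null
  sequence evaluated at \<open>n + \<Delta> n\<close>.\<close>

lemma err: "err \<longlonglongrightarrow> 0"
proof -
  define c where "c = (p - q)\<^sup>2 / 2"
  define f where "f k = (2 * real k + 2) * (2 * real k) * (2 * exp (- ((real k - 1) * c)))" for k :: nat
  have c: "0 < c" using pq by (simp add: c_def)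
  have le: "err n \<le> f (n + \<Delta> n)" "0 \<le> err n" for n
  proof -
    have "(real (n + \<Delta> n) - 1) * c \<le> real (n + \<Delta> n - 1) * c"
      using c by (intro mult_right_mono) linarith+
    then show "err n \<le> f (n + \<Delta> n)"
      unfolding err_def f_def by (intro mult_left_mono) (auto simp: c_def)
    show "0 \<le> err n" by (simp add: err_def)
  qed
  have "f \<longlonglongrightarrow> 0" unfolding f_def using c by real_asymp
  moreover have "filterlim (\<lambda>n. n + \<Delta> n) at_top sequentially"
    by (rule filterlim_at_top_mono[OF filterlim_ident]) auto
  ultimately have "(\<lambda>n. f (n + \<Delta> n)) \<longlonglongrightarrow> 0" by (rule filterlim_compose)
  then show ?thesis
    by (rule tendsto_sandwich[OF _ _ tendsto_const, rotated 2]) (use le in auto)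
qed

lemma minus_never_wins: "(\<lambda>n. model_prob p q \<Delta> w n minus_wins) \<longlonglongrightarrow> 0"
proof (rule tendsto_sandwich[OF _ _ tendsto_const err])
  show "\<forall>\<^sub>F n in sequentially. model_prob p q \<Delta> w n minus_wins \<le> err n"
    using eventually_ge_at_top[of 1]
  proof eventually_elim
    case (elim n)
    show ?case unfolding model_prob_def err_eq[OF elim, symmetric]
      by (rule block_model.minus_wins_prob[OF block[OF elim]])
  qed
qed (simp add: model_prob_def)

lemma halts_subcritical:
  assumes \<epsilon>: "0 < \<epsilon>"
    and \<Delta>: "\<forall>\<^sub>F n in sequentially. real (\<Delta> n) \<le> (p - q) / q * real n - \<sigma> / q * sqrt (real n * ln (real n)) - \<epsilon> * window n"
  shows "(\<lambda>n. model_prob p q \<Delta> w n halts) \<longlonglongrightarrow> 1"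
proof -
  define \<theta> where "\<theta> = q * \<epsilon> / \<sigma>"
  define k where "k = 1 / \<sigma>"
  have pos: "0 < \<theta>" "0 < k" using \<sigma> pq \<epsilon> by (auto simp: \<theta>_def k_def)
  \<comment> \<open>Between two scales: the expected count has order sqrt n (ln n)^(- 1/2 -
    \<theta>), so Markov leaves (ln n)^(- \<theta>/2), while \<open>\<mu>\<close> is small enough
    against sqrt(n / ln n) for the feedback factor exp(2 x \<mu>) to tend to 1.\<close>
  define \<mu> where "\<mu> n = sqrt (real n) * ln (real n) powr (- 1 / 2 - \<theta> / 2)" for n :: nat
  obtain C where C: "0 < C" and tail: "\<forall>\<^sub>F n in sequentially. \<forall>a s. n \<le> a \<longrightarrow>
     real a \<le> p / q * real n - \<sigma> / q * sqrt (real n * ln (real n)) - \<epsilon> * window n \<longrightarrow>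
     binom_pair_prob a q (n - 1) p {(i, j). - s \<le> real i - real j}
     \<le> C * exp (- (ln (real n) / 2) - \<theta> * ln (ln (real n)) + tilt k n * s) / sqrt (ln (real n))"
    using tail_upper[OF \<epsilon>] unfolding \<theta>_def k_def by blast
  define e where "e n = real n * (C * exp (- (ln (real n) / 2) - \<theta> * ln (ln (real n)) + tilt k n * (2 * \<mu> n)) / sqrt (ln (real n))) / \<mu> n" for n
  have e: "e \<longlonglongrightarrow> 0" unfolding e_def \<mu>_def tilt_def using C pos by real_asymp
  have \<mu>n: "\<forall>\<^sub>F n in sequentially. \<mu> n \<le> real n" unfolding \<mu>_def using pos by real_asymp
  have "\<forall>\<^sub>F n in sequentially. 1 - (err n + e n) \<le> model_prob p q \<Delta> w n halts"
    using tail \<Delta> \<mu>n eventually_ge_at_top[of 3]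
  proof eventually_elim
    case (elim n)
    have n1: "1 \<le> n" using elim by simp
    interpret block_model p q "{1..2 * n + \<Delta> n}" "w n" "n + \<Delta> n" n by (rule block[OF n1])
    have ln0: "0 < ln (real n)" using elim(4) by simp
    have \<mu>0: "0 < \<mu> n" using n1 ln0 by (simp add: \<mu>_def)
    have le: "real (n + \<Delta> n) \<le> p / q * real n - \<sigma> / q * sqrt (real n * ln (real n)) - \<epsilon> * window n"
      using elim(2) pq by (simp add: diff_divide_distrib algebra_simps)
    have "Pr {E. \<mu> n \<le> real (card {v \<in> B. - 2 * \<mu> n < real_of_int (adv E v)})}
      \<le> real n * binom_pair_prob (n + \<Delta> n) q (n - 1) p {(i, j). - (2 * \<mu> n) \<le> real i - real j} / \<mu> n"
      by (rule static_few[OF \<mu>0])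
    also have "\<dots> \<le> e n"
      unfolding e_def using elim(1) le \<mu>0 by (intro divide_right_mono mult_left_mono) auto
    finally have "1 - (err n + e n) \<le> 1 - (\<gamma> + Pr
        {E. \<mu> n \<le> real (card {v \<in> B. - 2 * \<mu> n < real_of_int (adv E v)})})"
      using err_eq[OF n1] by linarith
    also have "\<dots> \<le> model_prob p q \<Delta> w n halts"
      unfolding model_prob_def by (rule halts_prob[OF elim(3)])
    finally show ?case .
  qed
  moreover have "(\<lambda>n. err n + e n) \<longlonglongrightarrow> 0" using tendsto_add[OF err e] by simp
  ultimately show ?thesis by (intro tendsto_one_of_error model_prob_le_1)
qed

text \<open>At the size p n / q + (2 \<tau> / q) sqrt(n ln n) the mean of a sum exceeds twice the
  deviation \<tau> sqrt(n ln n) conceded to each binomial.\<close>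

lemma first_day_supercritical:
  assumes L: "2 * \<tau> / q \<le> L"
    and \<Delta>: "\<forall>\<^sub>F n in sequentially. real (\<Delta> n) \<ge> (p - q) / q * real n + L * sqrt (real n * ln (real n))"
  shows "(\<lambda>n. model_prob p q \<Delta> w n (\<lambda>V. plus_wins_on V 1)) \<longlonglongrightarrow> 1"
proof -
  define r where "r = p / q"
  define h where "h = 2 * \<tau> / q"
  have pos: "0 < r" "0 < h" using pq \<tau> by (auto simp: r_def h_def)
  have size: "\<forall>\<^sub>F n in sequentially. r * real n + h * sqrt (real n * ln (real n)) + 1 \<le> (r + 1) * real n"
    using pos by real_asymp
  have "\<forall>\<^sub>F n in sequentially. 1 - (err n + 2 / real n) \<le> model_prob p q \<Delta> w n (\<lambda>V. plus_wins_on V 1)"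
    using \<Delta> size eventually_ge_at_top[of 2]
  proof eventually_elim
    case (elim n)
    have n1: "1 \<le> n" using elim by simp
    interpret block_model p q "{1..2 * n + \<Delta> n}" "w n" "n + \<Delta> n" n by (rule block[OF n1])
    let ?X = "sqrt (real n * ln (real n))"
    define a where "a = nat \<lceil>r * real n + h * ?X\<rceil>"
    have X0: "0 \<le> ?X" using n1 by simp
    have x0: "0 < r * real n + h * ?X" using pos X0 n1 by (intro add_pos_nonneg) auto
    have a: "r * real n + h * ?X \<le> real a" "real a \<le> r * real n + h * ?X + 1" "0 < a"
      using x0 unfolding a_def by linarith+
    have "h * ?X \<le> L * ?X" using L X0 unfolding h_def by (intro mult_right_mono)
    then have "r * real n + h * ?X \<le> real (n + \<Delta> n)"
      using elim(1) pq by (simp add: r_def diff_divide_distrib algebra_simps)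
    then have am: "a \<le> n + \<Delta> n" unfolding a_def by (simp add: nat_le_iff ceiling_le_iff)
    have "(r * real n + h * ?X) * q \<le> real a * q" using a pq by (intro mult_right_mono) auto
    \<comment> \<open>Strict because a minus vertex has only \<open>n - 1\<close> possible minus
      neighbours, which leaves a slack of \<open>p\<close>.\<close>
    then have d: "- 0 < real a * q - (real n - 1) * p - 2 * (\<tau> * ?X)"
      using pq by (simp add: r_def h_def algebra_simps)
    have "Pr {E. \<exists>v\<in>B. adv E v \<le> 0} =
      Pr {E. \<exists>v\<in>B. real_of_int (adv E v) \<le> - 0}"
      by simp
    also have "\<dots> \<le> real n * binom_pair_prob a q (n - 1) p {(i, j). real i - real j \<le> - 0}"
      by (rule static_all[OF am])
    also have "\<dots> \<le> 2 / real n"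
      using a elim(2) by (intro deviation[OF elim(3) _ _ d]) (auto simp: r_def)
    finally have "1 - (err n + 2 / real n) \<le> 1 - (\<gamma> + Pr
        {E. \<exists>v\<in>B. adv E v \<le> 0})"
      using err_eq[OF n1] by linarith
    also have "\<dots> \<le> model_prob p q \<Delta> w n (\<lambda>V. plus_wins_on V 1)"
      unfolding model_prob_def by (rule first_day_prob)
    finally show ?case .
  qed
  moreover have "(\<lambda>n. 2 / real n) \<longlonglongrightarrow> 0" by real_asymp
  from tendsto_add[OF err this] have "(\<lambda>n. err n + 2 / real n) \<longlonglongrightarrow> 0" by simp
  ultimately show ?thesis by (intro tendsto_one_of_error model_prob_le_1)
qed

text \<open>For large \<open>\<Delta>\<close> only the edges towards a fixed set of \<open>a\<close> plus vertices are counted,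
  with \<open>a\<close> at the threshold, so that the local estimates apply.\<close>

lemma threshold_size:
  assumes \<kappa>: "0 < \<kappa>" and \<epsilon>: "0 \<le> \<epsilon>"
    and \<Delta>: "\<forall>\<^sub>F n in sequentially. real (\<Delta> n) \<ge> (p - q) / q * real n - \<kappa> * \<sigma> / q * sqrt (real n * ln (real n)) + \<epsilon> * window n"
    and a_def: "\<And>n. a n = nat \<lceil>threshold \<kappa> \<epsilon> n\<rceil>"
  shows "\<forall>\<^sub>F n in sequentially. threshold \<kappa> \<epsilon> n \<le> real (a n) \<and> real (a n) \<le> threshold \<kappa> \<epsilon> n + 1 \<and> a n \<le> n + \<Delta> n \<and>
    0 < a n \<and> real (a n) \<le> (p / q + 1) * real n"
  using threshold_bounds[OF \<kappa> \<epsilon>] \<Delta> eventually_ge_at_top[of 1]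
proof eventually_elim
  case (elim n)
  have x0: "1 \<le> threshold \<kappa> \<epsilon> n" using elim by linarith
  then have 1: "threshold \<kappa> \<epsilon> n \<le> real (a n)" "real (a n) \<le> threshold \<kappa> \<epsilon> n + 1" "0 < a n"
    unfolding a_def by linarith+
  have "threshold \<kappa> \<epsilon> n \<le> real (n + \<Delta> n)"
    using elim(2) pq by (simp add: threshold_def diff_divide_distrib algebra_simps)
  then have "a n \<le> n + \<Delta> n" unfolding a_def by (simp add: nat_le_iff ceiling_le_iff)
  moreover have "(p / q + 1) * real n = p / q * real n + real n" by (simp add: algebra_simps)
  ultimately show ?case using 1 elim(1) by linarith
qed

text \<open>For \<open>\<kappa> \<le> 1\<close> the mean is at least - \<sigma> sqrt(n ln n), and
  the deviations of the two binomials add 2 \<tau> sqrt(n ln n).\<close>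

lemma deviation_at_threshold:
  assumes n: "2 \<le> n" and \<kappa>: "0 \<le> \<kappa>" "\<kappa> \<le> 1" and \<epsilon>: "0 \<le> \<epsilon>"
    and a: "threshold \<kappa> \<epsilon> n \<le> real a" "0 < a" "real a \<le> (p / q + 1) * real n"
  shows "real n * binom_pair_prob a q (n - 1) p
      {(i, j). real i - real j \<le> - ((\<sigma> + 2 * \<tau>) * sqrt (real n * ln (real n)))} \<le> 2 / real n"
proof (rule deviation[OF n a(2,3)])
  let ?X = "sqrt (real n * ln (real n))"
  have X0: "0 \<le> ?X" using n by simp
  have w0: "0 \<le> window n" using n by (simp add: window_def)
  have "threshold \<kappa> \<epsilon> n * q \<le> real a * q" using a pq by (intro mult_right_mono) auto
  moreover have "\<kappa> * \<sigma> * ?X \<le> \<sigma> * ?X" using \<kappa> \<sigma> X0 by (intro mult_right_mono) (auto simp: mult_left_le_one_le)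
  moreover have "0 \<le> q * \<epsilon> * window n" using pq \<epsilon> w0 by simp
  moreover have "(\<sigma> + 2 * \<tau>) * ?X = \<sigma> * ?X + 2 * (\<tau> * ?X)" "(real n - 1) * p = p * real n - p"
    by (simp_all add: algebra_simps)
  ultimately show "- ((\<sigma> + 2 * \<tau>) * ?X) < real a * q - (real n - 1) * p - 2 * (\<tau> * ?X)"
    using pq unfolding threshold_mult by linarith
qed

text \<open>For \<open>\<kappa> < 1\<close> the first batch has size of order at least n^(1 -
  \<kappa>^2 / 2) up to logarithms. The exponent exceeds 1/2, so one batch outweighs the worst
  deficit of order sqrt(n ln n).\<close>

lemma second_day_supercritical:
  assumes \<kappa>: "0 < \<kappa>" "\<kappa> < 1"
    and \<Delta>: "\<forall>\<^sub>F n in sequentially. real (\<Delta> n) \<ge> (p - q) / q * real n - \<kappa> * \<sigma> / q * sqrt (real n * ln (real n))"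
  shows "(\<lambda>n. model_prob p q \<Delta> w n (\<lambda>V. plus_wins_on V 2)) \<longlonglongrightarrow> 1"
proof -
  define a where "a n = nat \<lceil>threshold \<kappa> 0 n\<rceil>" for n
  define u where "u = \<kappa>\<^sup>2 / 2"
  define k where "k = \<kappa> / \<sigma>"
  define c0 where "c0 = \<sigma> + 2 * \<tau>"
  have u: "0 < u" "u < 1 / 2" using \<kappa> by (auto simp: u_def power_less_one_iff)
  have pos: "0 < k" "0 < c0" "0 < q" using \<kappa> \<sigma> \<tau> pq by (auto simp: k_def c0_def)
  obtain c D where c: "0 < c" and D: "0 < D" and tail: "\<forall>\<^sub>F n in sequentially. lower_tail_bounds \<kappa> 0 c D n"
    using tail_lower[of \<kappa> 0] \<kappa> by auto
  define g where "g n = c * exp (- (u * ln (real n))) / sqrt (ln (real n))" for n :: nat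
  \<comment> \<open>Negligible against the counts, yet large enough that n exp(- q^2 l / 2) tends to
    0.\<close>
  define l where "l n = (ln (real n))\<^sup>2" for n :: nat
  define e where "e n = real n * exp (- (q\<^sup>2 * l n / 2)) + 2 / real n + (4 / (real n * g n) + 4 * ((1 + D * tilt k n)\<^sup>2 - 1))" for n :: nat
  have e: "e \<longlonglongrightarrow> 0"
  proof -
    have 1: "(\<lambda>n. real n * exp (- (q\<^sup>2 * l n / 2))) \<longlonglongrightarrow> 0" unfolding l_def using pos by real_asymp
    have 2: "(\<lambda>n. 2 / real n) \<longlonglongrightarrow> 0" by real_asymp
    have 3: "(\<lambda>n. 4 / (real n * g n)) \<longlonglongrightarrow> 0" unfolding g_def using c u by real_asymp
    have 4: "(\<lambda>n. 4 * ((1 + D * tilt k n)\<^sup>2 - 1)) \<longlonglongrightarrow> 0" unfolding tilt_def using D pos by real_asymp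
    show ?thesis unfolding e_def using tendsto_add[OF tendsto_add[OF 1 2] tendsto_add[OF 3 4]] by simp
  qed
  have big: "\<forall>\<^sub>F n in sequentially. c0 * sqrt (real n * ln (real n)) \<le> q * (real n * g n / 2 - l n) / 2"
    unfolding g_def l_def using pos c u by real_asymp
  have "\<forall>\<^sub>F n in sequentially. real (\<Delta> n) \<ge> (p - q) / q * real n - \<kappa> * \<sigma> / q * sqrt (real n * ln (real n)) + 0 * window n"
    using \<Delta> by simp
  note size = threshold_size[OF \<kappa>(1) order_refl this a_def]
  have "\<forall>\<^sub>F n in sequentially. 1 - (err n + e n) \<le> model_prob p q \<Delta> w n (\<lambda>V. plus_wins_on V 2)"
    using tail big size eventually_ge_at_top[of 3]
  proof eventually_elim
    case (elim n)
    have n1: "1 \<le> n" "2 \<le> n" using elim by auto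
    interpret block_model p q "{1..2 * n + \<Delta> n}" "w n" "n + \<Delta> n" n by (rule block[OF n1(1)])
    have ln0: "0 < ln (real n)" using elim(4) by simp
    have g0: "0 < g n" using c ln0 by (simp add: g_def)
    have 1: "Pr {E. \<exists>v\<in>B. real_of_int (adv E v) \<le> - (c0 * sqrt (real n * ln (real n)))}
      \<le> 2 / real n"
      unfolding c0_def
      by (rule order_trans[OF static_all deviation_at_threshold[of n \<kappa> 0 "a n"]]) (use elim n1 \<kappa> in auto)
    have tl: "g n \<le> diff_tail (a n) q (n - 1) p 0"
       "diff_point (a n) q (n - 2) p (\<lfloor>- 0 :: real\<rfloor> + 1)
       \<le> (D * tilt k n) * diff_tail (a n) q (n - 1) p 0"
      using elim(1)[unfolded lower_tail_bounds_def, rule_format, of "a n" 0] elim(3) by (simp_all add: g_def u_def k_def)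
    have 2: "Pr {E. q * (real (card {v \<in> B. - 0 < real_of_int (adv E v)}) - l n) / 2 < c0 * sqrt (real n * ln (real n))}
      \<le> 4 / (real n * g n) + 4 * ((1 + D * tilt k n)\<^sup>2 - 1)"
      by (rule static_many_bound[OF _ _ g0 tl elim(2)]) (use elim n1 in auto)
    have l0: "0 \<le> l n" by (simp add: l_def)
    show ?case
      unfolding model_prob_def
      by (rule order_trans[OF _ second_day_prob[OF l0, of "c0 * sqrt (real n * ln (real n))"]]) (use 1 2 err_eq[OF n1(1)] in \<open>simp add: e_def\<close>)
  qed
  moreover have "(\<lambda>n. err n + e n) \<longlonglongrightarrow> 0" using tendsto_add[OF err e] by simp
  ultimately show ?thesis by (intro tendsto_one_of_error model_prob_le_1)
qed

text \<open>The first batch has order at least sqrt n (ln n)^(\<theta> - 1/2), which for every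
  \<theta> > 0 exceeds any multiple of the window sqrt(n / ln n) ln (ln n). Lowering the level by
  \<open>s\<close> multiplies the count by (ln n)^2, and the second count then beats sqrt(n ln
  n).\<close>

lemma third_day_supercritical:
  assumes \<epsilon>: "0 < \<epsilon>"
    and \<Delta>: "\<forall>\<^sub>F n in sequentially. real (\<Delta> n) \<ge> (p - q) / q * real n - \<sigma> / q * sqrt (real n * ln (real n)) + \<epsilon> * window n"
  shows "(\<lambda>n. model_prob p q \<Delta> w n (\<lambda>V. plus_wins_on V 3)) \<longlonglongrightarrow> 1"
proof -
  define a where "a n = nat \<lceil>threshold 1 \<epsilon> n\<rceil>" for n
  define \<theta> where "\<theta> = q * \<epsilon> / \<sigma>"
  define \<theta>' where "\<theta>' = \<theta> + 2"
  define k where "k = 1 / \<sigma>"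
  define c0 where "c0 = \<sigma> + 2 * \<tau>"
  have pos: "0 < k" "0 < c0" "0 < q" "0 < \<theta>" "2 < \<theta>'" "0 < \<sigma>" using \<sigma> \<tau> pq \<epsilon> by (auto simp: k_def c0_def \<theta>_def \<theta>'_def)
  obtain c D where c: "0 < c" and D: "0 < D" and tail: "\<forall>\<^sub>F n in sequentially. lower_tail_bounds 1 \<epsilon> c D n"
    using tail_lower[of 1 \<epsilon>] \<epsilon> by auto
  define g where "g \<theta> n = c * exp (- (1 / 2 * ln (real n)) + \<theta> * ln (ln (real n))) / sqrt (ln (real n))" for \<theta> and n :: nat
  define l where "l n = (ln (real n))\<^sup>2" for n :: nat
  \<comment> \<open>The factor \<open>2 * \<sigma>\<close> makes the product of tilt and level equal
    to 2 ln (ln n), hence \<open>\<theta>' = \<theta> + 2\<close>.\<close>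
  define s where "s n = 2 * \<sigma> * window n" for n
  define d where "d \<theta> n = 4 / (real n * g \<theta> n) + 4 * ((1 + D * tilt k n)\<^sup>2 - 1)" for \<theta> n
  define e where "e n = real n * exp (- (q\<^sup>2 * l n / 2)) + real n * exp (- (q\<^sup>2 * l n / 2)) + 2 / real n + (d \<theta> n + d \<theta>' n)" for n :: nat
  have d: "d \<theta> \<longlonglongrightarrow> 0" if "0 < \<theta>" for \<theta>
  proof -
    have 3: "(\<lambda>n. 4 / (real n * g \<theta> n)) \<longlonglongrightarrow> 0" unfolding g_def using c that by real_asymp
    have 4: "(\<lambda>n. 4 * ((1 + D * tilt k n)\<^sup>2 - 1)) \<longlonglongrightarrow> 0" unfolding tilt_def using D pos by real_asymp
    show ?thesis unfolding d_def using tendsto_add[OF 3 4] by simp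
  qed
  have e: "e \<longlonglongrightarrow> 0"
  proof -
    have 1: "(\<lambda>n. real n * exp (- (q\<^sup>2 * l n / 2))) \<longlonglongrightarrow> 0" unfolding l_def using pos by real_asymp
    have 2: "(\<lambda>n. 2 / real n) \<longlonglongrightarrow> 0" by real_asymp
    have "d \<theta> \<longlonglongrightarrow> 0" "d \<theta>' \<longlonglongrightarrow> 0" using d pos by auto
    from tendsto_add[OF tendsto_add[OF tendsto_add[OF 1 1] 2] tendsto_add[OF this]]
    show ?thesis unfolding e_def by simp
  qed
  have big1: "\<forall>\<^sub>F n in sequentially. s n \<le> q * (real n * g \<theta> n / 2 - l n) / 2"
    unfolding g_def l_def s_def window_def using pos c by real_asymp
  have big2: "\<forall>\<^sub>F n in sequentially. c0 * sqrt (real n * ln (real n)) \<le> q * (real n * g \<theta>' n / 2 - 2 * l n) / 2"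
    unfolding g_def l_def using pos c by real_asymp
  have ssmall: "\<forall>\<^sub>F n in sequentially. \<bar>s n\<bar> \<le> sqrt (real n)"
    unfolding s_def window_def using pos by real_asymp
  have ln1: "\<forall>\<^sub>F n in sequentially. 1 \<le> ln (real n)" by real_asymp
  have "\<forall>\<^sub>F n in sequentially. 1 - (err n + e n) \<le> model_prob p q \<Delta> w n (\<lambda>V. plus_wins_on V 3)"
    using tail big1 big2 ssmall ln1 threshold_size[OF zero_less_one less_imp_le[OF \<epsilon>] _ a_def, unfolded mult_1, OF \<Delta>] eventually_ge_at_top[of 3]
  proof eventually_elim
    case (elim n)
    have n1: "1 \<le> n" "2 \<le> n" using elim by auto
    interpret block_model p q "{1..2 * n + \<Delta> n}" "w n" "n + \<Delta> n" n by (rule block[OF n1(1)])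
    have ln0: "0 < ln (real n)" using elim(5) by simp
    have g0: "0 < g \<theta> n" for \<theta> using c ln0 by (simp add: g_def)
    have 1: "Pr {E. \<exists>v\<in>B. real_of_int (adv E v) \<le> - (c0 * sqrt (real n * ln (real n)))}
      \<le> 2 / real n"
      unfolding c0_def
      by (rule order_trans[OF static_all deviation_at_threshold[of n 1 \<epsilon> "a n"]]) (use elim n1 \<epsilon> in auto)
    note bounds = elim(1)[unfolded lower_tail_bounds_def power_one mult_1, folded \<theta>_def k_def, rule_format, of "a n"]
    have tl: "g \<theta> n \<le> diff_tail (a n) q (n - 1) p 0"
       "diff_point (a n) q (n - 2) p (\<lfloor>- 0 :: real\<rfloor> + 1)
       \<le> (D * tilt k n) * diff_tail (a n) q (n - 1) p 0"
      using bounds[of 0] elim(6) by (simp_all add: g_def)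
    have 2: "Pr {E. q * (real (card {v \<in> B. - 0 < real_of_int (adv E v)}) - l n) / 2 < s n}
      \<le> d \<theta> n"
      unfolding d_def by (rule static_many_bound[OF _ _ g0 tl elim(2)]) (use elim n1 in auto)
    have "tilt k n * s n = 2 * \<sigma> * (tilt k n * window n)" by (simp add: s_def)
    also have "\<dots> = 2 * ln (ln (real n))" unfolding tilt_algebra(4)[OF elim(5)] using pos by (simp add: k_def)
    finally have ts: "- (1 / 2 * ln (real n)) + \<theta> * ln (ln (real n)) + tilt k n * s n = - (1 / 2 * ln (real n)) + \<theta>' * ln (ln (real n))"
      by (simp add: \<theta>'_def algebra_simps)
    have tl': "g \<theta>' n \<le> diff_tail (a n) q (n - 1) p (s n)"
       "diff_point (a n) q (n - 2) p (\<lfloor>- s n\<rfloor> + 1)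
       \<le> (D * tilt k n) * diff_tail (a n) q (n - 1) p (s n)"
      using bounds[of "s n", unfolded ts] elim(6,4) by (simp_all add: g_def)
    have 3: "Pr {E. q * (real (card {v \<in> B. - s n < real_of_int (adv E v)}) - 2 * l n) / 2 < c0 * sqrt (real n * ln (real n))}
      \<le> d \<theta>' n"
      unfolding d_def by (rule static_many_bound[OF _ _ g0 tl' elim(3)]) (use elim n1 in auto)
    have l0: "0 \<le> l n" by (simp add: l_def)
    show ?case
      unfolding model_prob_def
      by (rule order_trans[OF _ third_day_prob[OF l0, of "c0 * sqrt (real n * ln (real n))" "s n"]]) (use 1 2 3 err_eq[OF n1(1)] in \<open>simp add: e_def\<close>)
  qed
  moreover have "(\<lambda>n. err n + e n) \<longlonglongrightarrow> 0" using tendsto_add[OF err e] by simp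
  ultimately show ?thesis by (intro tendsto_one_of_error model_prob_le_1)
qed

end

theorem theorem2:
  fixes p q :: real
  assumes "0 < q" and "q < p" and "p \<le> 1"
  shows
    "(\<forall>\<epsilon>>0. \<forall>\<Delta> w. valid_start \<Delta> w \<longrightarrow>
        (\<forall>\<^sub>F n in sequentially. real (\<Delta> n) \<le> (p - q) / q * real n
           - threshold_const p q * sqrt (real n * ln (real n))
           - \<epsilon> * sqrt (real n * (ln (ln (real n)))\<^sup>2 / ln (real n))) \<longrightarrow>
        (\<lambda>n. model_prob p q \<Delta> w n halts) \<longlonglongrightarrow> 1) \<and>
     (\<exists>L0>0. \<forall>L\<ge>L0. \<forall>\<Delta> w. valid_start \<Delta> w \<longrightarrow>
        (\<forall>\<^sub>F n in sequentially. real (\<Delta> n) \<ge> (p - q) / q * real n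
           + L * sqrt (real n * ln (real n))) \<longrightarrow>
        (\<lambda>n. model_prob p q \<Delta> w n (\<lambda>V. plus_wins_on V 1)) \<longlonglongrightarrow> 1) \<and>
     (\<forall>\<delta>>0. \<forall>\<Delta> w. valid_start \<Delta> w \<longrightarrow>
        (\<forall>\<^sub>F n in sequentially. real (\<Delta> n) \<ge> (p - q) / q * real n
           - (threshold_const p q - \<delta>) * sqrt (real n * ln (real n))) \<longrightarrow>
        (\<lambda>n. model_prob p q \<Delta> w n (\<lambda>V. plus_wins_on V 2)) \<longlonglongrightarrow> 1) \<and>
     (\<forall>\<epsilon>>0. \<forall>\<Delta> w. valid_start \<Delta> w \<longrightarrow>
        (\<forall>\<^sub>F n in sequentially. real (\<Delta> n) \<ge> (p - q) / q * real n
           - threshold_const p q * sqrt (real n * ln (real n))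
           + \<epsilon> * sqrt (real n * (ln (ln (real n)))\<^sup>2 / ln (real n))) \<longrightarrow>
        (\<lambda>n. model_prob p q \<Delta> w n (\<lambda>V. plus_wins_on V 3)) \<longlonglongrightarrow> 1) \<and>
     (\<forall>\<Delta> w. valid_start \<Delta> w \<longrightarrow>
        (\<lambda>n. model_prob p q \<Delta> w n minus_wins) \<longlonglongrightarrow> 0)"
proof -
  define \<sigma> where "\<sigma> = sqrt (p * (2 - p - q))"
  interpret rates p q \<sigma> using assms by unfold_locales (simp_all add: \<sigma>_def)
  have st: "started p q \<sigma> \<Delta> w" if "valid_start \<Delta> w" for \<Delta> w
    by (intro started.intro started_axioms.intro rates_axioms that)
  have halt: "(\<lambda>n. model_prob p q \<Delta> w n halts) \<longlonglongrightarrow> 1"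
    if "0 < \<epsilon>" "valid_start \<Delta> w" "\<forall>\<^sub>F n in sequentially. real (\<Delta> n) \<le> (p - q) / q * real n
           - threshold_const p q * sqrt (real n * ln (real n))
           - \<epsilon> * sqrt (real n * (ln (ln (real n)))\<^sup>2 / ln (real n))" for \<epsilon> \<Delta> w
    using started.halts_subcritical[OF st[OF that(2)] that(1)] that(3)
    unfolding threshold_const_eq window_def by blast
  have one: "\<exists>L0>0. \<forall>L\<ge>L0. \<forall>\<Delta> w. valid_start \<Delta> w \<longrightarrow>
        (\<forall>\<^sub>F n in sequentially. real (\<Delta> n) \<ge> (p - q) / q * real n
           + L * sqrt (real n * ln (real n))) \<longrightarrow>
        (\<lambda>n. model_prob p q \<Delta> w n (\<lambda>V. plus_wins_on V 1)) \<longlonglongrightarrow> 1"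
    using started.first_day_supercritical[OF st] pq \<tau>
    by (intro exI[of _ "2 * \<tau> / q"]) auto
  have two: "(\<lambda>n. model_prob p q \<Delta> w n (\<lambda>V. plus_wins_on V 2)) \<longlonglongrightarrow> 1"
    if \<delta>: "0 < \<delta>" and v: "valid_start \<Delta> w" and \<Delta>: "\<forall>\<^sub>F n in sequentially. real (\<Delta> n) \<ge> (p - q) / q * real n
           - (threshold_const p q - \<delta>) * sqrt (real n * ln (real n))" for \<delta> \<Delta> w
  proof -
    \<comment> \<open>The maximum with 1/2 keeps \<open>\<kappa>\<close> positive when
      \<open>\<delta>\<close> is at least the threshold constant.\<close>
    define \<kappa> where "\<kappa> = max (1 - \<delta> * q / \<sigma>) (1 / 2)"
    have \<kappa>: "0 < \<kappa>" "\<kappa> < 1" using \<delta> pq \<sigma> by (auto simp: \<kappa>_def)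
    have "1 - \<delta> * q / \<sigma> \<le> \<kappa>" by (simp add: \<kappa>_def)
    then have "(1 - \<delta> * q / \<sigma>) * (\<sigma> / q) \<le> \<kappa> * (\<sigma> / q)" using pq \<sigma> by (intro mult_right_mono) auto
    moreover have "(1 - \<delta> * q / \<sigma>) * (\<sigma> / q) = \<sigma> / q - \<delta>" using pq \<sigma>(1) by (simp add: field_simps)
    ultimately have le: "\<sigma> / q - \<delta> \<le> \<kappa> * \<sigma> / q" by simp
    have "\<forall>\<^sub>F n in sequentially. real (\<Delta> n) \<ge> (p - q) / q * real n - \<kappa> * \<sigma> / q * sqrt (real n * ln (real n))"
      using \<Delta> eventually_ge_at_top[of 1]
    proof eventually_elim
      case (elim n)
      have "(\<sigma> / q - \<delta>) * sqrt (real n * ln (real n)) \<le> \<kappa> * \<sigma> / q * sqrt (real n * ln (real n))"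
        using le elim(2) by (intro mult_right_mono) auto
      then show ?case using elim(1) unfolding threshold_const_eq by linarith
    qed
    then show ?thesis by (rule started.second_day_supercritical[OF st[OF v] \<kappa>])
  qed
  have three: "(\<lambda>n. model_prob p q \<Delta> w n (\<lambda>V. plus_wins_on V 3)) \<longlonglongrightarrow> 1"
    if "0 < \<epsilon>" "valid_start \<Delta> w" "\<forall>\<^sub>F n in sequentially. real (\<Delta> n) \<ge> (p - q) / q * real n
           - threshold_const p q * sqrt (real n * ln (real n))
           + \<epsilon> * sqrt (real n * (ln (ln (real n)))\<^sup>2 / ln (real n))" for \<epsilon> \<Delta> w
    using started.third_day_supercritical[OF st[OF that(2)] that(1)] that(3)
    unfolding threshold_const_eq window_def by blast
  have minus: "(\<lambda>n. model_prob p q \<Delta> w n minus_wins) \<longlonglongrightarrow> 0" if "valid_start \<Delta> w" for \<Delta> w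
    by (rule started.minus_never_wins[OF st[OF that]])
  show ?thesis
    using halt one two three minus by (intro conjI allI impI) (assumption | blast)+
qed

end
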